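(* Let $N\ge5$, $T>0$, and let $u$ be a solution of $$u_t=\Delta\log u\ \text{ in }\mathbb{R}^N\times(0,T),\qquad u(x,0)=u_0(x)\ \text{ in }\mathbb{R}^N,$$ with initial value $u_0$ satisfying $$B_{k_1}(x,0)\le u_0(x)\le B_{k_2}(x,0)\quad\text{and}\quad u_0(x)=B_{k_0}(x,0)+f(x)\qquad\text{in }\mathbb{R}^N$$ for some constants $k_1>k_2>0$, $k_0>0$ and some $f\in L^1(\mathbb{R}^N)$. Suppose $u$ satisfies $B_{k_1}(x,t)\le u(x,t)\le B_{k_2}(x,t)$ in $\mathbb{R}^N\times(0,T)$. Then the rescaled function $\widetilde u(\cdot,s)$ converges, uniformly on $\mathbb{R}^N$ and in the weighted space $L^1(\widetilde B^{\frac{N-4}{2}},\mathbb{R}^N)$, to the rescaled Barenblatt solution $\widetilde B_{k_0}$ as $s\to\infty$.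
   Context: For $k>0$ the Barenblatt solution is $$B_k(x,t)=\frac{2(N-2)(T-t)_+^{\frac{N}{N-2}}}{k+(T-t)_+^{\frac{2}{N-2}}|x|^2},\qquad a_+=\max(a,0),$$ and the rescaled Barenblatt solution is $\widetilde B_k(x)=\dfrac{2(N-2)}{k+|x|^2}$. A solution of the Cauchy problem $u_t=\Delta\log u$ in $\mathbb{R}^N\times(0,T)$, $u(x,0)=u_0(x)$ (with $u_0\ge 0$ locally integrable) is a function $u>0$ in $\mathbb{R}^N\times(0,T)$ satisfying the equation in the classical sense, with $u(\cdot,t)\to u_0$ in $L^1_{loc}(\mathbb{R}^N)$ as $t\to0$. The rescaled function is $$\widetilde u(x,s)=\frac{1}{(T-t)^{\frac{N}{N-2}}}\,u\!\left(\frac{x}{(T-t)^{\frac1{N-2}}},t\right),\qquad s=-\log(T-t),\quad s>-\log T.$$ For $\alpha>0$, $L^1(\widetilde B^{\alpha},\mathbb{R}^N)$ is the weighted $L^1$-space with weight $\widetilde B^{\alpha}(x)=\left(\frac{2(N-2)}{k_2+|x|^2}\right)^{\alpha}$, i.e. the space of measurable $f$ with $\int_{\mathbb{R}^N}|f(x)|\widetilde B^{\alpha}(x)\,dx<\infty$, with norm given by this integral. *)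

theory Defs
  imports "HOL-Analysis.Analysis"
begin

definition barenblatt :: "real \<Rightarrow> real \<Rightarrow> 'a::euclidean_space \<Rightarrow> real \<Rightarrow> real" where
  "barenblatt T k x t =
     2 * (real DIM('a) - 2) * (max 0 (T - t)) powr (real DIM('a) / (real DIM('a) - 2))
       / (k + (max 0 (T - t)) powr (2 / (real DIM('a) - 2)) * (norm x)\<^sup>2)"

definition rescaled_barenblatt :: "real \<Rightarrow> 'a::euclidean_space \<Rightarrow> real" where
  "rescaled_barenblatt k x = 2 * (real DIM('a) - 2) / (k + (norm x)\<^sup>2)"

definition partial_deriv :: "'a::euclidean_space \<Rightarrow> ('a \<Rightarrow> real) \<Rightarrow> 'a \<Rightarrow> real" where
  "partial_deriv b f x = deriv (\<lambda>h. f (x + h *\<^sub>R b)) 0"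

definition has_partial :: "'a::euclidean_space \<Rightarrow> ('a \<Rightarrow> real) \<Rightarrow> 'a \<Rightarrow> bool" where
  "has_partial b f x \<longleftrightarrow> (\<lambda>h. f (x + h *\<^sub>R b)) differentiable (at 0)"

definition laplacian :: "('a::euclidean_space \<Rightarrow> real) \<Rightarrow> 'a \<Rightarrow> real" where
  "laplacian f x = (\<Sum>b\<in>Basis. partial_deriv b (partial_deriv b f) x)"

text \<open>
  The parabolic class \<open>C\<^sup>2\<^sup>,\<^sup>1\<close> on \<open>\<real>\<^sup>N \<times> (0,T)\<close>: the function, its spatial partial derivatives
  of order one and two, and its time derivative all exist and are jointly continuous.
  Existence is required separately because \<^const>\<open>deriv\<close> is total.
\<close>
definition parabolic_C21 :: "real \<Rightarrow> ('a::euclidean_space \<Rightarrow> real \<Rightarrow> real) \<Rightarrow> bool" where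
  "parabolic_C21 T u \<longleftrightarrow>
     continuous_on (UNIV \<times> {0<..<T}) (\<lambda>(x, t). u x t) \<and>
     (\<forall>x. \<forall>t\<in>{0<..<T}. (\<lambda>\<tau>. u x \<tau>) differentiable (at t)) \<and>
     continuous_on (UNIV \<times> {0<..<T}) (\<lambda>(x, t). deriv (\<lambda>\<tau>. u x \<tau>) t) \<and>
     (\<forall>b\<in>Basis.
        (\<forall>x. \<forall>t\<in>{0<..<T}. has_partial b (\<lambda>y. u y t) x) \<and>
        continuous_on (UNIV \<times> {0<..<T}) (\<lambda>(x, t). partial_deriv b (\<lambda>y. u y t) x)) \<and>
     (\<forall>b\<in>Basis. \<forall>c\<in>Basis.
        (\<forall>x. \<forall>t\<in>{0<..<T}. has_partial c (partial_deriv b (\<lambda>y. u y t)) x) \<and>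
        continuous_on (UNIV \<times> {0<..<T})
          (\<lambda>(x, t). partial_deriv c (partial_deriv b (\<lambda>y. u y t)) x))"

definition locally_integrable :: "('a::euclidean_space \<Rightarrow> real) \<Rightarrow> bool" where
  "locally_integrable f \<longleftrightarrow> (\<forall>K. compact K \<longrightarrow> set_integrable lebesgue K f)"

text \<open>
  The Bochner integral of a non-integrable function is 0, but this cannot happen in the last
  conjunct: \<open>u0\<close> is locally integrable and each \<open>u(\<cdot>,t)\<close> is continuous.
\<close>
definition log_diffusion_solution ::
  "real \<Rightarrow> ('a::euclidean_space \<Rightarrow> real) \<Rightarrow> ('a \<Rightarrow> real \<Rightarrow> real) \<Rightarrow> bool" where
  "log_diffusion_solution T u0 u \<longleftrightarrow>
     locally_integrable u0 \<and> (AE x in lebesgue. 0 \<le> u0 x) \<and>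
     (\<forall>x. \<forall>t\<in>{0<..<T}. 0 < u x t) \<and>
     parabolic_C21 T u \<and>
     (\<forall>x. \<forall>t\<in>{0<..<T}. deriv (\<lambda>\<tau>. u x \<tau>) t = laplacian (\<lambda>y. ln (u y t)) x) \<and>
     (\<forall>K. compact K \<longrightarrow>
        ((\<lambda>t. LINT x:K|lebesgue. \<bar>u x t - u0 x\<bar>) \<longlongrightarrow> 0) (at_right 0))"

text \<open>Here \<open>T - t = exp (-s)\<close>; the time range \<open>0 < t < T\<close> is \<open>s > - ln T\<close>.\<close>
definition rescaled ::
  "real \<Rightarrow> ('a::euclidean_space \<Rightarrow> real \<Rightarrow> real) \<Rightarrow> 'a \<Rightarrow> real \<Rightarrow> real" where
  "rescaled T u x s =
     (let t = T - exp (- s) in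
        1 / (T - t) powr (real DIM('a) / (real DIM('a) - 2))
          * u (x /\<^sub>R (T - t) powr (1 / (real DIM('a) - 2))) t)"

definition weighted_L1 :: "('a::euclidean_space \<Rightarrow> real) \<Rightarrow> ('a \<Rightarrow> real) set" where
  "weighted_L1 w =
     {f. f \<in> borel_measurable lebesgue \<and> integrable lebesgue (\<lambda>x. \<bar>f x\<bar> * w x)}"

definition weighted_L1_norm :: "('a::euclidean_space \<Rightarrow> real) \<Rightarrow> ('a \<Rightarrow> real) \<Rightarrow> real" where
  "weighted_L1_norm w f = (LINT x|lebesgue. \<bar>f x\<bar> * w x)"

text \<open>
  Only the difference is required to lie in the space. For the weight
  \<open>rescaled_barenblatt k powr ((N - 4) / 2)\<close> the profile \<open>rescaled_barenblatt k0\<close> itself does not: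
  the product decays like \<open>|x|\<close> to the power \<open>-(N - 2)\<close>.
\<close>
definition tendsto_weighted_L1 ::
  "('a::euclidean_space \<Rightarrow> real) \<Rightarrow> ('s \<Rightarrow> 'a \<Rightarrow> real) \<Rightarrow> ('a \<Rightarrow> real) \<Rightarrow> 's filter \<Rightarrow> bool" where
  "tendsto_weighted_L1 w F g A \<longleftrightarrow>
     (\<forall>\<^sub>F s in A. (\<lambda>x. F s x - g x) \<in> weighted_L1 w) \<and>
     ((\<lambda>s. weighted_L1_norm w (\<lambda>x. F s x - g x)) \<longlongrightarrow> 0) A"

end

theory Submission
  imports Defs
begin

text \<open>
  Write \<open>B\<close> for the Barenblatt solution with parameter \<open>k0\<close>, \<open>q = u - B\<close> and \<open>g = ln u - ln B\<close>, so that
  \<open>q\<^sub>t = \<Delta>g\<close>. Kato's inequality yields \<open>d/dt \<integral>\<bar>q\<bar>\<phi> \<le> \<integral>(\<bar>g\<bar>\<Delta>\<phi> + \<bar>q\<bar>\<phi>\<^sub>t)\<close> for nonnegative test functions.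
  Superharmonic weights tending to 1 give the \<open>L\<^sup>1\<close> contraction \<open>\<integral>\<bar>q(t)\<bar> \<le> \<integral>\<bar>f\<bar>\<close>. In the rescaled variable \<open>y\<close>
  the weight \<open>(k + \<bar>y\<bar>\<^sup>2)\<^sup>-\<^sup>\<alpha>\<close> with \<open>0 < \<alpha> < (N-4)/2\<close> (this is where \<open>N \<ge> 5\<close> enters) turns the right-hand side
  into a negative multiple of the left-hand side, so the weighted \<open>L\<^sup>1\<close> norm decays exponentially in \<open>s\<close>.

  Uniform convergence is obtained without parabolic regularity theory. Comparing \<open>u(x,t)\<close> with the solution
  \<open>u(x,ct)/c\<close>, \<open>c > 1\<close>, shows that \<open>u/t\<close> is nonincreasing in \<open>t\<close>; hence \<open>g\<close> is almost monotone on time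
  windows \<open>[t\<^sub>a, t\<^sub>b]\<close> that are short relative to \<open>T - t\<^sub>b\<close>. The integral of \<open>g\<close> over such a window has the
  bounded Laplacian \<open>q(t\<^sub>b) - q(t\<^sub>a)\<close>, so a mean value inequality bounds it pointwise by the decaying weighted
  \<open>L\<^sup>1\<close> norm, and almost monotonicity transfers the bound to \<open>g\<close> at both ends of the window.
\<close>

section \<open>Green's identity and Kato's inequality\<close>

text \<open>The order of the two weighted estimates is forced. Each use of Kato's inequality cuts
  off at a radius R and leaves an error of size R^-2 times the integral of |g| times the weight over
  that ball. The pinching only gives |g| <= C / (1 + |x|^2), so for a weight of exponent -\<alpha>
  this error vanishes only if \<alpha> > (N-4)/2, just outside the range where rescaling produces
  decay. Superharmonicity allows \<alpha> up to (N-2)/2, which leaves room for (N-3)/2 in the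
  contraction estimate. Once the unweighted norm of q is known to be finite, |g| can be exchanged
  for (1 + |x|^2) |q|, and the cutoff error also vanishes for small positive \<alpha>. The
  unweighted norm is invariant under the rescaling, so contraction alone gives no decay. The
  exponent (N-4)/2 of the claim is the endpoint without decay; its weight is dominated by the one
  with \<alpha> = 1/4. For the uniform limit a bound on g is needed only on bounded sets of y, since
  all pinched profiles are at most C / (1 + |y|^2) uniformly in s.\<close>

definition c2_along_basis :: "('a::euclidean_space \<Rightarrow> real) \<Rightarrow> ('a \<Rightarrow> 'a \<Rightarrow> real) \<Rightarrow> ('a \<Rightarrow> 'a \<Rightarrow> real) \<Rightarrow> bool" where
  "c2_along_basis v p pp \<longleftrightarrow> continuous_on UNIV v \<and>
     (\<forall>b\<in>Basis. continuous_on UNIV (p b) \<and> continuous_on UNIV (pp b) \<and>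
       (\<forall>x. ((\<lambda>h. v (x + h *\<^sub>R b)) has_real_derivative p b x) (at 0) \<and>
            ((\<lambda>h. p b (x + h *\<^sub>R b)) has_real_derivative pp b x) (at 0)))"

lemma c2_along_basisD:
  assumes "c2_along_basis v p pp" "b \<in> Basis"
  shows "continuous_on UNIV (p b)" "continuous_on UNIV (pp b)"
    "((\<lambda>h. v (x + h *\<^sub>R b)) has_real_derivative p b x) (at 0)"
    "((\<lambda>h. p b (x + h *\<^sub>R b)) has_real_derivative pp b x) (at 0)"
  using assms by (auto simp: c2_along_basis_def)

lemma c2_along_basis_continuous: "c2_along_basis v p pp \<Longrightarrow> continuous_on UNIV v"
  by (simp add: c2_along_basis_def)

lemma c2_along_basis_diff:
  assumes "c2_along_basis v p pp" "c2_along_basis w q qq"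
  shows "c2_along_basis (\<lambda>x. v x - w x) (\<lambda>b x. p b x - q b x) (\<lambda>b x. pp b x - qq b x)"
  using assms unfolding c2_along_basis_def
  by (auto intro!: continuous_intros derivative_intros)

section \<open>Integration by parts along one direction\<close>

lemma integrable_compact_support:
  fixes F :: "'a::euclidean_space \<Rightarrow> real"
  assumes "continuous_on UNIV F" and "\<And>x. R \<le> norm x \<Longrightarrow> F x = 0"
  shows "integrable lborel F"
proof -
  have "integrable lborel (\<lambda>x. indicator (cball 0 R) x *\<^sub>R F x)"
    by (rule borel_integrable_compact) (use assms in \<open>auto intro: continuous_on_subset\<close>)
  moreover have "(\<lambda>x. indicator (cball 0 R) x *\<^sub>R F x) = F"
    using assms(2) by (fastforce simp: indicator_def)
  ultimately show ?thesis by simp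
qed

lemma lborel_integral_translate:
  fixes F :: "'a::euclidean_space \<Rightarrow> real"
  assumes "F \<in> borel_measurable borel"
  shows "(\<integral>x. F (x + c) \<partial>lborel) = (\<integral>x. F x \<partial>lborel)"
proof -
  have "(\<integral>x. F x \<partial>lborel) = (\<integral>x. F x \<partial>distr lborel borel ((+) c))"
    by (simp add: lborel_distr_plus)
  also have "\<dots> = (\<integral>x. F (c + x) \<partial>lborel)"
    using assms by (subst integral_distr) auto
  finally show ?thesis by (simp add: add.commute)
qed

lemma bounded_of_compact_support:
  fixes F :: "'a::euclidean_space \<Rightarrow> real"
  assumes "continuous_on UNIV F" and "\<And>x. R \<le> norm x \<Longrightarrow> F x = 0"
  obtains C where "0 \<le> C" "\<And>x. \<bar>F x\<bar> \<le> C"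
proof -
  have "compact (F ` cball 0 R)"
    using assms by (intro compact_continuous_image) (auto intro: continuous_on_subset)
  then obtain B where B: "\<And>x. x \<in> cball 0 R \<Longrightarrow> \<bar>F x\<bar> \<le> B"
    using compact_imp_bounded by (force simp: bounded_iff)
  have "\<bar>F x\<bar> \<le> max 0 B" for x
    using B[of x] assms(2)[of x] by (cases "norm x \<le> R") auto
  then show ?thesis by (intro that[of "max 0 B"]) auto
qed

lemma has_derivative_along_line:
  fixes F :: "'a::real_vector \<Rightarrow> real"
  assumes "\<And>x. ((\<lambda>h. F (x + h *\<^sub>R b)) has_real_derivative F' x) (at 0)"
  shows "((\<lambda>h. F (x + h *\<^sub>R b)) has_real_derivative F' (x + s *\<^sub>R b)) (at s)"
proof -
  have eq: "(\<lambda>h. F (x + s *\<^sub>R b + h *\<^sub>R b)) = (\<lambda>h. F (x + (h + s) *\<^sub>R b))"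
    by (simp add: scaleR_left_distrib add_ac)
  have "((\<lambda>h. F (x + (h + s) *\<^sub>R b)) has_real_derivative F' (x + s *\<^sub>R b)) (at 0)"
    using assms[of "x + s *\<^sub>R b"] unfolding eq .
  then show ?thesis
    using DERIV_shift[of "\<lambda>h. F (x + h *\<^sub>R b)" "F' (x + s *\<^sub>R b)" 0 s] by simp
qed

text \<open>Translation invariance makes every difference quotient of \<open>F\<close> integrate to
  0; dominated convergence carries this over to the directional derivative, without splitting the
  integral into coordinates.\<close>

lemma integral_directional_derivative_eq_0:
  fixes F :: "'a::euclidean_space \<Rightarrow> real"
  assumes F: "continuous_on UNIV F" and F': "continuous_on UNIV F'"
    and der: "\<And>x. ((\<lambda>h. F (x + h *\<^sub>R b)) has_real_derivative F' x) (at 0)"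
    and supp: "\<And>x. R \<le> norm x \<Longrightarrow> F x = 0" "\<And>x. R \<le> norm x \<Longrightarrow> F' x = 0"
  shows "(\<integral>x. F' x \<partial>lborel) = 0"
proof -
  define e where "e n = 1 / real (Suc n)" for n
  define D where "D n x = (F (x + e n *\<^sub>R b) - F x) / e n" for n x
  have e: "e n > 0" "e n \<le> 1" for n by (auto simp: e_def)
  obtain C where C: "0 \<le> C" "\<And>x. \<bar>F' x\<bar> \<le> C"
    using bounded_of_compact_support[OF F' supp(2)] by metis
  have [measurable]: "F \<in> borel_measurable borel" "F' \<in> borel_measurable borel"
    using F F' by (auto intro: borel_measurable_continuous_onI)
  \<comment> \<open>The step sizes are at most 1, so a translate of the support stays within
    \<open>R + norm b\<close>; inside, the mean value theorem bounds the quotient by the bound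
    \<open>C\<close> for the derivative.\<close>
  have bound: "\<bar>D n x\<bar> \<le> C * indicator (cball 0 (R + norm b)) x" for n x
  proof (cases "norm x \<le> R + norm b")
    case True
    have "\<exists>z. 0 < z \<and> z < e n \<and> F (x + e n *\<^sub>R b) - F (x + 0 *\<^sub>R b) = (e n - 0) * F' (x + z *\<^sub>R b)"
      by (rule MVT2) (use e has_derivative_along_line[OF der] in auto)
    then obtain z where "F (x + e n *\<^sub>R b) - F x = e n * F' (x + z *\<^sub>R b)" by auto
    then have "D n x = F' (x + z *\<^sub>R b)" using e[of n] by (simp add: D_def)
    then show ?thesis using C(2) True by simp
  next
    case False
    have "norm x \<le> norm (x + e n *\<^sub>R b) + norm (e n *\<^sub>R b)"
      by (metis add_diff_cancel_right' norm_triangle_ineq4)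
    also have "norm (e n *\<^sub>R b) \<le> norm b"
      using e[of n] by (simp add: mult_left_le_one_le)
    finally have "R \<le> norm (x + e n *\<^sub>R b)" using False by simp
    moreover have "R \<le> norm x" using False norm_ge_zero[of b] by linarith
    ultimately show ?thesis using False by (simp add: D_def supp)
  qed
  have lim: "(\<lambda>n. D n x) \<longlonglongrightarrow> F' x" for x
  proof -
    have "((\<lambda>h. (F (x + h *\<^sub>R b) - F x) / h) \<longlongrightarrow> F' x) (at 0)"
      using der[of x] by (simp add: DERIV_def)
    moreover have "filterlim e (at 0) sequentially"
      unfolding filterlim_at e_def using LIMSEQ_Suc[OF lim_inverse_n'] by auto
    ultimately show ?thesis
      unfolding D_def by (rule filterlim_compose)
  qed
  have "(\<lambda>n. \<integral>x. D n x \<partial>lborel) \<longlonglongrightarrow> (\<integral>x. F' x \<partial>lborel)"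
  proof (rule integral_dominated_convergence[where w="\<lambda>x. C * indicator (cball 0 (R + norm b)) x"])
    show "integrable lborel (\<lambda>x. C * indicator (cball 0 (R + norm b)) x :: real)"
      by (intro integrable_mult_right integrable_real_indicator) (use emeasure_bounded_finite[OF bounded_cball] in auto)
  qed (use lim bound in \<open>auto simp: D_def\<close>)
  moreover have "(\<integral>x. D n x \<partial>lborel) = 0" for n
  proof -
    have i: "integrable lborel F" by (rule integrable_compact_support[OF F supp(1)])
    have "integrable lborel (\<lambda>x. F (x + e n *\<^sub>R b))"
    proof (rule integrable_compact_support[where R="R + norm (e n *\<^sub>R b)"])
      show "continuous_on UNIV (\<lambda>x. F (x + e n *\<^sub>R b))"
        by (intro continuous_on_compose2[OF F] continuous_intros) auto
      show "F (x + e n *\<^sub>R b) = 0" if "R + norm (e n *\<^sub>R b) \<le> norm x" for x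
      proof -
        have "norm x \<le> norm (x + e n *\<^sub>R b) + norm (e n *\<^sub>R b)"
          by (metis add_diff_cancel_right' norm_triangle_ineq4)
        then show ?thesis using that by (intro supp) linarith
      qed
    qed
    then show ?thesis using i by (simp add: D_def lborel_integral_translate)
  qed
  ultimately show ?thesis by (simp add: LIMSEQ_const_iff)
qed

definition supported_in_ball :: "real \<Rightarrow> ('a::euclidean_space \<Rightarrow> real) \<Rightarrow> bool" where
  "supported_in_ball R F \<longleftrightarrow> (\<forall>x. R \<le> norm x \<longrightarrow> F x = 0)"

definition c2_test :: "real \<Rightarrow> ('a::euclidean_space \<Rightarrow> real) \<Rightarrow> ('a \<Rightarrow> 'a \<Rightarrow> real) \<Rightarrow> ('a \<Rightarrow> 'a \<Rightarrow> real) \<Rightarrow> bool" where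
  "c2_test R v p pp \<longleftrightarrow> c2_along_basis v p pp \<and> supported_in_ball R v \<and>
     (\<forall>b\<in>Basis. supported_in_ball R (p b) \<and> supported_in_ball R (pp b))"

text \<open>The function \<open>p b * \<phi> - v * q b\<close> has derivative
  \<open>pp b * \<phi> - v * qq b\<close> along \<open>b\<close>, the products of first derivatives
  cancelling, and a derivative of compact support integrates to 0. One direction at a time is enough
  because the Laplacian is a sum over \<open>Basis\<close>.\<close>

lemma green_identity:
  assumes v: "c2_along_basis v p pp" and f: "c2_test R \<phi> q qq" and b: "b \<in> Basis"
  shows "(\<integral>x. pp b x * \<phi> x \<partial>lborel) = (\<integral>x. v x * qq b x \<partial>lborel)"
proof -
  have f1: "c2_along_basis \<phi> q qq" and s: "supported_in_ball R \<phi>" "supported_in_ball R (q b)" "supported_in_ball R (qq b)"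
    using f b by (auto simp: c2_test_def)
  note s' = s[unfolded supported_in_ball_def, rule_format]
  note c = c2_along_basis_continuous[OF v] c2_along_basis_continuous[OF f1]
    c2_along_basisD(1,2)[OF v b] c2_along_basisD(1,2)[OF f1 b]
  have "(\<integral>x. pp b x * \<phi> x - v x * qq b x \<partial>lborel) = 0"
  proof (rule integral_directional_derivative_eq_0[where F="\<lambda>x. p b x * \<phi> x - v x * q b x" and b=b and R=R])
    fix x
    note d = c2_along_basisD(3,4)[OF v b, of x] c2_along_basisD(3,4)[OF f1 b, of x]
    show "((\<lambda>h. p b (x + h *\<^sub>R b) * \<phi> (x + h *\<^sub>R b) - v (x + h *\<^sub>R b) * q b (x + h *\<^sub>R b))
       has_real_derivative pp b x * \<phi> x - v x * qq b x) (at 0)"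
      by (rule derivative_eq_intros d refl)+ (simp add: algebra_simps)
  qed (use c s' in \<open>auto intro!: continuous_intros\<close>)
  moreover have "integrable lborel (\<lambda>x. pp b x * \<phi> x)" "integrable lborel (\<lambda>x. v x * qq b x)"
    by (rule integrable_compact_support[where R=R]; use c s' in \<open>auto intro!: continuous_intros\<close>)+
  ultimately show ?thesis by simp
qed

text \<open>\<open>abs_reg \<sigma> 0\<close> is \<open>\<bar>z\<bar> + \<sigma> z\<close>: the absolute value for \<open>\<sigma> = 0\<close>, twice the positive part for
  \<open>\<sigma> = 1\<close>.\<close>
definition abs_reg :: "real \<Rightarrow> real \<Rightarrow> real \<Rightarrow> real" where
  "abs_reg \<sigma> e z = \<sigma> * z + sqrt (z\<^sup>2 + e)"

definition abs_reg' :: "real \<Rightarrow> real \<Rightarrow> real \<Rightarrow> real" where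
  "abs_reg' \<sigma> e z = \<sigma> + z / sqrt (z\<^sup>2 + e)"

section \<open>Calculus of the smooth approximation of the absolute value\<close>

lemma abs_reg_pos_arg: "0 < e \<Longrightarrow> 0 < z\<^sup>2 + (e::real)"
  by (simp add: add_nonneg_pos)

lemma sqrt_reg_derivative:
  assumes "0 < e" and "(f has_real_derivative f') (at x)"
  shows "((\<lambda>x. sqrt ((f x)\<^sup>2 + e)) has_real_derivative f x * f' / sqrt ((f x)\<^sup>2 + e)) (at x)"
proof -
  have "((\<lambda>x. (f x)\<^sup>2 + e) has_real_derivative 2 * f x * f') (at x)"
    using assms(2) by (auto intro!: derivative_eq_intros)
  from DERIV_chain2[OF DERIV_real_sqrt[OF abs_reg_pos_arg[OF assms(1)]] this]
  show ?thesis by (simp add: field_simps)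
qed

lemma abs_reg_derivative:
  assumes "0 < e" and "(f has_real_derivative f') (at x)"
  shows "((\<lambda>x. abs_reg \<sigma> e (f x)) has_real_derivative abs_reg' \<sigma> e (f x) * f') (at x)"
  using DERIV_add[OF DERIV_cmult[OF assms(2), of \<sigma>] sqrt_reg_derivative[OF assms]]
  by (simp add: abs_reg_def abs_reg'_def algebra_simps)

text \<open>The second derivative found here is positive; this convexity of \<open>abs_reg\<close>
  gives Kato's inequality its sign.\<close>

lemma abs_reg'_derivative:
  assumes "0 < e" and "(f has_real_derivative f') (at x)"
  shows "((\<lambda>x. abs_reg' \<sigma> e (f x)) has_real_derivative e / (sqrt ((f x)\<^sup>2 + e)) ^ 3 * f') (at x)"
proof -
  have p: "0 < (f x)\<^sup>2 + e" using abs_reg_pos_arg[OF assms(1)] .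
  define S where "S = sqrt ((f x)\<^sup>2 + e)"
  have S: "S > 0" "S\<^sup>2 = (f x)\<^sup>2 + e" using p by (auto simp: S_def)
  have "((\<lambda>x. abs_reg' \<sigma> e (f x)) has_real_derivative (f' * S - f x * (f x * f' / S)) / (S * S)) (at x)"
    using DERIV_add[OF DERIV_const[of \<sigma>] DERIV_divide[OF assms(2) sqrt_reg_derivative[OF assms]]] S
    by (simp add: abs_reg'_def S_def)
  moreover have "(f' * S - f x * (f x * f' / S)) / (S * S) = (S\<^sup>2 - (f x)\<^sup>2) / S ^ 3 * f'"
    using S(1) by (simp add: field_simps power2_eq_square power3_eq_cube)
  ultimately show ?thesis using S by (simp add: S_def)
qed

lemma continuous_on_abs_reg [continuous_intros]:
  "0 < e \<Longrightarrow> continuous_on S f \<Longrightarrow> continuous_on S (\<lambda>x. abs_reg \<sigma> e (f x))"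
  "0 < e \<Longrightarrow> continuous_on S f \<Longrightarrow> continuous_on S (\<lambda>x. abs_reg' \<sigma> e (f x))"
  "continuous_on S f \<Longrightarrow> continuous_on S (\<lambda>x. abs_reg \<sigma> 0 (f x))"
  unfolding abs_reg_def abs_reg'_def
  by (auto intro!: continuous_intros simp: add_nonneg_eq_0_iff)

text \<open>With \<open>j = abs_reg \<sigma> e\<close>, the Laplacian of \<open>j(g)\<close> is
  \<open>j''(g)\<close> times the squared gradient plus \<open>j'(g)\<close> times the Laplacian of
  \<open>g\<close>. By convexity the gradient term is nonnegative against \<open>\<phi>\<close>, and
  Green's identity moves the Laplacian of \<open>j(g)\<close> onto \<open>\<phi>\<close>.\<close>

lemma kato_regularized:
  assumes g: "c2_along_basis g p pp" and f: "c2_test R \<phi> q qq" and pos: "\<And>x. 0 \<le> \<phi> x" and e: "0 < e"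
  shows "(\<integral>x. abs_reg' \<sigma> e (g x) * (\<Sum>b\<in>Basis. pp b x) * \<phi> x \<partial>lborel)
       \<le> (\<integral>x. abs_reg \<sigma> e (g x) * (\<Sum>b\<in>Basis. qq b x) \<partial>lborel)"
proof -
  define j'' where "j'' z = e / (sqrt (z\<^sup>2 + e)) ^ 3" for z
  define GG where "GG b x = j'' (g x) * (p b x)\<^sup>2 + abs_reg' \<sigma> e (g x) * pp b x" for b x
  have cg: "continuous_on UNIV g" by (rule c2_along_basis_continuous[OF g])
  have "sqrt (z\<^sup>2 + e) \<noteq> 0" for z using abs_reg_pos_arg[OF e, of z] by simp
  then have cj: "continuous_on UNIV (\<lambda>x. j'' (g x))"
    unfolding j''_def by (auto intro!: continuous_intros cg)
  have G: "c2_along_basis (\<lambda>x. abs_reg \<sigma> e (g x)) (\<lambda>b x. abs_reg' \<sigma> e (g x) * p b x) GG"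
    unfolding c2_along_basis_def
  proof (intro conjI ballI allI)
    fix b :: 'a assume b: "b \<in> Basis"
    note c = c2_along_basisD(1,2)[OF g b] cg cj
    show "continuous_on UNIV (\<lambda>x. abs_reg' \<sigma> e (g x) * p b x)" "continuous_on UNIV (GG b)"
      unfolding GG_def by (intro continuous_intros c e)+
    fix x
    note d = c2_along_basisD(3,4)[OF g b, of x]
    show "((\<lambda>h. abs_reg \<sigma> e (g (x + h *\<^sub>R b))) has_real_derivative abs_reg' \<sigma> e (g x) * p b x) (at 0)"
      using abs_reg_derivative[OF e d(1)] by simp
    show "((\<lambda>h. abs_reg' \<sigma> e (g (x + h *\<^sub>R b)) * p b (x + h *\<^sub>R b)) has_real_derivative GG b x) (at 0)"
      using DERIV_mult[OF abs_reg'_derivative[OF e d(1), of \<sigma>] d(2)]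
      by (simp add: GG_def j''_def power2_eq_square algebra_simps)
  qed (intro continuous_intros e cg)
  have f1: "c2_along_basis \<phi> q qq" and s: "supported_in_ball R \<phi>"
    "\<And>b. b \<in> Basis \<Longrightarrow> supported_in_ball R (qq b)"
    using f by (auto simp: c2_test_def)
  note s' = s[unfolded supported_in_ball_def, rule_format]
  note cf = c2_along_basis_continuous[OF f1] c2_along_basisD(2)[OF f1]
  have i1: "integrable lborel (\<lambda>x. abs_reg' \<sigma> e (g x) * pp b x * \<phi> x)"
    "integrable lborel (\<lambda>x. GG b x * \<phi> x)" "integrable lborel (\<lambda>x. abs_reg \<sigma> e (g x) * qq b x)" if b: "b \<in> Basis" for b
    by (rule integrable_compact_support[where R=R],
        use c2_along_basisD(2)[OF g b] c2_along_basisD(2)[OF G b] cf b s' in \<open>auto intro!: continuous_intros cg e\<close>)+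
  have "(\<integral>x. abs_reg' \<sigma> e (g x) * (\<Sum>b\<in>Basis. pp b x) * \<phi> x \<partial>lborel)
      = (\<Sum>b\<in>Basis. \<integral>x. abs_reg' \<sigma> e (g x) * pp b x * \<phi> x \<partial>lborel)"
    using i1(1) by (simp add: sum_distrib_left sum_distrib_right)
  also have "\<dots> \<le> (\<Sum>b\<in>Basis. \<integral>x. GG b x * \<phi> x \<partial>lborel)"
  proof (intro sum_mono integral_mono i1)
    fix b x
    have "0 \<le> j'' (g x)" using e by (simp add: j''_def add_nonneg_nonneg)
    then show "abs_reg' \<sigma> e (g x) * pp b x * \<phi> x \<le> GG b x * \<phi> x"
      by (intro mult_right_mono pos) (simp add: GG_def)
  qed
  also have "\<dots> = (\<Sum>b\<in>Basis. \<integral>x. abs_reg \<sigma> e (g x) * qq b x \<partial>lborel)"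
    by (intro sum.cong refl green_identity[OF G f])
  also have "\<dots> = (\<integral>x. abs_reg \<sigma> e (g x) * (\<Sum>b\<in>Basis. qq b x) \<partial>lborel)"
    using i1(3) by (simp add: sum_distrib_left)
  finally show ?thesis .
qed

section \<open>Integral inequality for two solutions\<close>

text \<open>The equation is imposed through the pure second partials of \<open>ln u\<close> at each
  fixed time; joint continuity is asked of \<open>u\<close> and \<open>ut\<close> only. In this form
  it is met by the given solution, by the Barenblatt solutions and by time-scaled copies
  alike.\<close>

definition smooth_positive_solution :: "real \<Rightarrow> ('a::euclidean_space \<Rightarrow> real \<Rightarrow> real) \<Rightarrow> ('a \<Rightarrow> real \<Rightarrow> real) \<Rightarrow> bool" where
  "smooth_positive_solution T u ut \<longleftrightarrow>
     (\<forall>x. \<forall>t\<in>{0<..<T}. 0 < u x t \<and> ((\<lambda>\<tau>. u x \<tau>) has_real_derivative ut x t) (at t)) \<and>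
     continuous_on (UNIV \<times> {0<..<T}) (\<lambda>(x, t). u x t) \<and>
     continuous_on (UNIV \<times> {0<..<T}) (\<lambda>(x, t). ut x t) \<and>
     (\<forall>t\<in>{0<..<T}. \<exists>p pp. c2_along_basis (\<lambda>x. ln (u x t)) p pp \<and> (\<forall>x. ut x t = (\<Sum>b\<in>Basis. pp b x)))"

text \<open>The time derivative is taken within \<open>I\<close>, hence one-sided at the ends of the
  closed windows \<open>{t1..t2}\<close> on which the families are used; \<open>\<phi>L\<close> is
  the spatial Laplacian.\<close>

definition test_family :: "real \<Rightarrow> real set \<Rightarrow> ('a::euclidean_space \<Rightarrow> real \<Rightarrow> real) \<Rightarrow> ('a \<Rightarrow> real \<Rightarrow> real) \<Rightarrow> ('a \<Rightarrow> real \<Rightarrow> real) \<Rightarrow> bool" where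
  "test_family R I \<phi> \<phi>t \<phi>L \<longleftrightarrow>
     (\<forall>t\<in>I. \<exists>q qq. c2_test R (\<lambda>x. \<phi> x t) q qq \<and> (\<forall>x. \<phi>L x t = (\<Sum>b\<in>Basis. qq b x))) \<and>
     (\<forall>x. \<forall>t\<in>I. 0 \<le> \<phi> x t \<and> ((\<lambda>\<tau>. \<phi> x \<tau>) has_real_derivative \<phi>t x t) (at t within I) \<and> (R \<le> norm x \<longrightarrow> \<phi>t x t = 0)) \<and>
     continuous_on (UNIV \<times> I) (\<lambda>(x, t). \<phi> x t) \<and>
     continuous_on (UNIV \<times> I) (\<lambda>(x, t). \<phi>t x t)"

text \<open>Differentiation under the integral sign and the exchange of integrals are carried out
  for gauge integrals over boxes; this is the passage from Lebesgue integrals to those and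
  back.\<close>

lemma lborel_integral_eq_cbox:
  fixes F :: "'a::euclidean_space \<Rightarrow> real"
  assumes "continuous_on UNIV F" "\<And>x. R \<le> norm x \<Longrightarrow> F x = 0" "cball 0 R \<subseteq> cbox a b"
  shows "(\<integral>x. F x \<partial>lborel) = integral (cbox a b) F"
proof -
  have "x \<in> cbox a b" if "F x \<noteq> 0" for x
  proof -
    have "norm x \<le> R" using assms(2)[of x] that by linarith
    then show ?thesis using assms(3) by auto
  qed
  then have "F = (\<lambda>x. if x \<in> cbox a b then F x else 0)" by (auto simp: fun_eq_iff)
  then have "integral UNIV F = integral (cbox a b) F"
    by (metis integral_restrict_UNIV)
  then show ?thesis
    using integral_lborel[OF integrable_compact_support[OF assms(1,2)]] by simp
qed

lemma abs_reg_bound: "0 \<le> e \<Longrightarrow> e \<le> 1 \<Longrightarrow> \<bar>abs_reg \<sigma> e z\<bar> \<le> (\<bar>\<sigma>\<bar> + 1) * \<bar>z\<bar> + 1"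
proof -
  assume e: "0 \<le> e" "e \<le> 1"
  have "sqrt (z\<^sup>2 + e) \<le> \<bar>z\<bar> + 1"
    by (rule real_le_lsqrt) (use e in \<open>auto simp: power2_sum\<close>)
  moreover have "0 \<le> sqrt (z\<^sup>2 + e)" using e by simp
  ultimately show ?thesis unfolding abs_reg_def
    using abs_triangle_ineq[of "\<sigma> * z" "sqrt (z\<^sup>2 + e)"] by (simp add: abs_mult algebra_simps)
qed

lemma abs_reg'_bound: "0 < e \<Longrightarrow> \<bar>abs_reg' \<sigma> e z\<bar> \<le> \<bar>\<sigma>\<bar> + 1"
proof -
  assume e: "0 < e"
  have "\<bar>z\<bar> \<le> sqrt (z\<^sup>2 + e)" using e by (intro real_le_rsqrt) auto
  moreover have "0 < sqrt (z\<^sup>2 + e)" using abs_reg_pos_arg[OF e] by simp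
  ultimately have "\<bar>z / sqrt (z\<^sup>2 + e)\<bar> \<le> 1" by (simp add: abs_divide)
  then show ?thesis unfolding abs_reg'_def by linarith
qed

lemma abs_reg_tendsto:
  assumes "e \<longlonglongrightarrow> 0" shows "(\<lambda>n. abs_reg \<sigma> (e n) z) \<longlonglongrightarrow> abs_reg \<sigma> 0 z"
  unfolding abs_reg_def by (intro tendsto_intros assms)

lemma abs_reg'_tendsto:
  assumes "e \<longlonglongrightarrow> 0" shows "(\<lambda>n. abs_reg' \<sigma> (e n) z) \<longlonglongrightarrow> \<sigma> + sgn z"
proof (cases "z = 0")
  case False
  have "(\<lambda>n. abs_reg' \<sigma> (e n) z) \<longlonglongrightarrow> \<sigma> + z / sqrt (z\<^sup>2 + 0)"
    unfolding abs_reg'_def by (intro tendsto_intros assms) (use False in auto)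
  moreover have "z / sqrt (z\<^sup>2 + 0) = sgn z" using False by (simp add: sgn_if)
  ultimately show ?thesis by metis
qed (simp add: abs_reg'_def)

text \<open>Since \<open>ln\<close> is increasing, \<open>q\<close> and \<open>g\<close> have the
  same sign. This is what lets the time derivative of |q| and Kato's inequality for |g| share one
  sign factor.\<close>

lemma sgn_ln_diff: "0 < a \<Longrightarrow> 0 < b \<Longrightarrow> sgn (ln a - ln b) = sgn (a - b :: real)"
  by (auto simp: sgn_if)

lemma continuous_on_slice:
  assumes "continuous_on (UNIV \<times> I) (\<lambda>(x, t). f x t)" "t \<in> I"
  shows "continuous_on UNIV (\<lambda>x. f x t)"
proof -
  have "continuous_on UNIV (\<lambda>x. (\<lambda>(x, t). f x t) (x, t))"
    by (rule continuous_on_compose2[OF assms(1)]) (use assms(2) in \<open>auto intro!: continuous_intros\<close>)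
  then show ?thesis by simp
qed

lemma continuous_on_swapped:
  assumes "continuous_on (A \<times> I) (\<lambda>(x, t). f x t)" "J \<subseteq> I" "B \<subseteq> A"
  shows "continuous_on (J \<times> B) (\<lambda>z. f (snd z) (fst z))"
proof -
  have "continuous_on (J \<times> B) (\<lambda>z. (\<lambda>(x, t). f x t) (snd z, fst z))"
    by (rule continuous_on_compose2[OF assms(1)]) (use assms(2,3) in \<open>auto intro!: continuous_intros\<close>)
  then show ?thesis by simp
qed

lemma bounded_on_compact_slab:
  fixes f :: "'a::euclidean_space \<Rightarrow> real \<Rightarrow> real"
  assumes "continuous_on (J \<times> UNIV) (\<lambda>z. f (snd z) (fst z))" "compact J"
  obtains C where "0 \<le> C" "\<And>x t. norm x \<le> R \<Longrightarrow> t \<in> J \<Longrightarrow> \<bar>f x t\<bar> \<le> C"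
proof -
  have "compact ((\<lambda>z. f (snd z) (fst z)) ` (J \<times> cball 0 R))"
    by (intro compact_continuous_image compact_Times assms compact_cball continuous_on_subset[OF assms(1)]) auto
  then obtain B where B: "\<And>z. z \<in> J \<times> cball 0 R \<Longrightarrow> \<bar>f (snd z) (fst z)\<bar> \<le> B"
    using compact_imp_bounded by (force simp: bounded_iff)
  have "\<bar>f x t\<bar> \<le> max 0 B" if "norm x \<le> R" "t \<in> J" for x t
    using B[of "(t, x)"] that by auto
  then show ?thesis by (intro that[of "max 0 B"]) auto
qed

lemma lborel_dominated_on_ball:
  fixes F :: "nat \<Rightarrow> 'a::euclidean_space \<Rightarrow> real"
  assumes "\<And>n. F n \<in> borel_measurable borel" "G \<in> borel_measurable borel"
    and "\<And>n x. \<bar>F n x\<bar> \<le> C * indicator (cball 0 R) x" and "\<And>x. (\<lambda>n. F n x) \<longlonglongrightarrow> G x"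
  shows "(\<lambda>n. \<integral>x. F n x \<partial>lborel) \<longlonglongrightarrow> (\<integral>x. G x \<partial>lborel)"
proof (rule integral_dominated_convergence[where w="\<lambda>x. C * indicator (cball 0 R) x"])
  show "integrable lborel (\<lambda>x. C * indicator (cball 0 R) x :: real)"
    by (intro integrable_mult_right integrable_real_indicator) (use emeasure_bounded_finite[OF bounded_cball] in auto)
qed (use assms in auto)

text \<open>The parameter \<open>\<sigma>\<close> lets one argument serve twice: the value 0 gives
  the contraction and decay estimates, the value 1 (twice the positive part) the comparison
  principle. The window keeps away from 0 and \<open>T\<close>, and the initial time is reached only
  afterwards by letting \<open>t1\<close> tend to 0.\<close>

locale two_solutions =
  fixes T :: real and u ut v vt :: "'a::euclidean_space \<Rightarrow> real \<Rightarrow> real"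
    and R t1 t2 :: real and \<phi> \<phi>t \<phi>L :: "'a \<Rightarrow> real \<Rightarrow> real" and \<sigma> :: real
  assumes u: "smooth_positive_solution T u ut" and v: "smooth_positive_solution T v vt"
    and \<phi>: "test_family R {t1..t2} \<phi> \<phi>t \<phi>L"
    and t12: "0 < t1" "t1 \<le> t2" "t2 < T"
begin

abbreviation "q \<equiv> \<lambda>x t. u x t - v x t"
abbreviation "qt \<equiv> \<lambda>x t. ut x t - vt x t"
abbreviation "g \<equiv> \<lambda>x t. ln (u x t) - ln (v x t)"

lemma pos: "t \<in> {t1..t2} \<Longrightarrow> 0 < u x t" "t \<in> {t1..t2} \<Longrightarrow> 0 < v x t"
  using u v t12 by (auto simp: smooth_positive_solution_def)

lemma cont:
  "continuous_on ({t1..t2} \<times> UNIV) (\<lambda>z. q (snd z) (fst z))"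
  "continuous_on ({t1..t2} \<times> UNIV) (\<lambda>z. qt (snd z) (fst z))"
  "continuous_on ({t1..t2} \<times> UNIV) (\<lambda>z. \<phi> (snd z) (fst z))"
  "continuous_on ({t1..t2} \<times> UNIV) (\<lambda>z. \<phi>t (snd z) (fst z))"
proof -
  have s: "{t1..t2} \<subseteq> {0<..<T}" using t12 by auto
  show "continuous_on ({t1..t2} \<times> UNIV) (\<lambda>z. q (snd z) (fst z))"
    "continuous_on ({t1..t2} \<times> UNIV) (\<lambda>z. qt (snd z) (fst z))"
    using u v unfolding smooth_positive_solution_def
    by (intro continuous_intros; use continuous_on_swapped[OF _ s subset_UNIV] in blast)+
  show "continuous_on ({t1..t2} \<times> UNIV) (\<lambda>z. \<phi> (snd z) (fst z))"
    "continuous_on ({t1..t2} \<times> UNIV) (\<lambda>z. \<phi>t (snd z) (fst z))"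
    using \<phi> unfolding test_family_def by (auto intro!: continuous_on_swapped)
qed

lemma cont_slice:
  assumes "continuous_on ({t1..t2} \<times> UNIV) (\<lambda>z. f (snd z) (fst z))" "t \<in> {t1..t2}"
  shows "continuous_on UNIV (\<lambda>x. f x t)"
proof -
  have "continuous_on UNIV (\<lambda>x. (\<lambda>z. f (snd z) (fst z)) (t, x))"
    by (rule continuous_on_compose2[OF assms(1)]) (use assms(2) in \<open>auto intro!: continuous_intros\<close>)
  then show ?thesis by simp
qed

lemma supp: "t \<in> {t1..t2} \<Longrightarrow> R \<le> norm x \<Longrightarrow> \<phi> x t = 0" "t \<in> {t1..t2} \<Longrightarrow> R \<le> norm x \<Longrightarrow> \<phi>t x t = 0"
  and nonneg: "t \<in> {t1..t2} \<Longrightarrow> 0 \<le> \<phi> x t"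
  using \<phi> unfolding test_family_def c2_test_def supported_in_ball_def by blast+

definition eps :: "nat \<Rightarrow> real" where "eps n = 1 / real (Suc n)"

lemma eps: "0 < eps n" "eps n \<le> 1" "eps \<longlonglongrightarrow> 0"
  using LIMSEQ_Suc[OF lim_inverse_n'] by (auto simp: eps_def[abs_def])

text \<open>As |q| need not be differentiable in time, the derivative is computed for the
  regularised integral \<open>En\<close>, with density \<open>dEn\<close>; \<open>dE\<close> is the
  pointwise limit of these densities.\<close>

definition "En n t = (\<integral>x. abs_reg \<sigma> (eps n) (q x t) * \<phi> x t \<partial>lborel)"
definition "dEn n x t = abs_reg' \<sigma> (eps n) (q x t) * qt x t * \<phi> x t + abs_reg \<sigma> (eps n) (q x t) * \<phi>t x t"
definition "dE x t = (\<sigma> + sgn (q x t)) * qt x t * \<phi> x t + abs_reg \<sigma> 0 (q x t) * \<phi>t x t"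

lemma dEn_cont: "continuous_on ({t1..t2} \<times> UNIV) (\<lambda>z. dEn n (snd z) (fst z))"
  unfolding dEn_def by (intro continuous_intros cont eps)

lemma En_derivative:
  assumes "t \<in> {t1..t2}"
  shows "(En n has_real_derivative (\<integral>x. dEn n x t \<partial>lborel)) (at t within {t1..t2})"
proof -
  obtain a :: 'a where a: "cball 0 R \<subseteq> cbox (- a) a"
    using bounded_subset_cbox_symmetric[OF bounded_cball] by blast
  have f_cont: "continuous_on ({t1..t2} \<times> UNIV) (\<lambda>z. abs_reg \<sigma> (eps n) (q (snd z) (fst z)) * \<phi> (snd z) (fst z))"
    by (intro continuous_intros cont eps)
  have 1: "En n s = integral (cbox (-a) a) (\<lambda>x. abs_reg \<sigma> (eps n) (q x s) * \<phi> x s)" if "s \<in> {t1..t2}" for s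
    unfolding En_def
    by (rule lborel_integral_eq_cbox[OF _ _ a]) (use that supp cont_slice[OF f_cont] in auto)
  have 2: "(\<integral>x. dEn n x t \<partial>lborel) = integral (cbox (-a) a) (\<lambda>x. dEn n x t)"
    by (rule lborel_integral_eq_cbox[OF _ _ a]) (use assms supp cont_slice[OF dEn_cont] in \<open>auto simp: dEn_def\<close>)
  have "((\<lambda>s. integral (cbox (-a) a) (\<lambda>x. abs_reg \<sigma> (eps n) (q x s) * \<phi> x s)) has_real_derivative
     integral (cbox (-a) a) (\<lambda>x. dEn n x t)) (at t within {t1..t2})"
  proof (rule leibniz_rule_field_derivative[where fx="\<lambda>t x. dEn n x t"])
    fix s x assume s: "s \<in> {t1..t2}"
    have "(u x has_real_derivative ut x s) (at s)" "(v x has_real_derivative vt x s) (at s)"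
      using u v s t12 by (auto simp: smooth_positive_solution_def)
    from DERIV_diff[OF this] have dq: "((\<lambda>s. q x s) has_real_derivative qt x s) (at s within {t1..t2})"
      by (rule DERIV_subset) auto
    have d\<phi>: "((\<lambda>s. \<phi> x s) has_real_derivative \<phi>t x s) (at s within {t1..t2})"
      using \<phi> s by (auto simp: test_family_def)
    have "((abs_reg \<sigma> (eps n)) has_real_derivative abs_reg' \<sigma> (eps n) (q x s) * 1) (at (q x s))"
      by (rule abs_reg_derivative) (use eps in auto)
    then have "((\<lambda>s. abs_reg \<sigma> (eps n) (q x s)) has_real_derivative abs_reg' \<sigma> (eps n) (q x s) * qt x s) (at s within {t1..t2})"
      using DERIV_chain2[OF _ dq] by simp
    from DERIV_mult[OF this d\<phi>]
    show "((\<lambda>s. abs_reg \<sigma> (eps n) (q x s) * \<phi> x s) has_real_derivative dEn n x s) (at s within {t1..t2})"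
      by (simp add: dEn_def algebra_simps)
  next
    fix s assume "s \<in> {t1..t2}"
    then show "(\<lambda>x. abs_reg \<sigma> (eps n) (q x s) * \<phi> x s) integrable_on cbox (- a) a"
      using cont_slice[OF f_cont] by (intro integrable_continuous) (auto intro: continuous_on_subset)
  next
    show "continuous_on ({t1..t2} \<times> cbox (- a) a) (\<lambda>(t, x). dEn n x t)"
      unfolding split_beta by (rule continuous_on_subset[OF dEn_cont]) auto
  qed (use assms in auto)
  then show ?thesis unfolding 2
    by (rule has_field_derivative_transform_within[where d=1]) (use 1 assms in auto)
qed

text \<open>Uniformity in \<open>n\<close> and in \<open>t\<close> serves two dominated
  convergences, one in space and one in time.\<close>

lemma dEn_bound:
  obtains C where "0 \<le> C" "\<And>n x t. t \<in> {t1..t2} \<Longrightarrow> \<bar>dEn n x t\<bar> \<le> C * indicator (cball 0 R) x"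
    "\<And>n x t. t \<in> {t1..t2} \<Longrightarrow> \<bar>abs_reg \<sigma> (eps n) (q x t) * \<phi> x t\<bar> \<le> C * indicator (cball 0 R) x"
proof -
  obtain C1 where c1: "0 \<le> C1" "\<And>x t. norm x \<le> R \<Longrightarrow> t \<in> {t1..t2} \<Longrightarrow> \<bar>q x t\<bar> \<le> C1"
    using bounded_on_compact_slab[where f=q and R=R, OF cont(1) compact_Icc] by blast
  obtain C2 where c2: "0 \<le> C2" "\<And>x t. norm x \<le> R \<Longrightarrow> t \<in> {t1..t2} \<Longrightarrow> \<bar>qt x t\<bar> \<le> C2"
    using bounded_on_compact_slab[where f=qt and R=R, OF cont(2) compact_Icc] by blast
  obtain C3 where c3: "0 \<le> C3" "\<And>x t. norm x \<le> R \<Longrightarrow> t \<in> {t1..t2} \<Longrightarrow> \<bar>\<phi> x t\<bar> \<le> C3"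
    using bounded_on_compact_slab[where f=\<phi> and R=R, OF cont(3) compact_Icc] by blast
  obtain C4 where c4: "0 \<le> C4" "\<And>x t. norm x \<le> R \<Longrightarrow> t \<in> {t1..t2} \<Longrightarrow> \<bar>\<phi>t x t\<bar> \<le> C4"
    using bounded_on_compact_slab[where f=\<phi>t and R=R, OF cont(4) compact_Icc] by blast
  note C = c1(1) c2(1) c3(1) c4(1) c1(2) c2(2) c3(2) c4(2)
  define J where "J = (\<bar>\<sigma>\<bar> + 1) * C1 + 1"
  define C where "C = (\<bar>\<sigma>\<bar> + 1) * C2 * C3 + J * C4 + J * C3"
  have J: "0 \<le> J" using C by (auto simp: J_def)
  have nn: "0 \<le> (\<bar>\<sigma>\<bar> + 1) * C2 * C3" "0 \<le> J * C4" "0 \<le> J * C3" using C J by auto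
  have in_ball: "\<bar>dEn n x t\<bar> \<le> C" "\<bar>abs_reg \<sigma> (eps n) (q x t) * \<phi> x t\<bar> \<le> C"
    if "norm x \<le> R" "t \<in> {t1..t2}" for n x t
  proof -
    have j: "\<bar>abs_reg \<sigma> (eps n) (q x t)\<bar> \<le> J"
      using abs_reg_bound[of "eps n" \<sigma> "q x t"] eps(1,2)[of n] mult_left_mono[OF C(5)[OF that], of "\<bar>\<sigma>\<bar> + 1"]
      by (auto simp: J_def)
    have 1: "\<bar>abs_reg' \<sigma> (eps n) (q x t) * qt x t * \<phi> x t\<bar> \<le> (\<bar>\<sigma>\<bar> + 1) * C2 * C3"
      unfolding abs_mult by (intro mult_mono abs_reg'_bound C that mult_nonneg_nonneg eps) auto
    have 2: "\<bar>abs_reg \<sigma> (eps n) (q x t) * \<phi>t x t\<bar> \<le> J * C4"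
      unfolding abs_mult by (intro mult_mono j C that J) auto
    have 3: "\<bar>abs_reg \<sigma> (eps n) (q x t) * \<phi> x t\<bar> \<le> J * C3"
      unfolding abs_mult by (intro mult_mono j C that J) auto
    show "\<bar>dEn n x t\<bar> \<le> C" "\<bar>abs_reg \<sigma> (eps n) (q x t) * \<phi> x t\<bar> \<le> C"
      using 1 2 3 nn unfolding dEn_def C_def by linarith+
  qed
  show ?thesis
  proof (rule that[of C])
    show "0 \<le> C" using nn by (simp add: C_def)
    fix n x t assume t: "t \<in> {t1..t2}"
    show "\<bar>dEn n x t\<bar> \<le> C * indicator (cball 0 R) x"
      using in_ball(1)[of x t n] supp[OF t, of x] t by (cases "norm x \<le> R") (auto simp: dEn_def)
    show "\<bar>abs_reg \<sigma> (eps n) (q x t) * \<phi> x t\<bar> \<le> C * indicator (cball 0 R) x"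
      using in_ball(2)[of x t n] supp[OF t, of x] t by (cases "norm x \<le> R") auto
  qed
qed

lemma meas:
  assumes "t \<in> {t1..t2}"
  shows "(\<lambda>x. q x t) \<in> borel_measurable borel" "(\<lambda>x. qt x t) \<in> borel_measurable borel"
    "(\<lambda>x. \<phi> x t) \<in> borel_measurable borel" "(\<lambda>x. \<phi>t x t) \<in> borel_measurable borel"
  using cont_slice[OF cont(1) assms] cont_slice[OF cont(2) assms] cont_slice[OF cont(3) assms]
    cont_slice[OF cont(4) assms] by (auto intro: borel_measurable_continuous_onI)

text \<open>Before the limit the two sides do not match: the time derivative carries
  \<open>abs_reg'\<close> of \<open>q\<close>, Kato's inequality carries \<open>abs_reg'\<close> of
  \<open>g\<close>. As the regularisation tends to 0 both factors become
  \<open>\<sigma> + sgn\<close>, and the signs of \<open>q\<close> and \<open>g\<close>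
  agree.\<close>

lemma dE_le:
  assumes t: "t \<in> {t1..t2}"
  shows "(\<integral>x. dE x t \<partial>lborel) \<le> (\<integral>x. abs_reg \<sigma> 0 (g x t) * \<phi>L x t + abs_reg \<sigma> 0 (q x t) * \<phi>t x t \<partial>lborel)"
proof -
  obtain p1 pp1 where p1: "c2_along_basis (\<lambda>x. ln (u x t)) p1 pp1" "\<And>x. ut x t = (\<Sum>b\<in>Basis. pp1 b x)"
    using u t t12 by (force simp: smooth_positive_solution_def)
  obtain p2 pp2 where p2: "c2_along_basis (\<lambda>x. ln (v x t)) p2 pp2" "\<And>x. vt x t = (\<Sum>b\<in>Basis. pp2 b x)"
    using v t t12 by (force simp: smooth_positive_solution_def)
  obtain r rr where r: "c2_test R (\<lambda>x. \<phi> x t) r rr" "\<And>x. \<phi>L x t = (\<Sum>b\<in>Basis. rr b x)"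
    using \<phi> t by (force simp: test_family_def)
  have g: "c2_along_basis (\<lambda>x. g x t) (\<lambda>b x. p1 b x - p2 b x) (\<lambda>b x. pp1 b x - pp2 b x)"
    by (rule c2_along_basis_diff[OF p1(1) p2(1)])
  have cg: "continuous_on UNIV (\<lambda>x. g x t)" by (rule c2_along_basis_continuous[OF g])
  have cL: "continuous_on UNIV (\<lambda>x. \<phi>L x t)" and sL: "\<And>x. R \<le> norm x \<Longrightarrow> \<phi>L x t = 0"
    using r by (auto simp: c2_test_def c2_along_basis_def supported_in_ball_def intro!: continuous_intros)
  note c = cont_slice[OF cont(1) t] cont_slice[OF cont(2) t] cont_slice[OF cont(3) t] cont_slice[OF cont(4) t]
  note [measurable] = meas[OF t]
  have [measurable]: "(\<lambda>x. g x t) \<in> borel_measurable borel" "(\<lambda>x. \<phi>L x t) \<in> borel_measurable borel"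
    using cg cL by (auto intro: borel_measurable_continuous_onI)
  have ineq: "(\<integral>x. abs_reg' \<sigma> (eps n) (g x t) * qt x t * \<phi> x t \<partial>lborel)
      \<le> (\<integral>x. abs_reg \<sigma> (eps n) (g x t) * \<phi>L x t \<partial>lborel)" for n
    using kato_regularized[OF g r(1) nonneg[OF t] eps(1)[of n], of \<sigma>]
    by (simp add: p1(2) p2(2) r(2) sum_subtractf)
  obtain C1 where C1: "0 \<le> C1" "\<And>x. \<bar>qt x t * \<phi> x t\<bar> \<le> C1"
    by (rule bounded_of_compact_support[of "\<lambda>x. qt x t * \<phi> x t" R])
       (use supp[OF t] in \<open>auto intro!: continuous_intros c\<close>)
  obtain C2 where C2: "0 \<le> C2" "\<And>x. \<bar>((\<bar>\<sigma>\<bar> + 1) * \<bar>g x t\<bar> + 1) * \<phi>L x t\<bar> \<le> C2"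
    by (rule bounded_of_compact_support[of "\<lambda>x. ((\<bar>\<sigma>\<bar> + 1) * \<bar>g x t\<bar> + 1) * \<phi>L x t" R])
       (use sL in \<open>auto intro!: continuous_intros cg cL\<close>)
  have "(\<lambda>n. \<integral>x. abs_reg' \<sigma> (eps n) (g x t) * qt x t * \<phi> x t \<partial>lborel)
      \<longlonglongrightarrow> (\<integral>x. (\<sigma> + sgn (g x t)) * qt x t * \<phi> x t \<partial>lborel)"
  proof (rule lborel_dominated_on_ball[where R=R and C="(\<bar>\<sigma>\<bar> + 1) * C1"])
    fix n x
    have "\<bar>abs_reg' \<sigma> (eps n) (g x t) * (qt x t * \<phi> x t)\<bar> \<le> (\<bar>\<sigma>\<bar> + 1) * C1"
      unfolding abs_mult[of "abs_reg' \<sigma> (eps n) (g x t)"] by (intro mult_mono abs_reg'_bound eps C1) auto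
    then show "\<bar>abs_reg' \<sigma> (eps n) (g x t) * qt x t * \<phi> x t\<bar> \<le> (\<bar>\<sigma>\<bar> + 1) * C1 * indicator (cball 0 R) x"
      using supp(1)[OF t, of x] by (cases "norm x \<le> R") (auto simp: mult.assoc)
    show "(\<lambda>n. abs_reg' \<sigma> (eps n) (g x t) * qt x t * \<phi> x t) \<longlonglongrightarrow> (\<sigma> + sgn (g x t)) * qt x t * \<phi> x t" for x
      by (intro tendsto_intros abs_reg'_tendsto eps)
  qed (unfold abs_reg'_def, measurable)
  moreover have "(\<lambda>n. \<integral>x. abs_reg \<sigma> (eps n) (g x t) * \<phi>L x t \<partial>lborel)
      \<longlonglongrightarrow> (\<integral>x. abs_reg \<sigma> 0 (g x t) * \<phi>L x t \<partial>lborel)"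
  proof (rule lborel_dominated_on_ball[where R=R and C=C2])
    fix n x
    have "\<bar>abs_reg \<sigma> (eps n) (g x t) * \<phi>L x t\<bar> \<le> \<bar>((\<bar>\<sigma>\<bar> + 1) * \<bar>g x t\<bar> + 1) * \<phi>L x t\<bar>"
      unfolding abs_mult using abs_reg_bound[of "eps n" \<sigma> "g x t"] eps(1,2)[of n]
      by (intro mult_right_mono) auto
    also have "\<dots> \<le> C2" by (rule C2)
    finally show "\<bar>abs_reg \<sigma> (eps n) (g x t) * \<phi>L x t\<bar> \<le> C2 * indicator (cball 0 R) x"
      using sL[of x] by (cases "norm x \<le> R") auto
    show "(\<lambda>n. abs_reg \<sigma> (eps n) (g x t) * \<phi>L x t) \<longlonglongrightarrow> abs_reg \<sigma> 0 (g x t) * \<phi>L x t" for x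
      by (intro tendsto_intros abs_reg_tendsto eps)
  qed (unfold abs_reg_def, measurable)
  ultimately have 1: "(\<integral>x. (\<sigma> + sgn (g x t)) * qt x t * \<phi> x t \<partial>lborel) \<le> (\<integral>x. abs_reg \<sigma> 0 (g x t) * \<phi>L x t \<partial>lborel)"
    using ineq by (intro LIMSEQ_le) auto
  have i: "integrable lborel (\<lambda>x. abs_reg \<sigma> 0 (q x t) * \<phi>t x t)" "integrable lborel (\<lambda>x. abs_reg \<sigma> 0 (g x t) * \<phi>L x t)"
    by (rule integrable_compact_support[where R=R]; use supp[OF t] sL in \<open>auto intro!: continuous_intros c cg cL\<close>)+
  have "integrable lborel (\<lambda>x. (\<bar>\<sigma>\<bar> + 1) * \<bar>qt x t * \<phi> x t\<bar>)"
    by (rule integrable_compact_support[where R=R]; use supp[OF t] in \<open>auto intro!: continuous_intros c\<close>)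
  then have i2: "integrable lborel (\<lambda>x. (\<sigma> + sgn (g x t)) * (qt x t * \<phi> x t))"
  proof (rule Bochner_Integration.integrable_bound)
    have "\<bar>\<sigma> + sgn (g x t)\<bar> \<le> \<bar>\<sigma>\<bar> + 1" for x by (auto simp: sgn_if)
    then show "AE x in lborel. norm ((\<sigma> + sgn (g x t)) * (qt x t * \<phi> x t)) \<le> norm ((\<bar>\<sigma>\<bar> + 1) * \<bar>qt x t * \<phi> x t\<bar>)"
      by (intro AE_I2) (simp add: abs_mult mult_right_mono)
  qed measurable
  have "(\<integral>x. dE x t \<partial>lborel) = (\<integral>x. (\<sigma> + sgn (g x t)) * (qt x t * \<phi> x t) + abs_reg \<sigma> 0 (q x t) * \<phi>t x t \<partial>lborel)"
    unfolding dE_def by (simp add: sgn_ln_diff pos[OF t] mult.assoc)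
  also have "\<dots> \<le> (\<integral>x. abs_reg \<sigma> 0 (g x t) * \<phi>L x t \<partial>lborel) + (\<integral>x. abs_reg \<sigma> 0 (q x t) * \<phi>t x t \<partial>lborel)"
    using 1 i i2 by (simp add: mult.assoc)
  also have "\<dots> = (\<integral>x. abs_reg \<sigma> 0 (g x t) * \<phi>L x t + abs_reg \<sigma> 0 (q x t) * \<phi>t x t \<partial>lborel)"
    using i by simp
  finally show ?thesis .
qed

text \<open>The fundamental theorem of calculus holds for each \<open>En n\<close>; as
  \<open>n\<close> tends to infinity the integrand becomes the one of \<open>dE_le\<close>, which
  the constant \<open>M\<close> then bounds.\<close>

lemma entropy_inequality:
  assumes M: "\<And>t. t \<in> {t1..t2} \<Longrightarrow>
    (\<integral>x. abs_reg \<sigma> 0 (g x t) * \<phi>L x t + abs_reg \<sigma> 0 (q x t) * \<phi>t x t \<partial>lborel) \<le> M"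
  shows "(\<integral>x. abs_reg \<sigma> 0 (q x t2) * \<phi> x t2 \<partial>lborel)
    \<le> (\<integral>x. abs_reg \<sigma> 0 (q x t1) * \<phi> x t1 \<partial>lborel) + M * (t2 - t1)"
proof -
  obtain C where C: "0 \<le> C" "\<And>n x t. t \<in> {t1..t2} \<Longrightarrow> \<bar>dEn n x t\<bar> \<le> C * indicator (cball 0 R) x"
    "\<And>n x t. t \<in> {t1..t2} \<Longrightarrow> \<bar>abs_reg \<sigma> (eps n) (q x t) * \<phi> x t\<bar> \<le> C * indicator (cball 0 R) x"
    using dEn_bound by metis
  have limE: "(\<lambda>n. En n t) \<longlonglongrightarrow> (\<integral>x. abs_reg \<sigma> 0 (q x t) * \<phi> x t \<partial>lborel)" if t: "t \<in> {t1..t2}" for t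
  proof -
    note [measurable] = meas[OF t]
    show ?thesis unfolding En_def
    proof (rule lborel_dominated_on_ball[where R=R and C=C])
      show "(\<lambda>n. abs_reg \<sigma> (eps n) (q x t) * \<phi> x t) \<longlonglongrightarrow> abs_reg \<sigma> 0 (q x t) * \<phi> x t" for x
        by (intro tendsto_intros abs_reg_tendsto eps)
    qed (use C(3)[OF t] in \<open>unfold abs_reg_def, measurable\<close>)
  qed
  have limD: "(\<lambda>n. \<integral>x. dEn n x t \<partial>lborel) \<longlonglongrightarrow> (\<integral>x. dE x t \<partial>lborel)" if t: "t \<in> {t1..t2}" for t
  proof -
    note [measurable] = meas[OF t]
    show ?thesis
    proof (rule lborel_dominated_on_ball[where R=R and C=C])
      show "(\<lambda>n. dEn n x t) \<longlonglongrightarrow> dE x t" for x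
        unfolding dEn_def dE_def by (intro tendsto_intros abs_reg_tendsto abs_reg'_tendsto eps)
    qed (use C(2)[OF t] in \<open>unfold dE_def dEn_def abs_reg_def abs_reg'_def, measurable\<close>)
  qed
  define K where "K = (\<integral>x. C * indicator (cball (0::'a) R) x \<partial>lborel)"
  have iC: "integrable lborel (\<lambda>x. C * indicator (cball (0::'a) R) x :: real)"
    by (intro integrable_mult_right integrable_real_indicator) (use emeasure_bounded_finite[OF bounded_cball] in auto)
  have bd: "norm (\<integral>x. dEn n x t \<partial>lborel) \<le> K" if t: "t \<in> {t1..t2}" for n t
  proof -
    have c: "continuous_on UNIV (\<lambda>x. dEn n x t)" by (rule cont_slice[OF dEn_cont t])
    have "integrable lborel (\<lambda>x. dEn n x t)"
      by (rule integrable_compact_support[where R=R]) (use c supp[OF t] in \<open>auto simp: dEn_def\<close>)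
    then show ?thesis unfolding K_def
      by (intro order.trans[OF integral_norm_bound] integral_mono iC integrable_norm) (use C(2)[OF t] in auto)
  qed
  have ftc: "((\<lambda>t. \<integral>x. dEn n x t \<partial>lborel) has_integral (En n t2 - En n t1)) {t1..t2}" for n
    by (rule fundamental_theorem_of_calculus[OF t12(2)])
       (use En_derivative in \<open>simp add: has_real_derivative_iff_has_vector_derivative\<close>)
  \<comment> \<open>Dominated convergence also supplies integrability in time of the limit, whose
    integrand contains \<open>sgn\<close> and need not be continuous.\<close>
  have dc: "(\<lambda>t. \<integral>x. dE x t \<partial>lborel) integrable_on {t1..t2}"
    "(\<lambda>n. integral {t1..t2} (\<lambda>t. \<integral>x. dEn n x t \<partial>lborel)) \<longlonglongrightarrow> integral {t1..t2} (\<lambda>t. \<integral>x. dE x t \<partial>lborel)"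
    by (rule dominated_convergence[where h="\<lambda>_. K" and f="\<lambda>n t. \<integral>x. dEn n x t \<partial>lborel"]; use ftc bd limD in \<open>auto simp: integrable_on_def\<close>)+
  have "(\<lambda>n. En n t2 - En n t1) \<longlonglongrightarrow> integral {t1..t2} (\<lambda>t. \<integral>x. dE x t \<partial>lborel)"
    using dc(2) integral_unique[OF ftc] by simp
  moreover have "(\<lambda>n. En n t2 - En n t1) \<longlonglongrightarrow> (\<integral>x. abs_reg \<sigma> 0 (q x t2) * \<phi> x t2 \<partial>lborel) - (\<integral>x. abs_reg \<sigma> 0 (q x t1) * \<phi> x t1 \<partial>lborel)"
    by (intro tendsto_intros limE) (use t12 in auto)
  ultimately have "(\<integral>x. abs_reg \<sigma> 0 (q x t2) * \<phi> x t2 \<partial>lborel) - (\<integral>x. abs_reg \<sigma> 0 (q x t1) * \<phi> x t1 \<partial>lborel)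
     = integral {t1..t2} (\<lambda>t. \<integral>x. dE x t \<partial>lborel)"
    using LIMSEQ_unique by blast
  also have "\<dots> \<le> integral {t1..t2} (\<lambda>t. M)"
    by (rule integral_le[OF dc(1)]) (use order.trans[OF dE_le M] in auto)
  also have "\<dots> = M * (t2 - t1)" using t12 by simp
  finally show ?thesis by simp
qed

end

section \<open>Classical solutions and Barenblatt solutions\<close>

lemma smooth_positive_solution_restrict:
  assumes "smooth_positive_solution T u ut" "T' \<le> T"
  shows "smooth_positive_solution T' u ut"
proof -
  have "UNIV \<times> {0<..<T'} \<subseteq> UNIV \<times> {0<..<T}" using assms(2) by auto
  then show ?thesis using assms unfolding smooth_positive_solution_def
    by (auto intro: continuous_on_subset)
qed

text \<open>The logarithm turns the factor \<open>1 / c\<close> into an additive constant, invisible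
  to the Laplacian, while the chain rule in time produces a factor \<open>c\<close> that cancels
  it.\<close>

lemma smooth_positive_solution_scale:
  assumes u: "smooth_positive_solution T u ut" and c: "0 < c"
  shows "smooth_positive_solution (T / c) (\<lambda>x t. u x (c * t) / c) (\<lambda>x t. ut x (c * t))"
  unfolding smooth_positive_solution_def
proof (intro conjI allI ballI)
  have I: "c * t \<in> {0<..<T}" if "t \<in> {0<..<T / c}" for t
    using that c by (auto simp: field_simps)
  fix x t assume t: "t \<in> {0<..<T / c}"
  show "0 < u x (c * t) / c"
    using u I[OF t] c by (auto simp: smooth_positive_solution_def)
  have "(u x has_real_derivative ut x (c * t)) (at (c * t))"
    using u I[OF t] by (auto simp: smooth_positive_solution_def)
  moreover have "((\<lambda>t. c * t) has_real_derivative c) (at t)"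
    by (auto intro!: derivative_eq_intros)
  ultimately have "((\<lambda>t. u x (c * t)) has_real_derivative ut x (c * t) * c) (at t)"
    by (rule DERIV_chain2)
  from DERIV_cdivide[OF this, of c]
  show "((\<lambda>\<tau>. u x (c * \<tau>) / c) has_real_derivative ut x (c * t)) (at t)"
    using c by simp
next
  have I: "c * t \<in> {0<..<T}" if "t \<in> {0<..<T / c}" for t
    using that c by (auto simp: field_simps)
  have *: "continuous_on (UNIV \<times> {0<..<T / c}) (\<lambda>(x, t). h x (c * t))"
    if h: "continuous_on (UNIV \<times> {0<..<T}) (\<lambda>(x, t). h x t :: real)" for h
  proof -
    have "continuous_on (UNIV \<times> {0<..<T / c}) (\<lambda>z. (\<lambda>(x, t). h x t) (fst z, c * snd z))"
      by (rule continuous_on_compose2[OF h]) (use I in \<open>auto intro!: continuous_intros\<close>)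
    then show ?thesis by (simp add: split_beta)
  qed
  show "continuous_on (UNIV \<times> {0<..<T / c}) (\<lambda>(x, t). ut x (c * t))"
    using u by (auto simp: smooth_positive_solution_def intro!: *)
  have "continuous_on (UNIV \<times> {0<..<T / c}) (\<lambda>(x, t). u x (c * t))"
    using u by (auto simp: smooth_positive_solution_def intro!: *)
  then show "continuous_on (UNIV \<times> {0<..<T / c}) (\<lambda>(x, t). u x (c * t) / c)"
    unfolding split_beta by (intro continuous_intros) (use c in auto)
  fix t assume t: "t \<in> {0<..<T / c}"
  obtain p pp where p: "c2_along_basis (\<lambda>x. ln (u x (c * t))) p pp" "\<And>x. ut x (c * t) = (\<Sum>b\<in>Basis. pp b x)"
    using u I[OF t] unfolding smooth_positive_solution_def by blast
  have pos: "0 < u x (c * t)" for x using u I[OF t] by (auto simp: smooth_positive_solution_def)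
  have eq: "(\<lambda>x. ln (u x (c * t) / c)) = (\<lambda>x. ln (u x (c * t)) - ln c)"
  proof
    show "ln (u x (c * t) / c) = ln (u x (c * t)) - ln c" for x
      using pos[of x] c by (simp add: ln_div)
  qed
  have "c2_along_basis (\<lambda>x. ln (u x (c * t)) - ln c) p pp"
    using p(1) unfolding c2_along_basis_def
    by (auto intro!: continuous_intros simp: DERIV_cdivide
        intro: DERIV_diff[OF _ DERIV_const, simplified])
  then show "\<exists>p pp. c2_along_basis (\<lambda>x. ln (u x (c * t) / c)) p pp \<and> (\<forall>x. ut x (c * t) = (\<Sum>b\<in>Basis. pp b x))"
    using p(2) unfolding eq by blast
qed

text \<open>Positivity transfers the parabolic regularity from \<open>u\<close> to
  \<open>ln u\<close>; \<open>p\<close> and \<open>pp\<close> come from the chain and quotient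
  rules, so that the Laplacian of the hypothesis, defined through \<open>deriv\<close>, becomes an
  explicit sum.\<close>

lemma smooth_positive_solution_of_log_diffusion:
  assumes "log_diffusion_solution T u0 u"
  shows "smooth_positive_solution T u (\<lambda>x t. deriv (\<lambda>\<tau>. u x \<tau>) t)"
  unfolding smooth_positive_solution_def
proof (intro conjI allI ballI)
  have pos: "\<And>x t. t \<in> {0<..<T} \<Longrightarrow> 0 < u x t" and par: "parabolic_C21 T u"
    and eq: "\<And>x t. t \<in> {0<..<T} \<Longrightarrow> deriv (\<lambda>\<tau>. u x \<tau>) t = laplacian (\<lambda>y. ln (u y t)) x"
    using assms by (auto simp: log_diffusion_solution_def)
  show "continuous_on (UNIV \<times> {0<..<T}) (\<lambda>(x, t). u x t)"
    "continuous_on (UNIV \<times> {0<..<T}) (\<lambda>(x, t). deriv (\<lambda>\<tau>. u x \<tau>) t)"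
    using par by (auto simp: parabolic_C21_def)
  fix x t assume t: "t \<in> {0<..<T}"
  show "0 < u x t" using pos t .
  have "(\<lambda>\<tau>. u x \<tau>) differentiable (at t)" using par t by (auto simp: parabolic_C21_def)
  then show "((\<lambda>\<tau>. u x \<tau>) has_real_derivative deriv (\<lambda>\<tau>. u x \<tau>) t) (at t)"
    using DERIV_deriv_iff_real_differentiable by blast
next
  have pos: "\<And>x t. t \<in> {0<..<T} \<Longrightarrow> 0 < u x t" and par: "parabolic_C21 T u"
    and eq: "\<And>x t. t \<in> {0<..<T} \<Longrightarrow> deriv (\<lambda>\<tau>. u x \<tau>) t = laplacian (\<lambda>y. ln (u y t)) x"
    using assms by (auto simp: log_diffusion_solution_def)
  fix t assume t: "t \<in> {0<..<T}"
  define v where "v = (\<lambda>y. u y t)"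
  define p where "p b x = partial_deriv b v x / v x" for b x
  define pp where "pp b x = (partial_deriv b (partial_deriv b v) x * v x - partial_deriv b v x * partial_deriv b v x) / (v x * v x)" for b x
  have vpos: "0 < v x" for x using pos[OF t] by (simp add: v_def)
  have cv: "continuous_on UNIV v"
    unfolding v_def by (rule continuous_on_slice[OF _ t]) (use par in \<open>simp add: parabolic_C21_def\<close>)
  have c1: "continuous_on UNIV (partial_deriv b v)" and c2: "continuous_on UNIV (partial_deriv b (partial_deriv b v))"
    and d1: "((\<lambda>h. v (x + h *\<^sub>R b)) has_real_derivative partial_deriv b v x) (at 0)"
    and d2: "((\<lambda>h. partial_deriv b v (x + h *\<^sub>R b)) has_real_derivative partial_deriv b (partial_deriv b v) x) (at 0)"
    if b: "b \<in> Basis" for b x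
  proof -
    have "continuous_on UNIV (\<lambda>x. partial_deriv b (\<lambda>y. u y t) x)"
      by (rule continuous_on_slice[OF _ t]) (use par b in \<open>simp add: parabolic_C21_def\<close>)
    then show "continuous_on UNIV (partial_deriv b v)" by (simp add: v_def)
    have "continuous_on UNIV (\<lambda>x. partial_deriv b (partial_deriv b (\<lambda>y. u y t)) x)"
      by (rule continuous_on_slice[OF _ t]) (use par b in \<open>simp add: parabolic_C21_def\<close>)
    then show "continuous_on UNIV (partial_deriv b (partial_deriv b v))" by (simp add: v_def)
    have "has_partial b v x" "has_partial b (partial_deriv b v) x"
      using par b t by (auto simp: parabolic_C21_def v_def)
    then show "((\<lambda>h. v (x + h *\<^sub>R b)) has_real_derivative partial_deriv b v x) (at 0)"
      "((\<lambda>h. partial_deriv b v (x + h *\<^sub>R b)) has_real_derivative partial_deriv b (partial_deriv b v) x) (at 0)"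
      unfolding has_partial_def partial_deriv_def[of b v x] partial_deriv_def[of b "partial_deriv b v" x]
      using DERIV_deriv_iff_real_differentiable by blast+
  qed
  have e1: "((\<lambda>h. ln (v (x + h *\<^sub>R b))) has_real_derivative p b x) (at 0)" if b: "b \<in> Basis" for b x
    using DERIV_chain2[OF DERIV_ln_divide d1[OF b, of x]] vpos[of x] by (simp add: p_def)
  have e2: "((\<lambda>h. p b (x + h *\<^sub>R b)) has_real_derivative pp b x) (at 0)" if b: "b \<in> Basis" for b x
    using DERIV_divide[OF d2[OF b, of x] d1[OF b, of x]] vpos[of x] by (simp add: p_def pp_def)
  have "c2_along_basis (\<lambda>x. ln (v x)) p pp"
    unfolding c2_along_basis_def
  proof (intro conjI ballI allI e1 e2)
    have nz: "\<forall>x\<in>UNIV. v x \<noteq> 0" using vpos by (metis less_irrefl)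
    show "continuous_on UNIV (\<lambda>x. ln (v x))" by (intro continuous_intros cv nz)
    fix b :: 'a assume b: "b \<in> Basis"
    show "continuous_on UNIV (p b)" "continuous_on UNIV (pp b)"
      unfolding p_def pp_def using nz by (auto intro!: continuous_intros cv c1[OF b] c2[OF b])
  qed
  moreover have "deriv (\<lambda>\<tau>. u x \<tau>) t = (\<Sum>b\<in>Basis. pp b x)" for x
  proof -
    have "partial_deriv b (\<lambda>y. ln (v y)) = p b" if b: "b \<in> Basis" for b
      by (rule ext, unfold partial_deriv_def, rule DERIV_imp_deriv, rule e1[OF b])
    moreover have "partial_deriv b (p b) x = pp b x" if b: "b \<in> Basis" for b
      unfolding partial_deriv_def by (rule DERIV_imp_deriv[OF e2[OF b]])
    moreover have "(\<lambda>y. ln (u y t)) = (\<lambda>y. ln (v y))" by (simp add: v_def)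
    ultimately show ?thesis unfolding eq[OF t] laplacian_def by (intro sum.cong refl) metis
  qed
  ultimately show "\<exists>p pp. c2_along_basis (\<lambda>x. ln (u x t)) p pp \<and> (\<forall>x. deriv (\<lambda>\<tau>. u x \<tau>) t = (\<Sum>b\<in>Basis. pp b x))"
    by (auto simp: v_def)
qed

section \<open>Radial functions and the equation for the Barenblatt solutions\<close>

lemma norm_sq_derivative_along_basis:
  fixes x b :: "'a::euclidean_space"
  assumes "b \<in> Basis"
  shows "((\<lambda>h. (norm (x + h *\<^sub>R b))\<^sup>2) has_real_derivative 2 * (x \<bullet> b)) (at 0)"
proof -
  have "(\<lambda>h. (norm (x + h *\<^sub>R b))\<^sup>2) = (\<lambda>h. (norm x)\<^sup>2 + 2 * h * (x \<bullet> b) + h\<^sup>2)"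
  proof
    fix h
    have "(x + h *\<^sub>R b) \<bullet> (x + h *\<^sub>R b) = x \<bullet> x + 2 * h * (x \<bullet> b) + h * h * (b \<bullet> b)"
      by (simp add: inner_add_left inner_add_right inner_commute[of b x] distrib_left)
    then show "(norm (x + h *\<^sub>R b))\<^sup>2 = (norm x)\<^sup>2 + 2 * h * (x \<bullet> b) + h\<^sup>2"
      using assms unfolding power2_norm_eq_inner by (simp add: power2_eq_square)
  qed
  then show ?thesis by (auto intro!: derivative_eq_intros)
qed

text \<open>Profiles are functions of the squared norm, which is smooth at the origin, so no
  singular terms in 1/|x| appear; with \<open>r = |x|^2\<close> the Laplacian is
  \<open>4 r F'' + 2 N F'\<close>.\<close>

lemma c2_along_basis_radial:
  fixes F F' F'' :: "real \<Rightarrow> real"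
  assumes d: "\<And>r. 0 \<le> r \<Longrightarrow> (F has_real_derivative F' r) (at r)"
    "\<And>r. 0 \<le> r \<Longrightarrow> (F' has_real_derivative F'' r) (at r)"
    and c: "continuous_on {0..} F''"
  shows "c2_along_basis (\<lambda>x::'a::euclidean_space. F ((norm x)\<^sup>2)) (\<lambda>b x. 2 * (x \<bullet> b) * F' ((norm x)\<^sup>2))
     (\<lambda>b x. 2 * F' ((norm x)\<^sup>2) + 4 * (x \<bullet> b)\<^sup>2 * F'' ((norm x)\<^sup>2))"
    (is "c2_along_basis ?f ?p ?pp")
    and "(\<Sum>b\<in>Basis. 2 * F' ((norm x)\<^sup>2) + 4 * (x \<bullet> b)\<^sup>2 * F'' ((norm x)\<^sup>2))
      = 4 * (norm x)\<^sup>2 * F'' ((norm x)\<^sup>2) + 2 * real DIM('a) * F' ((norm (x::'a))\<^sup>2)"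
proof -
  have cF: "continuous_on {0..} F" "continuous_on {0..} F'"
    by (rule DERIV_continuous_on, rule has_field_derivative_at_within, rule d, simp)+
  have cc: "continuous_on UNIV (\<lambda>x::'a. G ((norm x)\<^sup>2))" if "continuous_on {0..} G" for G :: "real \<Rightarrow> real"
    by (rule continuous_on_compose2[OF that]) (auto intro!: continuous_intros)
  show "c2_along_basis ?f ?p ?pp"
    unfolding c2_along_basis_def
  proof (intro conjI ballI allI)
    show "continuous_on UNIV ?f" by (rule cc[OF cF(1)])
    fix b :: 'a assume b: "b \<in> Basis"
    show "continuous_on UNIV (?p b)" "continuous_on UNIV (?pp b)"
      by (intro continuous_intros cc cF c)+
    fix x :: 'a
    have n: "0 \<le> (norm (x + 0 *\<^sub>R b))\<^sup>2" by simp
    show "((\<lambda>h. F ((norm (x + h *\<^sub>R b))\<^sup>2)) has_real_derivative ?p b x) (at 0)"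
      using DERIV_chain2[OF d(1)[OF n] norm_sq_derivative_along_basis[OF b]] by (simp add: algebra_simps)
    have "((\<lambda>h. F' ((norm (x + h *\<^sub>R b))\<^sup>2)) has_real_derivative F'' ((norm x)\<^sup>2) * (2 * (x \<bullet> b))) (at 0)"
      using DERIV_chain2[OF d(2)[OF n] norm_sq_derivative_along_basis[OF b]] by simp
    moreover have "((\<lambda>h. 2 * ((x + h *\<^sub>R b) \<bullet> b)) has_real_derivative 2) (at 0)"
      using b by (auto intro!: derivative_eq_intros simp: inner_add_left)
    ultimately show "((\<lambda>h. 2 * ((x + h *\<^sub>R b) \<bullet> b) * F' ((norm (x + h *\<^sub>R b))\<^sup>2)) has_real_derivative ?pp b x) (at 0)"
      using DERIV_mult by (fastforce simp: power2_eq_square algebra_simps)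
  qed
  have "(\<Sum>b\<in>Basis. (x \<bullet> b)\<^sup>2) = (norm x)\<^sup>2"
    unfolding power2_norm_eq_inner euclidean_inner[of x x] by (simp add: power2_eq_square)
  then show "(\<Sum>b\<in>Basis. 2 * F' ((norm x)\<^sup>2) + 4 * (x \<bullet> b)\<^sup>2 * F'' ((norm x)\<^sup>2))
      = 4 * (norm x)\<^sup>2 * F'' ((norm x)\<^sup>2) + 2 * real DIM('a) * F' ((norm x)\<^sup>2)"
    by (simp add: sum.distrib sum_distrib_right[symmetric] sum_distrib_left[symmetric])
qed

text \<open>With \<open>A = (T - t)\<^sup>2\<^sup>/\<^sup>(\<^sup>N\<^sup>-\<^sup>2\<^sup>)\<close> one has \<open>(T - t)\<^sup>N\<^sup>/\<^sup>(\<^sup>N\<^sup>-\<^sup>2\<^sup>) = (T - t) A\<close>.\<close>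
lemma barenblatt_eq:
  fixes x :: "'a::euclidean_space"
  assumes "3 \<le> DIM('a)" "t < T"
  shows "barenblatt T k x t = 2 * (real DIM('a) - 2) * ((T - t) * (T - t) powr (2 / (real DIM('a) - 2)))
     / (k + (T - t) powr (2 / (real DIM('a) - 2)) * (norm x)\<^sup>2)"
proof -
  have "real DIM('a) / (real DIM('a) - 2) = 1 + 2 / (real DIM('a) - 2)"
    using assms by (simp add: field_simps)
  then show ?thesis using assms by (simp add: barenblatt_def powr_add)
qed

definition barenblatt_dt :: "real \<Rightarrow> real \<Rightarrow> 'a::euclidean_space \<Rightarrow> real \<Rightarrow> real" where
  "barenblatt_dt T k x t = (let A = (T - t) powr (2 / (real DIM('a) - 2)) in
     - 2 * A * (real DIM('a) * k + (real DIM('a) - 2) * A * (norm x)\<^sup>2) / (k + A * (norm x)\<^sup>2)\<^sup>2)"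

text \<open>Both sides of the equation are computed explicitly, the spatial one from the radial form
  of the logarithm, a constant minus \<open>ln (k + A r)\<close>, and both come out as
  \<open>barenblatt_dt\<close>.\<close>

lemma smooth_positive_solution_barenblatt:
  assumes "3 \<le> DIM('a::euclidean_space)" "0 < k"
  shows "smooth_positive_solution T (barenblatt T k :: 'a \<Rightarrow> real \<Rightarrow> real) (barenblatt_dt T k)"
  unfolding smooth_positive_solution_def
proof (intro conjI allI ballI)
  define n where "n = real DIM('a)"
  define e where "e = 2 / (n - 2)"
  have n: "3 \<le> n" using assms by (simp add: n_def)
  have ne: "(n - 2) * e = 2" using n by (auto simp: e_def divide_eq_eq)
  have D: "0 < k + (T - t) powr e * r" if "0 \<le> r" for t r
    using assms that by (simp add: add_pos_nonneg)
  have B: "barenblatt T k x t = 2 * (n - 2) * ((T - t) * (T - t) powr e) / (k + (T - t) powr e * (norm x)\<^sup>2)" if "t < T" for x :: 'a and t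
    using barenblatt_eq[OF assms(1) that, of k x] by (simp add: n_def e_def)
  have Bt: "barenblatt_dt T k x t = - 2 * (T - t) powr e * (n * k + (n - 2) * (T - t) powr e * (norm x)\<^sup>2) / (k + (T - t) powr e * (norm x)\<^sup>2)\<^sup>2" for x :: 'a and t
    by (simp add: barenblatt_dt_def n_def e_def Let_def)
  have cont: "continuous_on (UNIV \<times> {0<..<T}) (\<lambda>z::'a \<times> real. (T - snd z) powr e)"
    by (auto intro!: continuous_intros)
  have nz: "k + (T - t) powr e * (norm x)\<^sup>2 \<noteq> 0" for x :: 'a and t using D[of "(norm x)\<^sup>2" t] by simp
  have "continuous_on (UNIV \<times> {0<..<T}) (\<lambda>z::'a \<times> real. 2 * (n - 2) * ((T - snd z) * (T - snd z) powr e) / (k + (T - snd z) powr e * (norm (fst z))\<^sup>2))"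
    using nz by (intro continuous_intros cont) auto
  then show "continuous_on (UNIV \<times> {0<..<T}) (\<lambda>(x::'a, t). barenblatt T k x t)"
    by (rule continuous_on_eq) (auto simp: B)
  have "continuous_on (UNIV \<times> {0<..<T}) (\<lambda>z::'a \<times> real. - 2 * (T - snd z) powr e * (n * k + (n - 2) * (T - snd z) powr e * (norm (fst z))\<^sup>2) / (k + (T - snd z) powr e * (norm (fst z))\<^sup>2)\<^sup>2)"
    using nz by (intro continuous_intros cont) auto
  then show "continuous_on (UNIV \<times> {0<..<T}) (\<lambda>(x::'a, t). barenblatt_dt T k x t)"
    by (rule continuous_on_eq) (auto simp: Bt)
  {
    fix x :: 'a and t assume t: "t \<in> {0<..<T}"
    show "0 < barenblatt T k x t"
      using t n D[of "(norm x)\<^sup>2" t] by (simp add: B)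
    define A where "A = (T - t) powr e"
    define r where "r = (norm x)\<^sup>2"
    have dA: "((\<lambda>t. (T - t) powr e) has_real_derivative - e * A / (T - t)) (at t)"
      using t by (auto intro!: derivative_eq_intros simp: A_def powr_diff)
    have dT: "((\<lambda>t. T - t) has_real_derivative - 1) (at t)" by (auto intro!: derivative_eq_intros)
    have Dn: "k + A * r \<noteq> 0" using nz[of t x] by (simp add: A_def r_def)
    have "T - t \<noteq> 0" using t by simp
    then have "(- e * A / (T - t)) * (T - t) = - e * A" by (metis nonzero_eq_divide_eq)
    then have "- 1 * A + (- e * A / (T - t)) * (T - t) = - (1 + e) * A"
      by (simp only: distrib_right minus_add_distrib)
    then have d1: "((\<lambda>t. ((T - t) * (T - t) powr e)) has_real_derivative (- (1 + e) * A)) (at t)"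
      using DERIV_mult[OF dT dA] by (simp add: A_def)
    have d2: "((\<lambda>t. k + (T - t) powr e * r) has_real_derivative (- e * A / (T - t) * r)) (at t)"
      using DERIV_add[OF DERIV_const[of k] DERIV_cmult_right[OF dA, of r]] by simp
    have d3: "((\<lambda>t. ((T - t) * (T - t) powr e) / (k + (T - t) powr e * r)) has_real_derivative
        ((- (1 + e) * A) * (k + A * r) - ((T - t) * A) * (- e * A / (T - t) * r)) / ((k + A * r) * (k + A * r))) (at t)"
      using DERIV_divide[OF d1 d2] Dn by (simp add: A_def)
    have "((- (1 + e) * A) * (k + A * r) - ((T - t) * A) * (- e * A / (T - t) * r))
       = - A * ((1 + e) * k + A * r)"
      using t by (simp add: field_simps)
    then have "((\<lambda>t. 2 * (n - 2) * (((T - t) * (T - t) powr e) / (k + (T - t) powr e * r))) has_real_derivative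
       2 * (n - 2) * (- A * ((1 + e) * k + A * r) / ((k + A * r) * (k + A * r)))) (at t)"
      using DERIV_cmult[OF d3, of "2 * (n - 2)"] by simp
    moreover have "2 * (n - 2) * (- A * ((1 + e) * k + A * r) / ((k + A * r) * (k + A * r))) = barenblatt_dt T k x t"
    proof -
      \<comment> \<open>This relation between the exponent of \<open>T - t\<close> and the dimension
        is what makes the time derivative agree with the Laplacian.\<close>
      have "(n - 2) * (1 + e) = n" using ne by (simp add: algebra_simps)
      then have "(n - 2) * ((1 + e) * k + A * r) = n * k + (n - 2) * A * r" 
        by (simp add: algebra_simps) (metis distrib_left mult.commute mult.left_commute)
      then have "2 * (n - 2) * (- A * ((1 + e) * k + A * r)) = - 2 * A * (n * k + (n - 2) * A * r)"
        by (metis (no_types, opaque_lifting) minus_mult_commute mult.assoc mult.left_commute)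
      then show ?thesis unfolding Bt A_def[symmetric] r_def[symmetric]
        by (simp add: power2_eq_square)
    qed
    ultimately have "((\<lambda>t. 2 * (n - 2) * (((T - t) * (T - t) powr e) / (k + (T - t) powr e * r))) has_real_derivative barenblatt_dt T k x t) (at t)"
      by metis
    moreover have "\<forall>\<^sub>F s in nhds t. 2 * (n - 2) * (((T - s) * (T - s) powr e) / (k + (T - s) powr e * r)) = barenblatt T k x s"
      using eventually_nhds_in_open[of "{..<T}" t] t by (auto elim!: eventually_mono simp: B r_def)
    ultimately show "((\<lambda>\<tau>. barenblatt T k x \<tau>) has_real_derivative barenblatt_dt T k x t) (at t)"
      by (subst (asm) DERIV_cong_ev[OF refl _ refl]) auto
  }
  fix t assume t: "t \<in> {0<..<T}"
  define A where "A = (T - t) powr e"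
  have A: "0 < A" using t by (simp add: A_def)
  define F where "F r = ln (2 * (n - 2) * ((T - t) * A)) - ln (k + A * r)" for r
  define F' where "F' r = - A / (k + A * r)" for r
  define F'' where "F'' r = A\<^sup>2 / (k + A * r)\<^sup>2" for r
  have Dp: "0 < k + A * r" if "0 \<le> r" for r using D[OF that] by (simp add: A_def)
  have dl: "((\<lambda>r. k + A * r) has_real_derivative A) (at r)" for r by (auto intro!: derivative_eq_intros)
  have dF: "(F has_real_derivative F' r) (at r)" if "0 \<le> r" for r
    unfolding F_def F'_def using DERIV_diff[OF DERIV_const DERIV_chain2[OF DERIV_ln_divide dl]] Dp[OF that] by fastforce
  have dF': "(F' has_real_derivative F'' r) (at r)" if "0 \<le> r" for r
    unfolding F'_def F''_def using DERIV_divide[OF DERIV_const dl, of r "- A"] Dp[OF that]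
    by (simp add: power2_eq_square)
  have cF'': "continuous_on {0..} F''"
    unfolding F''_def by (intro continuous_intros) (use Dp in fastforce)
  note R = c2_along_basis_radial[OF dF dF' cF'', where ?'a='a]
  have lnB: "ln (barenblatt T k x t) = F ((norm x)\<^sup>2)" for x :: 'a
    unfolding F_def using t n A Dp[of "(norm x)\<^sup>2"]
    by (simp add: B A_def[symmetric] ln_div)
  have "barenblatt_dt T k x t = 4 * (norm x)\<^sup>2 * F'' ((norm x)\<^sup>2) + 2 * n * F' ((norm x)\<^sup>2)" for x :: 'a
  proof -
    define r where "r = (norm x)\<^sup>2"
    define d where "d = k + A * r"
    have d: "d > 0" using Dp[of r] by (simp add: d_def r_def)
    have "4 * r * F'' r + 2 * n * F' r = (4 * r * A\<^sup>2 - 2 * n * A * d) / d\<^sup>2"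
      unfolding F'_def F''_def d_def[symmetric] using d by (simp add: field_simps power2_eq_square)
    also have "4 * r * A\<^sup>2 - 2 * n * A * d = - 2 * A * (n * k + (n - 2) * A * r)"
      by (simp add: d_def algebra_simps power2_eq_square)
    finally show ?thesis unfolding Bt A_def[symmetric] r_def[symmetric] d_def[symmetric] by simp
  qed
  then show "\<exists>p pp. c2_along_basis (\<lambda>x::'a. ln (barenblatt T k x t)) p pp \<and> (\<forall>x. barenblatt_dt T k x t = (\<Sum>b\<in>Basis. pp b x))"
    unfolding lnB
  proof (intro exI conjI allI)
    fix x :: 'a
    assume *: "\<And>x::'a. barenblatt_dt T k x t = 4 * (norm x)\<^sup>2 * F'' ((norm x)\<^sup>2) + 2 * n * F' ((norm x)\<^sup>2)"
    show "barenblatt_dt T k x t = (\<Sum>b\<in>Basis. 2 * F' ((norm x)\<^sup>2) + 4 * (x \<bullet> b)\<^sup>2 * F'' ((norm x)\<^sup>2))"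
      unfolding * n_def using R(2)[of x] by metis
  qed (rule R(1))
qed

section \<open>Radial weights with cutoff\<close>

lemma pos_part_power_derivative:
  fixes z :: real
  assumes "2 \<le> n"
  shows "((\<lambda>z. (max 0 z) ^ n) has_real_derivative real n * (max 0 z) ^ (n - 1)) (at z)"
proof -
  consider "z < 0" | "0 < z" | "z = 0" by linarith
  then show ?thesis
  proof cases
    case 1
    have "((\<lambda>z::real. 0) has_real_derivative 0) (at z)" by simp
    moreover have "\<forall>\<^sub>F w in nhds z. 0 = (max 0 w) ^ n"
      using eventually_nhds_in_open[of "{..<0}" z] 1 assms by (auto elim!: eventually_mono)
    ultimately have "((\<lambda>z. (max 0 z) ^ n) has_real_derivative 0) (at z)"
      using DERIV_cong_ev[of z z "\<lambda>_. 0" "\<lambda>z. (max 0 z) ^ n" 0 0] by blast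
    moreover have "real n * (max 0 z) ^ (n - 1) = 0" using 1 assms by (simp add: max_def)
    ultimately show ?thesis by (simp only:)
  next
    case 2
    have "((\<lambda>z::real. z ^ n) has_real_derivative real n * z ^ (n - 1)) (at z)" using DERIV_pow by simp
    moreover have "\<forall>\<^sub>F w in nhds z. w ^ n = (max 0 w) ^ n"
      using eventually_nhds_in_open[of "{0<..}" z] 2 by (auto elim!: eventually_mono)
    ultimately have "((\<lambda>z. (max 0 z) ^ n) has_real_derivative real n * z ^ (n - 1)) (at z)"
      using DERIV_cong_ev[of z z "\<lambda>z. z ^ n" "\<lambda>z. (max 0 z) ^ n"] by blast
    then show ?thesis using 2 by simp
  next
    case 3
    have "((\<lambda>h::real. (max 0 h) ^ n / h) \<longlongrightarrow> 0) (at 0)"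
    proof (rule Lim_null_comparison)
      show "((\<lambda>h::real. \<bar>h\<bar> ^ (n - 1)) \<longlongrightarrow> 0) (at 0)"
        using assms by (auto intro!: tendsto_eq_intros)
      have "norm ((max 0 h) ^ n / h) \<le> \<bar>h\<bar> ^ (n - 1)" for h :: real
      proof (cases "0 < h")
        case True
        have "h ^ n = h * h ^ (n - 1)" using assms by (cases n) auto
        then show ?thesis using True by simp
      next
        case False
        then have "(max 0 h) ^ n = 0" using assms by simp
        then show ?thesis by (simp only:) simp
      qed
      then show "\<forall>\<^sub>F h in at (0::real). norm ((max 0 h) ^ n / h) \<le> \<bar>h\<bar> ^ (n - 1)" by simp
    qed
    moreover have z: "(0::real) ^ n = 0" "(0::real) ^ (n - 1) = 0" using assms by (auto simp: zero_power)
    ultimately show ?thesis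
      unfolding DERIV_def 3 by (simp only: max.idem add_0_left z diff_zero mult_zero_right)
  qed
qed

text \<open>The cube is the lowest integer power of the positive part that is twice continuously
  differentiable. The argument \<open>r\<close> stands for the squared norm, so the support is the
  ball of radius \<open>R\<close>.\<close>

definition cut :: "real \<Rightarrow> real \<Rightarrow> real" where "cut R r = (max 0 (1 - r / R\<^sup>2)) ^ 3"
definition cut' :: "real \<Rightarrow> real \<Rightarrow> real" where "cut' R r = - (3 / R\<^sup>2) * (max 0 (1 - r / R\<^sup>2))\<^sup>2"
definition cut'' :: "real \<Rightarrow> real \<Rightarrow> real" where "cut'' R r = 6 / R ^ 4 * max 0 (1 - r / R\<^sup>2)"

lemma cut_derivative:
  assumes "0 < R"
  shows "(cut R has_real_derivative cut' R r) (at r)" "(cut' R has_real_derivative cut'' R r) (at r)"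
proof -
  have R4: "R ^ 4 = R\<^sup>2 * R\<^sup>2" by (simp add: power2_eq_square power4_eq_xxxx)
  have l: "((\<lambda>r. 1 - r / R\<^sup>2) has_real_derivative - (1 / R\<^sup>2)) (at r)"
    using DERIV_diff[OF DERIV_const[of 1] DERIV_cdivide[OF DERIV_ident, of "R\<^sup>2"]] by simp
  show "(cut R has_real_derivative cut' R r) (at r)"
    using DERIV_chain2[OF pos_part_power_derivative[of 3] l]
    by (simp add: cut_def[abs_def] cut'_def)
  have "((\<lambda>r. - (3 / R\<^sup>2) * (max 0 (1 - r / R\<^sup>2))\<^sup>2) has_real_derivative
      - (3 / R\<^sup>2) * (real 2 * (max 0 (1 - r / R\<^sup>2)) ^ (2 - 1) * - (1 / R\<^sup>2))) (at r)"
    by (rule DERIV_cmult[OF DERIV_chain2[OF pos_part_power_derivative[of 2] l]]) simp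
  moreover have "- (3 / S) * (real 2 * z ^ (2 - 1) * - (1 / S)) = 6 / (S * S) * z" for S z :: real
    by simp
  then have "- (3 / R\<^sup>2) * (real 2 * (max 0 (1 - r / R\<^sup>2)) ^ (2 - 1) * - (1 / R\<^sup>2)) = cut'' R r"
    unfolding cut''_def R4 by blast
  ultimately show "(cut' R has_real_derivative cut'' R r) (at r)"
    unfolding cut'_def[abs_def] by simp
qed

lemma cut_continuous [continuous_intros]:
  "continuous_on S f \<Longrightarrow> continuous_on S (\<lambda>x. cut R (f x))"
  "continuous_on S f \<Longrightarrow> continuous_on S (\<lambda>x. cut' R (f x))"
  "continuous_on S f \<Longrightarrow> continuous_on S (\<lambda>x. cut'' R (f x))"
  unfolding cut_def cut'_def cut''_def divide_inverse by (auto intro!: continuous_intros)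

lemma cut_nonneg: "0 \<le> cut R r" by (simp add: cut_def)

lemma cut_eq_0:
  assumes "0 < R" "R\<^sup>2 \<le> r"
  shows "cut R r = 0" "cut' R r = 0" "cut'' R r = 0"
proof -
  have "1 - r / R\<^sup>2 \<le> 0" using assms by simp
  then show "cut R r = 0" "cut' R r = 0" "cut'' R r = 0"
    by (auto simp: cut_def cut'_def cut''_def max_absorb1)
qed

text \<open>The derivative bounds are of order \<open>R^-2\<close>, as needed for the Laplacian: the
  second derivative appears there with a factor \<open>r\<close>, and \<open>r \<le> R^2\<close> on
  the support.\<close>

lemma cut_le:
  assumes "0 < R" "0 \<le> r"
  shows "cut R r \<le> 1" "\<bar>cut' R r\<bar> \<le> 3 / R\<^sup>2" "0 \<le> cut'' R r" "r * cut'' R r \<le> 6 / R\<^sup>2"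
proof -
  define z where "z = max 0 (1 - r / R\<^sup>2)"
  have z: "0 \<le> z" "z \<le> 1" using assms by (auto simp: z_def)
  show "cut R r \<le> 1" unfolding cut_def z_def[symmetric] using z by (simp add: power_le_one)
  have "z\<^sup>2 \<le> 1" using z by (simp add: power_le_one)
  then show "\<bar>cut' R r\<bar> \<le> 3 / R\<^sup>2" unfolding cut'_def z_def[symmetric] using assms
    by (simp add: abs_mult divide_right_mono)
  show n: "0 \<le> cut'' R r" unfolding cut''_def by simp
  show "r * cut'' R r \<le> 6 / R\<^sup>2"
  proof (cases "R\<^sup>2 \<le> r")
    case False
    have "cut'' R r \<le> 6 / R ^ 4" unfolding cut''_def z_def[symmetric] using z assms
      by (simp add: divide_right_mono)
    then have "r * cut'' R r \<le> R\<^sup>2 * (6 / R ^ 4)"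
      using False n assms by (intro mult_mono) auto
    also have "\<dots> = 6 / R\<^sup>2" using assms by (simp add: power2_eq_square power4_eq_xxxx)
    finally show ?thesis .
  qed (simp add: cut_eq_0[OF assms(1)])
qed

lemma cut_mono:
  assumes "0 < R" "R \<le> R'" "0 \<le> r"
  shows "cut R r \<le> cut R' r"
proof -
  have "r / R'\<^sup>2 \<le> r / R\<^sup>2" using assms by (intro divide_left_mono power_mono) auto
  then show ?thesis unfolding cut_def by (intro power_mono) auto
qed

lemma cut_tendsto_1: "(\<lambda>m. cut (real (Suc m)) r) \<longlonglongrightarrow> 1"
proof -
  have "(\<lambda>m. inverse (real (Suc m))) \<longlonglongrightarrow> 0" by (rule LIMSEQ_inverse_real_of_nat)
  then have "(\<lambda>m. (max 0 (1 - r * (inverse (real (Suc m)))\<^sup>2)) ^ 3) \<longlonglongrightarrow> (max 0 (1 - r * 0\<^sup>2)) ^ 3"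
    by (intro tendsto_intros)
  then show ?thesis by (simp add: cut_def divide_inverse power_inverse)
qed

text \<open>The condition with \<open>a\<close> controls the product of \<open>W'\<close> with the
  derivative of the cutoff, weighted by \<open>r\<close> as in the Laplacian, by a multiple of
  \<open>W\<close> itself. For a power weight \<open>a\<close> is its exponent.\<close>

definition radial_weight :: "real \<Rightarrow> real set \<Rightarrow> (real \<Rightarrow> real \<Rightarrow> real) \<Rightarrow> (real \<Rightarrow> real \<Rightarrow> real) \<Rightarrow> (real \<Rightarrow> real \<Rightarrow> real) \<Rightarrow> (real \<Rightarrow> real \<Rightarrow> real) \<Rightarrow> bool" where
  "radial_weight a I W W' W'' Wt \<longleftrightarrow>
     (\<forall>r\<ge>0. \<forall>t\<in>I. 0 \<le> W r t \<and> r * \<bar>W' r t\<bar> \<le> a * W r t \<and>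
        ((\<lambda>r. W r t) has_real_derivative W' r t) (at r) \<and>
        ((\<lambda>r. W' r t) has_real_derivative W'' r t) (at r) \<and>
        ((\<lambda>t. W r t) has_real_derivative Wt r t) (at t within I)) \<and>
     continuous_on ({0..} \<times> I) (\<lambda>(r, t). W r t) \<and>
     continuous_on ({0..} \<times> I) (\<lambda>(r, t). Wt r t) \<and>
     (\<forall>t\<in>I. continuous_on {0..} (\<lambda>r. W'' r t))"

lemma test_family_cut:
  fixes W W' W'' Wt :: "real \<Rightarrow> real \<Rightarrow> real"
  assumes W: "radial_weight a I W W' W'' Wt" and R: "0 < R"
  defines "\<Phi>' \<equiv> \<lambda>r t. W' r t * cut R r + W r t * cut' R r"
    and "\<Phi>'' \<equiv> \<lambda>r t. W'' r t * cut R r + 2 * (W' r t * cut' R r) + W r t * cut'' R r"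
  shows "test_family R I (\<lambda>x::'a::euclidean_space. \<lambda>t. W ((norm x)\<^sup>2) t * cut R ((norm x)\<^sup>2))
     (\<lambda>x t. Wt ((norm x)\<^sup>2) t * cut R ((norm x)\<^sup>2))
     (\<lambda>x t. 4 * (norm x)\<^sup>2 * \<Phi>'' ((norm x)\<^sup>2) t + 2 * real DIM('a) * \<Phi>' ((norm x)\<^sup>2) t)"
  unfolding test_family_def
proof (intro conjI ballI allI impI)
  note w = W[unfolded radial_weight_def]
  have R2: "R\<^sup>2 \<le> (norm x)\<^sup>2" if "R \<le> norm x" for x :: 'a using that R by (intro power_mono) auto
  have sw: "continuous_on (UNIV \<times> I) (\<lambda>z::'a \<times> real. V ((norm (fst z))\<^sup>2) (snd z))"
    if V: "continuous_on ({0..} \<times> I) (\<lambda>(r, t). V r t :: real)" for V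
  proof -
    have "continuous_on (UNIV \<times> I) (\<lambda>z::'a \<times> real. (\<lambda>(r, t). V r t) ((norm (fst z))\<^sup>2, snd z))"
      by (rule continuous_on_compose2[OF V]) (auto intro!: continuous_intros)
    then show ?thesis by simp
  qed
  show "continuous_on (UNIV \<times> I) (\<lambda>(x::'a, t). W ((norm x)\<^sup>2) t * cut R ((norm x)\<^sup>2))"
    "continuous_on (UNIV \<times> I) (\<lambda>(x::'a, t). Wt ((norm x)\<^sup>2) t * cut R ((norm x)\<^sup>2))"
    unfolding split_beta using w by (intro continuous_intros sw; blast)+
  fix t assume t: "t \<in> I"
  have d1: "((\<lambda>r. W r t * cut R r) has_real_derivative \<Phi>' r t) (at r)" if "0 \<le> r" for r
    using DERIV_mult[OF _ cut_derivative(1)[OF R], of "\<lambda>r. W r t" "W' r t" r] w t that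
    by (simp add: \<Phi>'_def algebra_simps)
  have d2: "((\<lambda>r. \<Phi>' r t) has_real_derivative \<Phi>'' r t) (at r)" if "0 \<le> r" for r
  proof -
    have a: "((\<lambda>r. W r t) has_real_derivative W' r t) (at r)" "((\<lambda>r. W' r t) has_real_derivative W'' r t) (at r)"
      using w t that by auto
    show ?thesis unfolding \<Phi>'_def
      using DERIV_add[OF DERIV_mult[OF a(2) cut_derivative(1)[OF R]] DERIV_mult[OF a(1) cut_derivative(2)[OF R]]]
      by (simp add: \<Phi>''_def algebra_simps)
  qed
  have cW: "continuous_on {0..} (\<lambda>r. W r t)" "continuous_on {0..} (\<lambda>r. W' r t)"
    by (rule DERIV_continuous_on, rule has_field_derivative_at_within, use w t in auto)+
  have c2: "continuous_on {0..} (\<lambda>r. \<Phi>'' r t)"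
    unfolding \<Phi>''_def using w t by (intro continuous_intros cW) auto
  note rad = c2_along_basis_radial[OF d1 d2 c2, where ?'a='a]
  show "\<exists>q qq. c2_test R (\<lambda>x::'a. W ((norm x)\<^sup>2) t * cut R ((norm x)\<^sup>2)) q qq \<and>
     (\<forall>x. 4 * (norm x)\<^sup>2 * \<Phi>'' ((norm x)\<^sup>2) t + 2 * real DIM('a) * \<Phi>' ((norm x)\<^sup>2) t = (\<Sum>b\<in>Basis. qq b x))"
  proof (intro exI conjI allI)
    show "c2_test R (\<lambda>x::'a. W ((norm x)\<^sup>2) t * cut R ((norm x)\<^sup>2)) (\<lambda>b x. 2 * (x \<bullet> b) * \<Phi>' ((norm x)\<^sup>2) t)
      (\<lambda>b x. 2 * \<Phi>' ((norm x)\<^sup>2) t + 4 * (x \<bullet> b)\<^sup>2 * \<Phi>'' ((norm x)\<^sup>2) t)"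
      unfolding c2_test_def using rad(1) R2
      by (auto simp: supported_in_ball_def cut_eq_0[OF R] \<Phi>'_def \<Phi>''_def)
    show "4 * (norm x)\<^sup>2 * \<Phi>'' ((norm x)\<^sup>2) t + 2 * real DIM('a) * \<Phi>' ((norm x)\<^sup>2) t
      = (\<Sum>b\<in>Basis. 2 * \<Phi>' ((norm x)\<^sup>2) t + 4 * (x \<bullet> b)\<^sup>2 * \<Phi>'' ((norm x)\<^sup>2) t)" for x :: 'a
      using rad(2)[of x] by metis
  qed
  fix x :: 'a
  show "0 \<le> W ((norm x)\<^sup>2) t * cut R ((norm x)\<^sup>2)" using w t by (simp add: cut_nonneg)
  have "((\<lambda>\<tau>. W ((norm x)\<^sup>2) \<tau>) has_real_derivative Wt ((norm x)\<^sup>2) t) (at t within I)" using w t by simp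
  from DERIV_cmult_right[OF this]
  show "((\<lambda>\<tau>. W ((norm x)\<^sup>2) \<tau> * cut R ((norm x)\<^sup>2)) has_real_derivative Wt ((norm x)\<^sup>2) t * cut R ((norm x)\<^sup>2)) (at t within I)" .
  assume "R \<le> norm x"
  then show "Wt ((norm x)\<^sup>2) t * cut R ((norm x)\<^sup>2) = 0" using R2 cut_eq_0[OF R] by simp
qed

lemma abs_reg_0: "abs_reg \<sigma> 0 z = \<bar>z\<bar> + \<sigma> * z"
  by (simp add: abs_reg_def)

lemma abs_reg_0_nonneg: "\<bar>\<sigma>\<bar> \<le> 1 \<Longrightarrow> 0 \<le> \<bar>z\<bar> + \<sigma> * (z::real)"
proof -
  assume "\<bar>\<sigma>\<bar> \<le> 1"
  then have "\<bar>\<sigma> * z\<bar> \<le> 1 * \<bar>z\<bar>" unfolding abs_mult by (intro mult_right_mono) auto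
  then show ?thesis by linarith
qed

text \<open>The Laplacian of weight times cutoff splits into cutoff times the Laplacian of the
  weight, which \<open>ineq\<close> handles together with the time derivative, and terms with
  derivatives of the cutoff, which are at most a multiple of \<open>W / R^2\<close>. The later
  integral estimates are instances with different weights and different ways of supplying
  \<open>err\<close>.\<close>

lemma cutoff_inequality:
  fixes u v :: "'a::euclidean_space \<Rightarrow> real \<Rightarrow> real"
  assumes sol: "smooth_positive_solution T u ut" "smooth_positive_solution T v vt"
    and t12: "0 < t1" "t1 \<le> t2" "t2 < T"
    and W: "radial_weight a {t1..t2} W W' W'' Wt" and a: "0 \<le> a" and R: "0 < R" and \<sigma>: "\<bar>\<sigma>\<bar> \<le> 1"
  defines "G \<equiv> \<lambda>x t. \<bar>ln (u x t) - ln (v x t)\<bar> + \<sigma> * (ln (u x t) - ln (v x t))"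
    and "Q \<equiv> \<lambda>x t. \<bar>u x t - v x t\<bar> + \<sigma> * (u x t - v x t)"
  assumes ineq: "\<And>x t. t \<in> {t1..t2} \<Longrightarrow>
      G x t * (4 * (norm x)\<^sup>2 * W'' ((norm x)\<^sup>2) t + 2 * real DIM('a) * W' ((norm x)\<^sup>2) t)
      + Q x t * Wt ((norm x)\<^sup>2) t \<le> 0"
    and err: "\<And>t. t \<in> {t1..t2} \<Longrightarrow>
      (\<integral>x. indicator (cball 0 R) x * (G x t * W ((norm x)\<^sup>2) t) \<partial>lborel) / R\<^sup>2 \<le> err"
  shows "(\<integral>x. Q x t2 * (W ((norm x)\<^sup>2) t2 * cut R ((norm x)\<^sup>2)) \<partial>lborel)
    \<le> (\<integral>x. Q x t1 * (W ((norm x)\<^sup>2) t1 * cut R ((norm x)\<^sup>2)) \<partial>lborel)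
       + (24 + 6 * real DIM('a) + 24 * a) * err * (t2 - t1)"
proof -
  define n where "n = real DIM('a)"
  define \<Phi>' where "\<Phi>' = (\<lambda>r t. W' r t * cut R r + W r t * cut' R r)"
  define \<Phi>'' where "\<Phi>'' = (\<lambda>r t. W'' r t * cut R r + 2 * (W' r t * cut' R r) + W r t * cut'' R r)"
  define \<phi>L where "\<phi>L = (\<lambda>(x::'a) t. 4 * (norm x)\<^sup>2 * \<Phi>'' ((norm x)\<^sup>2) t + 2 * real DIM('a) * \<Phi>' ((norm x)\<^sup>2) t)"
  have tf: "test_family R {t1..t2} (\<lambda>x::'a. \<lambda>t. W ((norm x)\<^sup>2) t * cut R ((norm x)\<^sup>2))
     (\<lambda>x t. Wt ((norm x)\<^sup>2) t * cut R ((norm x)\<^sup>2)) \<phi>L"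
    unfolding \<phi>L_def \<Phi>'_def \<Phi>''_def by (rule test_family_cut[OF W R])
  interpret two_solutions T u ut v vt R t1 t2 "\<lambda>x t. W ((norm x)\<^sup>2) t * cut R ((norm x)\<^sup>2)"
     "\<lambda>x t. Wt ((norm x)\<^sup>2) t * cut R ((norm x)\<^sup>2)" \<phi>L \<sigma>
    by unfold_locales fact+
  \<comment> \<open>The part 24 = 4 * 6 comes from the term with \<open>cut''\<close>, 6 n = 2 n * 3
    from \<open>cut'\<close>, and 24 a = 8 * 3 a from the mixed term with \<open>W'\<close> and
    \<open>cut'\<close>.\<close>
  define E where "E = 24 + 6 * n + 24 * a"
  have n: "0 \<le> n" by (simp add: n_def)
  have E: "0 \<le> E" using n a by (simp add: E_def)
  note w = W[unfolded radial_weight_def]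
  have pt: "G x t * \<phi>L x t + Q x t * (Wt ((norm x)\<^sup>2) t * cut R ((norm x)\<^sup>2))
      \<le> E / R\<^sup>2 * (indicator (cball 0 R) x * (G x t * W ((norm x)\<^sup>2) t))" if t: "t \<in> {t1..t2}" for x t
  proof -
    define r where "r = (norm x)\<^sup>2"
    have r: "0 \<le> r" by (simp add: r_def)
    have G: "0 \<le> G x t" unfolding G_def by (rule abs_reg_0_nonneg[OF \<sigma>])
    have W0: "0 \<le> W r t" and rW: "r * \<bar>W' r t\<bar> \<le> a * W r t" using w t r by auto
    note ct = cut_le[OF R r]
    show ?thesis
    proof (cases "norm x \<le> R")
      case True
      have L: "\<phi>L x t = cut R r * (4 * r * W'' r t + 2 * n * W' r t)
          + (8 * (r * (W' r t * cut' R r)) + W r t * (4 * (r * cut'' R r) + 2 * n * cut' R r))"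
        unfolding \<phi>L_def \<Phi>'_def \<Phi>''_def r_def[symmetric] n_def by (simp add: algebra_simps)
      have "r * (W' r t * cut' R r) \<le> \<bar>(r * W' r t) * cut' R r\<bar>" by (simp add: mult.assoc)
      also have "\<dots> = (r * \<bar>W' r t\<bar>) * \<bar>cut' R r\<bar>" using r by (simp add: abs_mult)
      also have "\<dots> \<le> (a * W r t) * (3 / R\<^sup>2)" using rW ct W0 a r by (intro mult_mono[of "r * \<bar>W' r t\<bar>"]) auto
      finally have 1: "r * (W' r t * cut' R r) \<le> (a * W r t) * (3 / R\<^sup>2)" .
      have "2 * n * cut' R r \<le> 2 * n * (3 / R\<^sup>2)" using ct n by (intro mult_left_mono) auto
      then have "4 * (r * cut'' R r) + 2 * n * cut' R r \<le> 4 * (6 / R\<^sup>2) + 2 * n * (3 / R\<^sup>2)"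
        using ct by linarith
      then have "W r t * (4 * (r * cut'' R r) + 2 * n * cut' R r) \<le> W r t * (4 * (6 / R\<^sup>2) + 2 * n * (3 / R\<^sup>2))"
        by (intro mult_left_mono W0)
      then have "8 * (r * (W' r t * cut' R r)) + W r t * (4 * (r * cut'' R r) + 2 * n * cut' R r)
         \<le> 8 * ((a * W r t) * (3 / R\<^sup>2)) + W r t * (4 * (6 / R\<^sup>2) + 2 * n * (3 / R\<^sup>2))"
        using 1 by linarith
      also have "\<dots> = E / R\<^sup>2 * W r t" using R by (simp add: E_def field_simps)
      finally have 2: "G x t * (8 * (r * (W' r t * cut' R r)) + W r t * (4 * (r * cut'' R r) + 2 * n * cut' R r))
         \<le> G x t * (E / R\<^sup>2 * W r t)" by (intro mult_left_mono G)
      have "cut R r * (G x t * (4 * r * W'' r t + 2 * n * W' r t) + Q x t * Wt r t) \<le> 0"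
        using ineq[OF t, of x] cut_nonneg[of R r] unfolding r_def[symmetric] n_def[symmetric]
        by (simp add: mult_nonneg_nonpos)
      then have "G x t * \<phi>L x t + Q x t * (Wt r t * cut R r) \<le> G x t * (E / R\<^sup>2 * W r t)"
        using 2 unfolding L by (simp add: algebra_simps)
      then show ?thesis using True by (simp add: r_def[symmetric] algebra_simps)
    next
      case False
      then have "R\<^sup>2 \<le> r" unfolding r_def using R by (intro power_mono) auto
      then show ?thesis using False
        unfolding \<phi>L_def \<Phi>'_def \<Phi>''_def r_def[symmetric] by (simp add: cut_eq_0[OF R])
    qed
  qed
  have bound: "(\<integral>x. abs_reg \<sigma> 0 (ln (u x t) - ln (v x t)) * \<phi>L x t
     + abs_reg \<sigma> 0 (u x t - v x t) * (Wt ((norm x)\<^sup>2) t * cut R ((norm x)\<^sup>2)) \<partial>lborel) \<le> E * err"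
    if t: "t \<in> {t1..t2}" for t
  proof -
    obtain p1 pp1 where p1: "c2_along_basis (\<lambda>x. ln (u x t)) p1 pp1"
      using sol(1) t t12 by (force simp: smooth_positive_solution_def)
    obtain p2 pp2 where p2: "c2_along_basis (\<lambda>x. ln (v x t)) p2 pp2"
      using sol(2) t t12 by (force simp: smooth_positive_solution_def)
    have cG: "continuous_on UNIV (\<lambda>x. G x t)"
      unfolding G_def by (intro continuous_intros c2_along_basis_continuous[OF p1] c2_along_basis_continuous[OF p2])
    have cQ: "continuous_on UNIV (\<lambda>x. Q x t)"
      unfolding Q_def by (intro continuous_intros cont_slice[OF cont(1) t])
    have cWt: "continuous_on UNIV (\<lambda>x::'a. W ((norm x)\<^sup>2) t)"
    proof -
      have "continuous_on {0..} (\<lambda>r. W r t)"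
        by (rule DERIV_continuous_on[where D="\<lambda>r. W' r t"], rule has_field_derivative_at_within, use w t in auto)
      then show ?thesis by (rule continuous_on_compose2) (auto intro!: continuous_intros)
    qed
    obtain r rr where r: "c2_test R (\<lambda>x. W ((norm x)\<^sup>2) t * cut R ((norm x)\<^sup>2)) r rr" "\<And>x. \<phi>L x t = (\<Sum>b\<in>Basis. rr b x)"
      using tf t by (force simp: test_family_def)
    have cL: "continuous_on UNIV (\<lambda>x. \<phi>L x t)" and sL: "\<And>x. R \<le> norm x \<Longrightarrow> \<phi>L x t = 0"
      using r by (auto simp: c2_test_def c2_along_basis_def supported_in_ball_def intro!: continuous_intros)
    have i1: "integrable lborel (\<lambda>x. G x t * \<phi>L x t + Q x t * (Wt ((norm x)\<^sup>2) t * cut R ((norm x)\<^sup>2)))"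
      by (rule integrable_compact_support[where R=R])
         (use sL supp(2)[OF t] cont_slice[OF cont(4) t] cG cL cQ in \<open>auto intro!: continuous_intros\<close>)
    have "integrable lborel (\<lambda>x. indicator (cball 0 R) x *\<^sub>R (G x t * W ((norm x)\<^sup>2) t))"
      by (rule borel_integrable_compact) (auto intro!: continuous_intros continuous_on_subset[OF cG] continuous_on_subset[OF cWt])
    then have i2: "integrable lborel (\<lambda>x. indicator (cball 0 R) x * (G x t * W ((norm x)\<^sup>2) t))" by simp
    have "(\<integral>x. G x t * \<phi>L x t + Q x t * (Wt ((norm x)\<^sup>2) t * cut R ((norm x)\<^sup>2)) \<partial>lborel)
      \<le> (\<integral>x. E / R\<^sup>2 * (indicator (cball 0 R) x * (G x t * W ((norm x)\<^sup>2) t)) \<partial>lborel)"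
      by (intro integral_mono i1 integrable_mult_right i2 pt t)
    also have "\<dots> = E * ((\<integral>x. indicator (cball 0 R) x * (G x t * W ((norm x)\<^sup>2) t) \<partial>lborel) / R\<^sup>2)" by simp
    also have "\<dots> \<le> E * err" by (intro mult_left_mono err t E)
    finally show ?thesis unfolding abs_reg_0 G_def Q_def .
  qed
  show ?thesis
    using entropy_inequality[OF bound] unfolding abs_reg_0 Q_def E_def n_def by simp
qed

text \<open>Monotone convergence as the cutoff radius grows. Integrability is part of the
  conclusion, which matters because the weighted norms are not known to be finite
  beforehand.\<close>

lemma integral_le_of_cutoff:
  fixes F :: "'a::euclidean_space \<Rightarrow> real"
  assumes c: "continuous_on UNIV F" and pos: "\<And>x. 0 \<le> F x"
    and le: "\<And>m. (\<integral>x. F x * cut (real (Suc m)) ((norm x)\<^sup>2) \<partial>lborel) \<le> C + e m" and e: "e \<longlonglongrightarrow> 0"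
  shows "integrable lborel F" "(\<integral>x. F x \<partial>lborel) \<le> C"
proof -
  define f where "f m x = F x * cut (real (Suc m)) ((norm x)\<^sup>2)" for m x
  have i: "integrable lborel (f m)" for m
  proof (rule integrable_compact_support[where R="real (Suc m)"])
    fix x :: 'a assume "real (Suc m) \<le> norm x"
    then have "(real (Suc m))\<^sup>2 \<le> (norm x)\<^sup>2" by (intro power_mono) auto
    then show "f m x = 0" unfolding f_def by (subst cut_eq_0) auto
  qed (auto intro!: continuous_intros c simp: f_def)
  have mono: "incseq (\<lambda>m. f m x)" for x
    unfolding f_def by (intro incseq_SucI mult_left_mono cut_mono pos) auto
  have "incseq (\<lambda>m. integral\<^sup>L lborel (f m))"
    using mono by (auto intro!: incseq_SucI integral_mono i dest: incseq_SucD)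
  moreover obtain B where "\<And>m. \<bar>e m\<bar> \<le> B"
    using e convergent_imp_Bseq[of e] by (force simp: convergent_def Bseq_def)
  then have "integral\<^sup>L lborel (f m) \<le> C + B" for m
    using le[of m] unfolding f_def by (smt (verit))
  ultimately obtain L where L: "(\<lambda>m. integral\<^sup>L lborel (f m)) \<longlonglongrightarrow> L"
    using incseq_convergent by blast
  have lim: "(\<lambda>m. f m x) \<longlonglongrightarrow> F x" for x
    unfolding f_def using tendsto_mult_left[OF cut_tendsto_1] by (fastforce simp del: of_nat_Suc)
  have m: "F \<in> borel_measurable lborel" using c by (simp add: borel_measurable_continuous_onI)
  show "integrable lborel F"
    by (rule integrable_monotone_convergence[OF i _ _ L m]) (use mono lim in \<open>auto simp: mono_def incseq_def\<close>)
  have "integral\<^sup>L lborel F = L"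
    by (rule integral_monotone_convergence[OF i _ _ L m]) (use mono lim in \<open>auto simp: mono_def incseq_def\<close>)
  also have "L \<le> C"
  proof (rule LIMSEQ_le[OF L])
    show "(\<lambda>m. C + e m) \<longlonglongrightarrow> C" using tendsto_add[OF tendsto_const e] by fastforce
    show "\<exists>N. \<forall>m\<ge>N. integral\<^sup>L lborel (f m) \<le> C + e m" using le unfolding f_def by blast
  qed
  finally show "(\<integral>x. F x \<partial>lborel) \<le> C" .
qed

section \<open>Power weights and bounds for Barenblatt solutions\<close>

text \<open>The function is dominated by a sum over the balls of radius \<open>2^j\<close>: volumes
  grow like \<open>2^(n j)\<close>, values decay like \<open>4^(-p j)\<close>, and the geometric
  series converges because \<open>n < 2 p\<close>.\<close>

lemma integrable_power_tail:
  assumes p: "real DIM('a::euclidean_space) < 2 * p"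
  shows "integrable lborel (\<lambda>x::'a. (1 + (norm x)\<^sup>2) powr (- p))"
proof -
  define n where "n = real DIM('a)"
  have p0: "0 \<le> p" using p by linarith
  define f where "f x = (1 + (norm x)\<^sup>2) powr (- p)" for x :: 'a
  \<comment> \<open>On the shell \<open>2^(j-1) < |x| \<le> 2^j\<close> the value is controlled by
    the inner radius; the factor \<open>4 powr p\<close> makes up for this index shift and also
    covers \<open>j = 0\<close>.\<close>
  define G where "G j = 4 powr p * 4 powr (- p * real j)" for j :: nat
  define V where "V = unit_ball_vol n"
  have V: "0 \<le> V" by (simp add: V_def n_def)
  have pt: "ennreal (f x) \<le> (\<Sum>j. ennreal (G j) * indicator (cball 0 (2 ^ j)) x)" for x :: 'a
  proof -
    obtain j0 where j0: "norm x < 2 ^ j0" using real_arch_pow[of 2] by auto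
    define j where "j = (LEAST j. norm x \<le> 2 ^ j)"
    have j: "norm x \<le> 2 ^ j" unfolding j_def by (rule LeastI[of "\<lambda>j. norm x \<le> 2 ^ j" j0]) (use j0 in simp)
    have "f x \<le> G j"
    proof (cases j)
      case 0
      have "(1 + (norm x)\<^sup>2) powr (- p) \<le> 1 powr (- p)" using p0 by (intro powr_mono2') auto
      moreover have "1 \<le> 4 powr p" using p0 by (intro ge_one_powr_ge_zero) auto
      ultimately show ?thesis using 0 by (simp add: f_def G_def)
    next
      case (Suc i)
      have "\<not> norm x \<le> 2 ^ i" using not_less_Least[of i "\<lambda>j. norm x \<le> 2 ^ j"] Suc by (simp add: j_def)
      then have "(2 ^ i)\<^sup>2 \<le> (norm x)\<^sup>2" by (intro power_mono) auto
      then have "4 ^ i \<le> 1 + (norm x)\<^sup>2" by (simp add: power2_eq_square flip: power_mult_distrib)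
      then have "f x \<le> (4 ^ i) powr (- p)" unfolding f_def using p0 by (intro powr_mono2') auto
      also have "(4 ^ i) powr (- p) = 4 powr (- p * real i)"
        by (simp add: powr_powr mult.commute flip: powr_realpow)
      also have "\<dots> = G j" by (simp add: G_def Suc flip: powr_add) (simp add: algebra_simps)
      finally show ?thesis .
    qed
    define h where "h i = ennreal (G i) * indicator (cball 0 (2 ^ i)) x" for i
    have "ennreal (f x) \<le> h j" using j \<open>f x \<le> G j\<close> by (simp add: ennreal_leI h_def)
    also have "h j = sum h {j}" by simp
    also have "\<dots> \<le> (\<Sum>i. h i)" by (intro sum_le_suminf) auto
    also have "\<dots> = (\<Sum>i. ennreal (G i) * indicator (cball 0 (2 ^ i)) x)" by (simp add: h_def)
    finally show ?thesis .
  qed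
  have sm: "summable (\<lambda>j. G j * (V * (2 ^ j) powr n))"
  proof -
    have *: "G j * (V * (2 ^ j) powr n) = 4 powr p * V * (2 powr (n - 2 * p)) ^ j" for j
    proof -
      have "4 powr (- p * real j) = 2 powr (- (2 * p) * real j)"
        using powr_powr[of 2 2 "- p * real j"] by (simp add: mult.assoc)
      then have "4 powr (- p * real j) * (2 ^ j) powr n = 2 powr ((n - 2 * p) * real j)"
        by (simp add: powr_powr algebra_simps flip: powr_realpow powr_add)
      also have "\<dots> = (2 powr (n - 2 * p)) ^ j" by (simp add: powr_powr flip: powr_realpow)
      finally show ?thesis by (simp add: G_def)
    qed
    have "2 powr (n - 2 * p) < 1" using p powr_less_mono[of "n - 2 * p" 0 2] by (simp add: n_def)
    then show ?thesis unfolding * by (simp add: summable_mult summable_geometric)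
  qed
  have "(\<integral>\<^sup>+x. ennreal (f x) \<partial>lborel) \<le> (\<integral>\<^sup>+x. (\<Sum>j. ennreal (G j) * indicator (cball (0::'a) (2 ^ j)) x) \<partial>lborel)"
    by (rule nn_integral_mono) (rule pt)
  also have "\<dots> = (\<Sum>j. \<integral>\<^sup>+x. ennreal (G j) * indicator (cball (0::'a) (2 ^ j)) x \<partial>lborel)"
    by (intro nn_integral_suminf borel_measurable_times_ennreal borel_measurable_indicator) auto
  also have "\<dots> = (\<Sum>j. ennreal (G j * (V * (2 ^ j) powr n)))"
  proof (intro suminf_cong)
    fix j
    have "(\<integral>\<^sup>+x. ennreal (G j) * indicator (cball (0::'a) (2 ^ j)) x \<partial>lborel) = ennreal (G j) * emeasure lborel (cball (0::'a) (2 ^ j))"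
      by (rule nn_integral_cmult_indicator) auto
    also have "emeasure lborel (cball (0::'a) (2 ^ j)) = ennreal (V * (2 ^ j) powr n)"
      by (simp add: emeasure_cball V_def n_def powr_realpow)
    finally show "(\<integral>\<^sup>+x. ennreal (G j) * indicator (cball (0::'a) (2 ^ j)) x \<partial>lborel) = ennreal (G j * (V * (2 ^ j) powr n))"
      using V by (simp add: ennreal_mult G_def)
  qed
  also have "\<dots> = ennreal (\<Sum>j. G j * (V * (2 ^ j) powr n))"
    using sm V by (intro suminf_ennreal_eq) (auto simp: G_def intro: summable_sums)
  also have "\<dots> < \<infinity>" by simp
  finally have "(\<integral>\<^sup>+x. ennreal (norm (f x)) \<partial>lborel) < \<infinity>" by (simp add: f_def)
  moreover have "f \<in> borel_measurable lborel" unfolding f_def by measurable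
  ultimately show ?thesis unfolding f_def[symmetric] by (intro integrableI_bounded) auto
qed

text \<open>The cutoff error at radius \<open>R = m + 1\<close> for an integrand with a power tail.
  The \<open>itself\<close> argument carries the space, hence the dimension.\<close>

definition tail_error :: "'a::euclidean_space itself \<Rightarrow> real \<Rightarrow> nat \<Rightarrow> real" where
  "tail_error _ p m = (\<integral>x. indicator (cball (0::'a) (real (Suc m))) x * (1 + (norm x)\<^sup>2) powr (- p) \<partial>lborel) / (real (Suc m))\<^sup>2"

text \<open>On the ball \<open>1 / R^2 \<le> 2 / (1 + |x|^2)\<close>, which gains one power: the
  integrands are dominated by a multiple of the integrable tail of exponent \<open>p + 1\<close>,
  and they tend to 0 pointwise.\<close>

lemma tail_error_tendsto:
  assumes p: "real DIM('a::euclidean_space) < 2 * (p + 1)"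
  shows "tail_error TYPE('a) p \<longlonglongrightarrow> 0"
proof -
  define F where "F m x = indicator (cball 0 (real (Suc m))) x * (1 + (norm x)\<^sup>2) powr (- p) / (real (Suc m))\<^sup>2" for m and x :: 'a
  have "(\<lambda>m. \<integral>x. F m x \<partial>lborel) \<longlonglongrightarrow> (\<integral>x. 0 \<partial>(lborel :: 'a measure))"
  proof (rule integral_dominated_convergence[where w="\<lambda>x. 2 * (1 + (norm x)\<^sup>2) powr (- (p + 1))"])
    show "integrable lborel (\<lambda>x::'a. 2 * (1 + (norm x)\<^sup>2) powr (- (p + 1)))"
      by (intro integrable_mult_right integrable_power_tail p)
    show "AE x in lborel. (\<lambda>m. F m x) \<longlonglongrightarrow> 0"
    proof (intro AE_I2)
      fix x :: 'a
      have "(\<lambda>m. inverse (real (Suc m))) \<longlonglongrightarrow> 0" by (rule LIMSEQ_inverse_real_of_nat)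
      then have "(\<lambda>m. (1 + (norm x)\<^sup>2) powr (- p) * (inverse (real (Suc m)))\<^sup>2) \<longlonglongrightarrow> (1 + (norm x)\<^sup>2) powr (- p) * 0\<^sup>2"
        by (intro tendsto_intros)
      then have *: "(\<lambda>m. (1 + (norm x)\<^sup>2) powr (- p) * (inverse (real (Suc m)))\<^sup>2) \<longlonglongrightarrow> 0" by simp
      show "(\<lambda>m. F m x) \<longlonglongrightarrow> 0"
        by (rule Lim_null_comparison[OF _ *], rule always_eventually, rule allI,
            unfold F_def divide_inverse power_inverse, auto simp: indicator_def simp del: of_nat_Suc)
    qed
    show "AE x in lborel. norm (F m x) \<le> 2 * (1 + (norm x)\<^sup>2) powr (- (p + 1))" for m
    proof (intro AE_I2)
      fix x :: 'a
      show "norm (F m x) \<le> 2 * (1 + (norm x)\<^sup>2) powr (- (p + 1))"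
      proof (cases "norm x \<le> real (Suc m)")
        case True
        have "(norm x)\<^sup>2 \<le> (real (Suc m))\<^sup>2" using True by (intro power_mono) auto
        moreover have "1 \<le> (real (Suc m))\<^sup>2" by (intro one_le_power) auto
        ultimately have "1 + (norm x)\<^sup>2 \<le> 2 * (real (Suc m))\<^sup>2" by linarith
        then have "1 / (real (Suc m))\<^sup>2 \<le> 2 / (1 + (norm x)\<^sup>2)"
          by (simp add: field_simps add_pos_nonneg)
        then have "(1 + (norm x)\<^sup>2) powr (- p) * (1 / (real (Suc m))\<^sup>2) \<le> (1 + (norm x)\<^sup>2) powr (- p) * (2 / (1 + (norm x)\<^sup>2))"
          by (intro mult_left_mono) auto
        moreover have "(1 + (norm x)\<^sup>2) powr (- (p + 1)) = (1 + (norm x)\<^sup>2) powr (- p) / (1 + (norm x)\<^sup>2)"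
          using powr_diff[of "1 + (norm x)\<^sup>2" "- p" 1] by (simp add: add_pos_nonneg powr_one_gt_zero_iff)
        ultimately show ?thesis using True by (simp add: F_def mult_ac)
      qed (simp add: F_def)
    qed
    show "F m \<in> borel_measurable lborel" for m
    proof -
      have "(\<lambda>x::'a. (1 + (norm x)\<^sup>2) powr (- p)) \<in> borel_measurable borel"
        by (intro borel_measurable_continuous_onI continuous_intros) (smt (verit) zero_le_power2)
      then have "(\<lambda>x::'a. (1 + (norm x)\<^sup>2) powr (- p)) \<in> borel_measurable lborel" by simp
      moreover have "(indicator (cball 0 (real (Suc m))) :: 'a \<Rightarrow> real) \<in> borel_measurable lborel"
        by (intro borel_measurable_indicator) auto
      ultimately show ?thesis unfolding F_def by (intro borel_measurable_divide borel_measurable_times) auto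
    qed
  qed auto
  then show ?thesis by (simp add: F_def tail_error_def[abs_def])
qed

text \<open>Three choices are used: \<open>A = \<beta> = 1\<close> for the contraction;
  \<open>A\<close> the squared rescaling factor and \<open>\<beta>\<close> a negative power of
  \<open>T - t\<close> for the decay; \<open>A = 1\<close> and \<open>\<beta>\<close> a decaying
  exponential for the comparison. The constant for the mixed term is \<open>\<alpha>\<close> because
  \<open>A r \<le> k + A r\<close>.\<close>

lemma radial_weight_power:
  fixes A A' \<beta> \<beta>' :: "real \<Rightarrow> real"
  assumes k: "0 < k" and \<alpha>: "0 \<le> \<alpha>" and A: "\<And>t. t \<in> I \<Longrightarrow> 0 < A t" and \<beta>: "\<And>t. t \<in> I \<Longrightarrow> 0 \<le> \<beta> t"
    and dA: "\<And>t. t \<in> I \<Longrightarrow> (A has_real_derivative A' t) (at t within I)"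
    and d\<beta>: "\<And>t. t \<in> I \<Longrightarrow> (\<beta> has_real_derivative \<beta>' t) (at t within I)"
    and c: "continuous_on I A'" "continuous_on I \<beta>'"
  shows "radial_weight \<alpha> I (\<lambda>r t. \<beta> t * (k + A t * r) powr (- \<alpha>))
     (\<lambda>r t. - \<alpha> * A t * \<beta> t * (k + A t * r) powr (- \<alpha> - 1))
     (\<lambda>r t. \<alpha> * (\<alpha> + 1) * (A t)\<^sup>2 * \<beta> t * (k + A t * r) powr (- \<alpha> - 2))
     (\<lambda>r t. \<beta>' t * (k + A t * r) powr (- \<alpha>) - \<alpha> * A' t * r * \<beta> t * (k + A t * r) powr (- \<alpha> - 1))"
  unfolding radial_weight_def
proof (intro conjI allI ballI impI)
  have D: "0 < k + A t * r" if "0 \<le> r" "t \<in> I" for r t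
    using k A[OF that(2)] that by (simp add: add_pos_nonneg)
  have cA: "continuous_on I A" "continuous_on I \<beta>" using dA d\<beta> by (auto intro: DERIV_continuous_on)
  have cc: "continuous_on ({0..} \<times> I) (\<lambda>z. h (snd z))" if "continuous_on I h" for h :: "real \<Rightarrow> real"
    by (rule continuous_on_compose2[OF that]) (auto intro!: continuous_intros)
  have cD: "continuous_on ({0..} \<times> I) (\<lambda>z. (k + A (snd z) * fst z) powr s)" for s
  proof (intro continuous_intros cc[OF cA(1)])
    show "\<forall>z\<in>{0..} \<times> I. k + A (snd z) * fst z \<noteq> 0" using D by fastforce
  qed
  show "continuous_on ({0..} \<times> I) (\<lambda>(r, t). \<beta> t * (k + A t * r) powr (- \<alpha>))"
    "continuous_on ({0..} \<times> I) (\<lambda>(r, t). \<beta>' t * (k + A t * r) powr (- \<alpha>) - \<alpha> * A' t * r * \<beta> t * (k + A t * r) powr (- \<alpha> - 1))"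
    unfolding split_beta by (intro continuous_intros cD cc[OF cA(2)] cc[OF c(1)] cc[OF c(2)])+
  {
    fix t assume t: "t \<in> I"
    show "continuous_on {0..} (\<lambda>r. \<alpha> * (\<alpha> + 1) * (A t)\<^sup>2 * \<beta> t * (k + A t * r) powr (- \<alpha> - 2))"
    proof (intro continuous_intros)
      show "\<forall>r\<in>{0..}. k + A t * r \<noteq> 0" using D t by fastforce
    qed
  }
  fix r t assume r: "(0::real) \<le> r" and t: "t \<in> I"
  show "0 \<le> \<beta> t * (k + A t * r) powr (- \<alpha>)" using \<beta>[OF t] by simp
  have dl: "((\<lambda>r. k + A t * r) has_real_derivative A t) (at r)" by (auto intro!: derivative_eq_intros)
  have dp: "((\<lambda>r. (k + A t * r) powr s) has_real_derivative s * (k + A t * r) powr (s - 1) * A t) (at r)" for s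
    using DERIV_fun_powr[OF dl D[OF r t], of s] by simp
  show "((\<lambda>r. \<beta> t * (k + A t * r) powr (- \<alpha>)) has_real_derivative - \<alpha> * A t * \<beta> t * (k + A t * r) powr (- \<alpha> - 1)) (at r)"
    using DERIV_cmult[OF dp[of "- \<alpha>"], of "\<beta> t"] by (simp add: mult_ac)
  have "- \<alpha> - 1 - 1 = - \<alpha> - 2" by simp
  then show "((\<lambda>r. - \<alpha> * A t * \<beta> t * (k + A t * r) powr (- \<alpha> - 1)) has_real_derivative
     \<alpha> * (\<alpha> + 1) * (A t)\<^sup>2 * \<beta> t * (k + A t * r) powr (- \<alpha> - 2)) (at r)"
    using DERIV_cmult[OF dp[of "- \<alpha> - 1"], of "- \<alpha> * A t * \<beta> t"]
    by (simp add: algebra_simps power2_eq_square)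
  have "((\<lambda>t. k + A t * r) has_real_derivative A' t * r) (at t within I)"
    using DERIV_add[OF DERIV_const[of k] DERIV_cmult_right[OF dA[OF t], of r]] by simp
  moreover have "((\<lambda>x. x powr (- \<alpha>)) has_real_derivative - \<alpha> * (k + A t * r) powr (- \<alpha> - 1)) (at (k + A t * r))"
    using has_real_derivative_powr[OF D[OF r t]] .
  ultimately have dq: "((\<lambda>t. (k + A t * r) powr (- \<alpha>)) has_real_derivative - \<alpha> * (k + A t * r) powr (- \<alpha> - 1) * (A' t * r)) (at t within I)"
    using DERIV_chain2 by fast
  show "((\<lambda>t. \<beta> t * (k + A t * r) powr (- \<alpha>)) has_real_derivative
     \<beta>' t * (k + A t * r) powr (- \<alpha>) - \<alpha> * A' t * r * \<beta> t * (k + A t * r) powr (- \<alpha> - 1)) (at t within I)"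
    using DERIV_mult[OF d\<beta>[OF t] dq] by (simp add: algebra_simps)
  have "(k + A t * r) powr (- \<alpha> - 1) * (k + A t * r) = (k + A t * r) powr (- \<alpha>)"
    using D[OF r t] by (simp add: powr_diff)
  moreover have "(k + A t * r) powr (- \<alpha> - 1) * (A t * r) \<le> (k + A t * r) powr (- \<alpha> - 1) * (k + A t * r)"
    using k by (intro mult_left_mono) auto
  ultimately have "\<alpha> * \<beta> t * ((k + A t * r) powr (- \<alpha> - 1) * (A t * r)) \<le> \<alpha> * \<beta> t * (k + A t * r) powr (- \<alpha>)"
    using \<alpha> \<beta>[OF t] by (intro mult_left_mono) auto
  moreover have "\<bar>- \<alpha> * A t * \<beta> t * (k + A t * r) powr (- \<alpha> - 1)\<bar> = \<alpha> * A t * \<beta> t * (k + A t * r) powr (- \<alpha> - 1)"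
    using \<alpha> A[OF t] \<beta>[OF t] by (simp add: abs_mult)
  ultimately show "r * \<bar>- \<alpha> * A t * \<beta> t * (k + A t * r) powr (- \<alpha> - 1)\<bar> \<le> \<alpha> * (\<beta> t * (k + A t * r) powr (- \<alpha>))"
    by (simp add: mult_ac)
qed

text \<open>With positive parameters the sign is that of the last factor, so that the weight is
  superharmonic when \<open>2 (\<alpha> + 1) \<le> n\<close>.\<close>

lemma power_weight_laplacian:
  fixes A b k r \<alpha> n :: real
  assumes "0 < k + A * r"
  shows "4 * r * (\<alpha> * (\<alpha> + 1) * A\<^sup>2 * b * (k + A * r) powr (- \<alpha> - 2)) + 2 * n * (- \<alpha> * A * b * (k + A * r) powr (- \<alpha> - 1))
     = 2 * \<alpha> * A * b * (k + A * r) powr (- \<alpha> - 2) * (2 * (\<alpha> + 1) * (A * r) - n * (k + A * r))"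
proof -
  have "(k + A * r) powr (- \<alpha> - 1) = (k + A * r) powr (- \<alpha> - 2) * (k + A * r)"
  proof -
    have "- \<alpha> - 1 = (- \<alpha> - 2) + 1" by simp
    then show ?thesis using assms powr_add[of "k + A * r" "- \<alpha> - 2" 1] by (simp only: powr_one less_imp_le)
  qed
  then show ?thesis by (simp add: algebra_simps power2_eq_square)
qed

text \<open>The rescaled variable is \<open>y = x (sc N T t)\<^sup>1\<^sup>/\<^sup>2\<close>.\<close>
definition sc :: "real \<Rightarrow> real \<Rightarrow> real \<Rightarrow> real" where
  "sc n T t = (T - t) powr (2 / (n - 2))"

section \<open>Elementary bounds for Barenblatt solutions\<close>

context
  fixes T :: real
  assumes dim: "3 \<le> DIM('a::euclidean_space)"
begin

lemma sc_pos: "t < T \<Longrightarrow> 0 < sc (real DIM('a)) T t" by (simp add: sc_def)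

lemma sc_antimono: "s \<le> t \<Longrightarrow> t < T \<Longrightarrow> sc (real DIM('a)) T t \<le> sc (real DIM('a)) T s"
  unfolding sc_def using dim by (intro powr_mono2) auto

lemma barenblatt_sc:
  "t < T \<Longrightarrow> barenblatt T k (x::'a) t = 2 * (real DIM('a) - 2) * ((T - t) * sc (real DIM('a)) T t) / (k + sc (real DIM('a)) T t * (norm x)\<^sup>2)"
  unfolding sc_def by (rule barenblatt_eq[OF dim])

lemma barenblatt_denominator_pos: "0 < k \<Longrightarrow> t < T \<Longrightarrow> 0 < k + sc (real DIM('a)) T t * (norm (x::'a))\<^sup>2"
  using sc_pos[of t] by (simp add: add_pos_nonneg)

lemma barenblatt_pos: "0 < k \<Longrightarrow> t < T \<Longrightarrow> 0 < barenblatt T k (x::'a) t"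
  using barenblatt_denominator_pos[of k t x] sc_pos[of t] dim by (simp add: barenblatt_sc)

lemma barenblatt_antimono_k: "0 < k \<Longrightarrow> k \<le> k' \<Longrightarrow> t < T \<Longrightarrow> barenblatt T k' (x::'a) t \<le> barenblatt T k x t"
  using barenblatt_denominator_pos[of k t x] sc_pos[of t] dim
  by (auto simp: barenblatt_sc intro!: divide_left_mono mult_pos_pos)

text \<open>From \<open>ln z \<le> z - 1\<close> for the quotient of the two denominators. This
  quadratic decay in space is what the pinching tells about the logarithmic ratio before any
  integral estimate.\<close>

lemma ln_barenblatt_diff_le:
  assumes "0 < k" "k \<le> k'" "t < T"
  shows "ln (barenblatt T k (x::'a) t) - ln (barenblatt T k' x t) \<le> (k' - k) / (k + sc (real DIM('a)) T t * (norm x)\<^sup>2)"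
proof -
  define r where "r = sc (real DIM('a)) T t * (norm x)\<^sup>2"
  have d: "0 < k + r" "0 < k' + r" using barenblatt_denominator_pos[of k t x] assms by (auto simp: r_def)
  have M: "0 < 2 * (real DIM('a) - 2) * ((T - t) * sc (real DIM('a)) T t)" (is "0 < ?M") using assms sc_pos[of t] dim by simp
  have "ln (barenblatt T k x t) - ln (barenblatt T k' x t) = ln (?M / (k + r)) - ln (?M / (k' + r))"
    using assms by (simp add: barenblatt_sc r_def)
  also have "\<dots> = (ln ?M - ln (k + r)) - (ln ?M - ln (k' + r))"
    using M d by (subst (1 2) ln_divide_pos) auto
  also have "\<dots> = ln ((k' + r) / (k + r))" using d by (simp add: ln_div)
  also have "\<dots> \<le> (k' + r) / (k + r) - 1" using d by (intro ln_le_minus_one) simp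
  also have "\<dots> = (k' - k) / (k + r)" using d by (simp add: field_simps)
  finally show ?thesis by (simp add: r_def)
qed

lemma barenblatt_two_sided:
  assumes k: "0 < k" "0 < k'" and t0: "0 \<le> t0" "t0 < T"
  obtains c C where "0 < c" "0 < C"
    "\<And>x t. 0 \<le> t \<Longrightarrow> t \<le> t0 \<Longrightarrow> c / (1 + (norm x)\<^sup>2) \<le> barenblatt T k' (x::'a) t"
    "\<And>x t. 0 \<le> t \<Longrightarrow> t \<le> t0 \<Longrightarrow> barenblatt T k (x::'a) t \<le> C / (1 + (norm x)\<^sup>2)"
proof -
  define n where "n = real DIM('a) - 2"
  have n: "0 < n" using dim by (simp add: n_def)
  define A0 where "A0 = sc (real DIM('a)) T t0"
  define A1 where "A1 = sc (real DIM('a)) T 0"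
  have A: "0 < A0" "0 < A1" using t0 by (auto simp: A0_def A1_def sc_pos)
  define c where "c = 2 * n * ((T - t0) * A0) / (k' + A1)"
  define C where "C = 2 * n * (T * A1) / min k A0"
  have st: "A0 \<le> sc (real DIM('a)) T t" "sc (real DIM('a)) T t \<le> A1" if "0 \<le> t" "t \<le> t0" for t
    using that t0 by (auto simp: A0_def A1_def intro!: sc_antimono)
  show ?thesis
  proof (rule that[of c C])
    show "0 < c" "0 < C" using n t0 A k by (auto simp: c_def C_def)
    fix x :: 'a and t assume t: "0 \<le> t" "t \<le> t0"
    define s where "s = sc (real DIM('a)) T t"
    define r where "r = (norm x)\<^sup>2"
    have r: "0 \<le> r" by (simp add: r_def)
    have s: "A0 \<le> s" "s \<le> A1" "0 < s" using st[OF t] A by (auto simp: s_def)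
    have num: "2 * n * ((T - t0) * A0) \<le> 2 * n * ((T - t) * s)" "2 * n * ((T - t) * s) \<le> 2 * n * (T * A1)"
      using t t0 s A n by (auto intro!: mult_left_mono mult_mono)
    have "k' + s * r \<le> (k' + A1) * (1 + r)"
      using mult_right_mono[OF s(2) r] mult_nonneg_nonneg[OF less_imp_le[OF k(2)] r] A
      by (simp add: algebra_simps)
    then have "2 * n * ((T - t0) * A0) / ((k' + A1) * (1 + r)) \<le> 2 * n * ((T - t) * s) / (k' + s * r)"
      using num n t0 A k s r t by (intro frac_le) (auto intro!: add_pos_nonneg)
    then show "c / (1 + (norm x)\<^sup>2) \<le> barenblatt T k' x t"
      using t t0 by (simp add: c_def barenblatt_sc r_def s_def n_def)
    have "min k A0 * (1 + r) \<le> k + s * r"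
    proof -
      have "min k A0 * r \<le> s * r" using s r by (intro mult_right_mono) auto
      moreover have "min k A0 \<le> k" by simp
      ultimately show ?thesis by (simp add: algebra_simps del: min.cobounded1)
    qed
    then have "2 * n * ((T - t) * s) / (k + s * r) \<le> 2 * n * (T * A1) / (min k A0 * (1 + r))"
      using num n t0 A k s r t by (intro frac_le) (auto intro!: add_pos_nonneg mult_pos_pos)
    then show "barenblatt T k x t \<le> C / (1 + (norm x)\<^sup>2)"
      using t t0 by (simp add: C_def barenblatt_sc r_def s_def n_def)
  qed
qed

end

text \<open>The initial data and \<open>f\<close> are measurable for the completed measure only, the
  solutions at positive times are continuous; an integral of the second kind is bounded here by a
  majorant of the first.\<close>

lemma lborel_integral_le_lebesgue:
  fixes F :: "'a::euclidean_space \<Rightarrow> real"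
  assumes F: "continuous_on UNIV F" "\<And>x. R \<le> norm x \<Longrightarrow> F x = 0"
    and H: "integrable lebesgue H" and le: "AE x in lebesgue. F x \<le> H x"
  shows "(\<integral>x. F x \<partial>lborel) \<le> (\<integral>x. H x \<partial>lebesgue)"
proof -
  have m: "F \<in> borel_measurable lborel" using F(1) by (simp add: borel_measurable_continuous_onI)
  have "(\<integral>x. F x \<partial>lborel) = (\<integral>x. F x \<partial>lebesgue)" by (rule integral_completion[OF m, symmetric])
  also have "\<dots> \<le> (\<integral>x. H x \<partial>lebesgue)"
    using integrable_compact_support[OF F] by (intro integral_mono_AE H le) (simp add: integrable_completion[OF m])
  finally show ?thesis .
qed

section \<open>The unweighted contraction estimate\<close>

text \<open>The solution property concerns an open time interval; this statement reaches the initial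
  time 0, where \<open>u0\<close> is compared with the Barenblatt profile.\<close>

lemma barenblatt_continuous:
  assumes "3 \<le> DIM('a::euclidean_space)" "0 < k"
  shows "continuous_on (UNIV \<times> {..<T}) (\<lambda>(x::'a, t). barenblatt T k x t)"
proof -
  have "continuous_on (UNIV \<times> {..<T}) (\<lambda>z::'a \<times> real. 2 * (real DIM('a) - 2) * ((T - snd z) * sc (real DIM('a)) T (snd z)) / (k + sc (real DIM('a)) T (snd z) * (norm (fst z))\<^sup>2))"
  proof (rule continuous_on_divide)
    have c: "continuous_on (UNIV \<times> {..<T}) (\<lambda>z::'a \<times> real. sc (real DIM('a)) T (snd z))"
      unfolding sc_def by (auto intro!: continuous_intros)
    show "continuous_on (UNIV \<times> {..<T}) (\<lambda>z::'a \<times> real. 2 * (real DIM('a) - 2) * ((T - snd z) * sc (real DIM('a)) T (snd z)))"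
      "continuous_on (UNIV \<times> {..<T}) (\<lambda>z::'a \<times> real. k + sc (real DIM('a)) T (snd z) * (norm (fst z))\<^sup>2)"
      by (intro continuous_intros c)+
    show "\<forall>z\<in>UNIV \<times> {..<T}. k + sc (real DIM('a)) T (snd z) * (norm (fst z :: 'a))\<^sup>2 \<noteq> 0"
    proof
      fix z :: "'a \<times> real" assume "z \<in> UNIV \<times> {..<T}"
      then have "snd z < T" by auto
      from barenblatt_denominator_pos[OF assms this, of "fst z"]
      show "k + sc (real DIM('a)) T (snd z) * (norm (fst z))\<^sup>2 \<noteq> 0" by linarith
    qed
  qed
  then show ?thesis by (rule continuous_on_eq) (auto simp: barenblatt_sc[OF assms(1)])
qed

lemma tail_error_bound:
  fixes F :: "'a::euclidean_space \<Rightarrow> real"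
  assumes F: "continuous_on UNIV F" and le: "\<And>x. F x \<le> C * (1 + (norm x)\<^sup>2) powr (- p)"
  shows "(\<integral>x. indicator (cball 0 (real (Suc m))) x * F x \<partial>lborel) / (real (Suc m))\<^sup>2 \<le> C * tail_error TYPE('a) p m"
proof -
  have i: "integrable lborel (\<lambda>x::'a. indicator (cball 0 (real (Suc m))) x * g x)" if "continuous_on UNIV g" for g :: "'a \<Rightarrow> real"
    using borel_integrable_compact[of "cball 0 (real (Suc m))" g, OF compact_cball continuous_on_subset[OF that]] by simp
  have c: "continuous_on UNIV (\<lambda>x::'a. (1 + (norm x)\<^sup>2) powr (- p))"
    by (intro continuous_intros) (smt (verit) zero_le_power2)
  have "(\<integral>x. indicator (cball 0 (real (Suc m))) x * F x \<partial>lborel)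
      \<le> (\<integral>x. C * (indicator (cball (0::'a) (real (Suc m))) x * (1 + (norm x)\<^sup>2) powr (- p)) \<partial>lborel)"
    by (intro integral_mono i F integrable_mult_right c)
       (use le in \<open>auto simp: indicator_def\<close>)
  then show ?thesis by (simp add: tail_error_def divide_right_mono)
qed

text \<open>The estimates are made over an arbitrary euclidean space; the coordinate space
  \<open>real ^ 'n\<close> enters in the final theorem.\<close>

locale pinched_solution =
  fixes T k0 k1 k2 :: real and u :: "'a::euclidean_space \<Rightarrow> real \<Rightarrow> real" and u0 f :: "'a \<Rightarrow> real"
  assumes dim: "5 \<le> DIM('a)" and T: "0 < T" and sol: "log_diffusion_solution T u0 u"
    and k: "0 < k2" "k2 < k1" "0 < k0"
    and f: "integrable lebesgue f"
    and u0: "AE x in lebesgue. u0 x = barenblatt T k0 x 0 + f x"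
    and bd: "\<And>x t. 0 < t \<Longrightarrow> t < T \<Longrightarrow> barenblatt T k1 x t \<le> u x t \<and> u x t \<le> barenblatt T k2 x t"
begin

abbreviation "B \<equiv> barenblatt T k0 :: 'a \<Rightarrow> real \<Rightarrow> real"
text \<open>The hypotheses do not place \<open>k0\<close> between \<open>k2\<close> and
  \<open>k1\<close>; with \<open>km\<close> and \<open>kM\<close> both \<open>u\<close> and
  \<open>B\<close> lie between the same two Barenblatt solutions.\<close>

abbreviation "km \<equiv> min k0 k2"
abbreviation "kM \<equiv> max k0 k1"
abbreviation "q \<equiv> \<lambda>x t. u x t - B x t"
abbreviation "g \<equiv> \<lambda>x t. ln (u x t) - ln (B x t)"

lemma dim3: "3 \<le> DIM('a)" using dim by simp
lemma n5: "5 \<le> real DIM('a)" using dim by simp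

lemma km: "0 < km" "km \<le> kM" "0 < kM" using k by auto

lemma u_sol: "smooth_positive_solution T u (\<lambda>x t. deriv (\<lambda>\<tau>. u x \<tau>) t)"
  by (rule smooth_positive_solution_of_log_diffusion[OF sol])

lemma B_sol: "smooth_positive_solution T B (barenblatt_dt T k0)"
  by (rule smooth_positive_solution_barenblatt[OF dim3 k(3)])

lemma bounds:
  assumes "0 < t" "t < T"
  shows "barenblatt T kM x t \<le> u x t" "u x t \<le> barenblatt T km x t"
    "barenblatt T kM x t \<le> B x t" "B x t \<le> barenblatt T km x t"
  using bd[OF assms, of x] assms k
    barenblatt_antimono_k[OF dim3, of k1 kM t T x] barenblatt_antimono_k[OF dim3, of km k2 t T x]
    barenblatt_antimono_k[OF dim3, of k0 kM t T x] barenblatt_antimono_k[OF dim3, of km k0 t T x]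
  by (auto intro: order.trans)

lemma pos: "0 < t \<Longrightarrow> t < T \<Longrightarrow> 0 < u x t" "t < T \<Longrightarrow> 0 < B x t"
  using u_sol barenblatt_pos[OF dim3, of k0 t T x] k by (auto simp: smooth_positive_solution_def)

lemma cont_u: "0 < t \<Longrightarrow> t < T \<Longrightarrow> continuous_on UNIV (\<lambda>x. u x t)"
  using u_sol by (auto simp: smooth_positive_solution_def intro: continuous_on_slice[where I="{0<..<T}"])

lemma cont_B: "t < T \<Longrightarrow> continuous_on UNIV (\<lambda>x. B x t)"
  by (rule continuous_on_slice[OF barenblatt_continuous[OF dim3 k(3)]]) auto

lemma cont_g: assumes "0 < t" "t < T" shows "continuous_on UNIV (\<lambda>x. g x t)"
proof (intro continuous_intros cont_u cont_B assms)
  show "\<forall>x\<in>UNIV. u x t \<noteq> 0" "\<forall>x\<in>UNIV. B x t \<noteq> 0" using pos assms by (metis less_irrefl)+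
qed

lemma g_le:
  assumes "0 < t" "t < T"
  shows "\<bar>g x t\<bar> \<le> (kM - km) / (km + sc (real DIM('a)) T t * (norm x)\<^sup>2)"
proof -
  note b = bounds[OF assms, of x]
  have p: "0 < barenblatt T kM x t" using barenblatt_pos[OF dim3 km(3) assms(2)] .
  have "\<bar>g x t\<bar> \<le> ln (barenblatt T km x t) - ln (barenblatt T kM x t)"
    using b p pos(1)[OF assms, of x] pos(2)[OF assms(2), of x]
      ln_mono[of "barenblatt T kM x t" "u x t"] ln_mono[of "u x t" "barenblatt T km x t"]
      ln_mono[of "barenblatt T kM x t" "B x t"] ln_mono[of "B x t" "barenblatt T km x t"]
    by linarith
  also have "\<dots> \<le> (kM - km) / (km + sc (real DIM('a)) T t * (norm x)\<^sup>2)"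
    by (rule ln_barenblatt_diff_le[OF dim3 km(1,2) assms(2)])
  finally show ?thesis .
qed

text \<open>The difference is split as \<open>|u - u0| + |B - B(0)| + |f|\<close>; the first part
  vanishes by the initial condition in local L1, the second by continuity up to time 0. A majorant
  \<open>h\<close> with a limit suffices for passing to the initial time in an inequality.\<close>

lemma initial_bound:
  assumes \<phi>: "continuous_on UNIV \<phi>" "\<And>x. R \<le> norm x \<Longrightarrow> \<phi> x = 0" "\<And>x. 0 \<le> \<phi> x" "\<And>x. \<phi> x \<le> c"
  obtains h where "(h \<longlongrightarrow> c * (\<integral>x. \<bar>f x\<bar> \<partial>lebesgue)) (at_right 0)"
    "\<And>t. 0 < t \<Longrightarrow> t < T \<Longrightarrow> (\<integral>x. \<bar>q x t\<bar> * \<phi> x \<partial>lborel) \<le> h t"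
proof -
  define K where "K = cball (0::'a) R"
  have K: "compact K" by (simp add: K_def)
  define b where "b t = (\<integral>x. \<bar>B x t - B x 0\<bar> * \<phi> x \<partial>lborel)" for t
  define h where "h t = c * (LINT x:K|lebesgue. \<bar>u x t - u0 x\<bar>) + b t + c * (\<integral>x. \<bar>f x\<bar> \<partial>lebesgue)" for t
  have c: "0 \<le> c" using \<phi>(3)[of 0] \<phi>(4)[of 0] by linarith
  have cBB: "continuous_on UNIV (\<lambda>x. \<bar>B x t - B x 0\<bar> * \<phi> x)" if "t < T" for t
    by (intro continuous_intros cont_B that T \<phi>)
  have "(b \<longlongrightarrow> 0) (at_right 0)"
  proof -
    obtain a :: 'a where a: "cball 0 R \<subseteq> cbox (- a) a"
      using bounded_subset_cbox_symmetric[OF bounded_cball] by blast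
    have cB: "continuous_on ({0..T/2} \<times> cbox (- a) a) (\<lambda>z. B (snd z) (fst z))"
      by (rule continuous_on_swapped[OF barenblatt_continuous[OF dim3 k(3), of T]]) (use T in auto)
    have "continuous_on {0..T/2} (\<lambda>t. integral (cbox (- a) a) (\<lambda>x. \<bar>B x t - B x 0\<bar> * \<phi> x))"
    proof (rule integral_continuous_on_param)
      have "continuous_on ({0..T/2} \<times> cbox (- a) a) (\<lambda>z. \<bar>B (snd z) (fst z) - B (snd z) 0\<bar> * \<phi> (snd z))"
        by (intro continuous_intros cB continuous_on_compose2[OF cont_B[OF T]] continuous_on_compose2[OF \<phi>(1)]) auto
      then show "continuous_on ({0..T/2} \<times> cbox (- a) a) (\<lambda>(t, x). \<bar>B x t - B x 0\<bar> * \<phi> x)"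
        by (simp add: split_beta)
    qed
    then have "continuous_on {0..T/2} b"
    proof (rule continuous_on_eq)
      show "integral (cbox (- a) a) (\<lambda>x. \<bar>B x t - B x 0\<bar> * \<phi> x) = b t" if "t \<in> {0..T/2}" for t
        unfolding b_def by (rule lborel_integral_eq_cbox[OF cBB _ a, symmetric]) (use \<phi> that T in auto)
    qed
    then have "(b \<longlongrightarrow> b 0) (at 0 within {0..T/2})"
      using T by (auto simp: continuous_on_def)
    moreover have "b 0 = 0" by (simp add: b_def)
    ultimately show ?thesis using T by (simp add: at_within_Icc_at_right)
  qed
  moreover have "((\<lambda>t. LINT x:K|lebesgue. \<bar>u x t - u0 x\<bar>) \<longlongrightarrow> 0) (at_right 0)"
    using sol K by (simp add: log_diffusion_solution_def)
  ultimately have "(h \<longlongrightarrow> c * 0 + 0 + c * (\<integral>x. \<bar>f x\<bar> \<partial>lebesgue)) (at_right 0)"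
    unfolding h_def by (intro tendsto_intros)
  then have lim: "(h \<longlongrightarrow> c * (\<integral>x. \<bar>f x\<bar> \<partial>lebesgue)) (at_right 0)" by simp
  show ?thesis
  proof (rule that[OF lim])
    fix t assume t: "0 < t" "t < T"
    define H where "H x = c * (indicator K x *\<^sub>R \<bar>u x t - u0 x\<bar>) + \<bar>B x t - B x 0\<bar> * \<phi> x + c * \<bar>f x\<bar>" for x
    have mu: "(\<lambda>x. indicator K x *\<^sub>R u x t) \<in> borel_measurable lborel"
      using borel_integrable_compact[OF K continuous_on_subset[OF cont_u[OF t] subset_UNIV]] by (rule borel_measurable_integrable)
    have "set_integrable lebesgue K (\<lambda>x. u x t)"
      unfolding set_integrable_def using borel_integrable_compact[OF K continuous_on_subset[OF cont_u[OF t] subset_UNIV]]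
      unfolding integrable_completion[OF mu] .
    moreover have "set_integrable lebesgue K u0" using sol K by (simp add: log_diffusion_solution_def locally_integrable_def)
    ultimately have "set_integrable lebesgue K (\<lambda>x. \<bar>u x t - u0 x\<bar>)"
      by (intro set_integrable_abs set_integral_diff)
    then have i1: "integrable lebesgue (\<lambda>x. indicator K x *\<^sub>R \<bar>u x t - u0 x\<bar>)" by (simp add: set_integrable_def)
    have mb: "(\<lambda>x. \<bar>B x t - B x 0\<bar> * \<phi> x) \<in> borel_measurable lborel"
      using cBB[OF t(2)] by (simp add: borel_measurable_continuous_onI)
    have "integrable lborel (\<lambda>x. \<bar>B x t - B x 0\<bar> * \<phi> x)"
      by (rule integrable_compact_support[where R=R]) (use cBB t \<phi> in auto)
    then have i2: "integrable lebesgue (\<lambda>x. \<bar>B x t - B x 0\<bar> * \<phi> x)" by (simp add: integrable_completion[OF mb])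
    have i3: "integrable lebesgue (\<lambda>x. \<bar>f x\<bar>)" using f by simp
    have "(\<integral>x. \<bar>q x t\<bar> * \<phi> x \<partial>lborel) \<le> (\<integral>x. H x \<partial>lebesgue)"
    proof (rule lborel_integral_le_lebesgue[where R=R])
      show "continuous_on UNIV (\<lambda>x. \<bar>q x t\<bar> * \<phi> x)" by (intro continuous_intros cont_u cont_B t \<phi>)
      show "integrable lebesgue H" unfolding H_def using i1 i2 i3 by simp
      show "AE x in lebesgue. \<bar>q x t\<bar> * \<phi> x \<le> H x"
        using u0
      proof eventually_elim
        case (elim x)
        show ?case
        proof (cases "R \<le> norm x \<and> \<phi> x = 0")
          case True
          then show ?thesis using c by (simp add: H_def)
        next
          case False
          then have xK: "x \<in> K" using \<phi>(2)[of x] by (auto simp: K_def)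
          have "\<bar>q x t\<bar> \<le> \<bar>u x t - u0 x\<bar> + \<bar>B x t - B x 0\<bar> + \<bar>f x\<bar>" using elim by linarith
          then have "\<bar>q x t\<bar> * \<phi> x \<le> (\<bar>u x t - u0 x\<bar> + \<bar>B x t - B x 0\<bar> + \<bar>f x\<bar>) * \<phi> x"
            by (intro mult_right_mono \<phi>)
          also have "\<dots> \<le> c * \<bar>u x t - u0 x\<bar> + \<bar>B x t - B x 0\<bar> * \<phi> x + c * \<bar>f x\<bar>"
            using mult_left_mono[OF \<phi>(4)[of x], of "\<bar>u x t - u0 x\<bar>"] mult_left_mono[OF \<phi>(4)[of x], of "\<bar>f x\<bar>"]
            by (simp add: algebra_simps)
          finally show ?thesis using xK by (simp add: H_def)
        qed
      qed
    qed (simp add: \<phi>)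
    also have "\<dots> = h t"
      unfolding H_def h_def b_def set_lebesgue_integral_def using i1 i2 i3 by (simp add: integral_completion[OF mb])
    finally show "(\<integral>x. \<bar>q x t\<bar> * \<phi> x \<partial>lborel) \<le> h t" .
  qed
qed

text \<open>At this \<open>\<alpha>\<close> the weight is still superharmonic, and
  \<open>g_le\<close> makes the cutoff error a \<open>tail_error\<close> of exponent
  \<open>1 + \<alpha>\<close>, which tends to 0 since \<open>N < 2 (\<alpha> + 2) = N + 1\<close>.
  The parameter \<open>l\<close> is kept free so that the weight can be flattened
  afterwards.\<close>

lemma L1_weighted_contraction:
  assumes t2: "0 < t2" "t2 < T" and l: "1 \<le> l"
  defines "\<alpha> \<equiv> (real DIM('a) - 3) / 2"
  shows "integrable lborel (\<lambda>x. \<bar>q x t2\<bar> * (l + (norm x)\<^sup>2) powr (- \<alpha>))"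
    and "(\<integral>x. \<bar>q x t2\<bar> * (l + (norm x)\<^sup>2) powr (- \<alpha>) \<partial>lborel) \<le> l powr (- \<alpha>) * (\<integral>x. \<bar>f x\<bar> \<partial>lebesgue)"
proof -
  have \<alpha>: "0 \<le> \<alpha>" and \<alpha>2: "2 * \<alpha> = real DIM('a) - 3" using n5 by (auto simp: \<alpha>_def)
  have l0: "0 < l" using l by simp
  have cw: "continuous_on UNIV (\<lambda>x::'a. (l + (norm x)\<^sup>2) powr (- \<alpha>))"
    by (intro continuous_intros) (use l0 in \<open>smt (verit) zero_le_power2\<close>)
  \<comment> \<open>\<open>sc\<close> decreases in time, so its value at \<open>t2\<close> serves in
    a lower bound for the denominator of \<open>g_le\<close> that is uniform over all earlier
    times.\<close>
  define C1 where "C1 = (kM - km) / min km (sc (real DIM('a)) T t2)"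
  have At2: "0 < sc (real DIM('a)) T t2" using sc_pos[OF dim3 t2(2)] .
  have C1: "0 \<le> C1" using km At2 by (simp add: C1_def)
  define E where "E = 24 + 6 * real DIM('a) + 24 * \<alpha>"
  have E: "0 \<le> E" using n5 \<alpha> by (simp add: E_def)
  define e where "e m = E * (C1 * tail_error TYPE('a) (1 + \<alpha>) m) * T" for m
  have te: "0 \<le> tail_error TYPE('a) p m" for p m
    unfolding tail_error_def by (intro divide_nonneg_nonneg integral_nonneg) auto
  have e: "e \<longlonglongrightarrow> 0"
  proof -
    have "2 * ((1 + \<alpha>) + 1) = 4 + 2 * \<alpha>" by simp
    then have "2 * ((1 + \<alpha>) + 1) = real DIM('a) + 1" unfolding \<alpha>2 by simp
    then have "real DIM('a) < 2 * ((1 + \<alpha>) + 1)" by simp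
    then have "tail_error TYPE('a) (1 + \<alpha>) \<longlonglongrightarrow> 0" by (rule tail_error_tendsto)
    then have "(\<lambda>m. E * (C1 * tail_error TYPE('a) (1 + \<alpha>) m) * T) \<longlonglongrightarrow> E * (C1 * 0) * T" by (intro tendsto_intros)
    then show ?thesis by (simp add: e_def[abs_def])
  qed
  have main: "(\<integral>x. \<bar>q x t2\<bar> * (l + (norm x)\<^sup>2) powr (- \<alpha>) * cut (real (Suc m)) ((norm x)\<^sup>2) \<partial>lborel)
     \<le> l powr (- \<alpha>) * (\<integral>x. \<bar>f x\<bar> \<partial>lebesgue) + e m" for m
  proof -
    define R where "R = real (Suc m)"
    have R: "0 < R" by (simp add: R_def)
    define \<phi> where "\<phi> x = (l + (norm x)\<^sup>2) powr (- \<alpha>) * cut R ((norm x)\<^sup>2)" for x :: 'a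
    have R2: "R\<^sup>2 \<le> (norm x)\<^sup>2" if "R \<le> norm x" for x :: 'a using that R by (intro power_mono) auto
    obtain h where h: "(h \<longlongrightarrow> l powr (- \<alpha>) * (\<integral>x. \<bar>f x\<bar> \<partial>lebesgue)) (at_right 0)"
      "\<And>t. 0 < t \<Longrightarrow> t < T \<Longrightarrow> (\<integral>x. \<bar>q x t\<bar> * \<phi> x \<partial>lborel) \<le> h t"
    proof (rule initial_bound[of \<phi> R "l powr (- \<alpha>)"])
      show "continuous_on UNIV \<phi>" unfolding \<phi>_def by (intro continuous_intros cw)
      show "\<phi> x = 0" if "R \<le> norm x" for x using R2[OF that] cut_eq_0[OF R] by (simp add: \<phi>_def)
      show "0 \<le> \<phi> x" for x by (simp add: \<phi>_def cut_nonneg)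
      show "\<phi> x \<le> l powr (- \<alpha>)" for x
      proof -
        have "(l + (norm x)\<^sup>2) powr (- \<alpha>) \<le> l powr (- \<alpha>)" using l0 \<alpha> by (intro powr_mono2') auto
        then have "\<phi> x \<le> l powr (- \<alpha>) * 1" unfolding \<phi>_def using cut_le(1)[OF R] cut_nonneg by (intro mult_mono) auto
        then show ?thesis by simp
      qed
    qed (rule that)
    have step: "(\<integral>x. \<bar>q x t2\<bar> * \<phi> x \<partial>lborel) \<le> h t1 + e m" if t1: "0 < t1" "t1 < t2" for t1
    proof -
      have w: "radial_weight \<alpha> {t1..t2} (\<lambda>r t. 1 * (l + 1 * r) powr (- \<alpha>))
         (\<lambda>r t. - \<alpha> * 1 * 1 * (l + 1 * r) powr (- \<alpha> - 1))
         (\<lambda>r t. \<alpha> * (\<alpha> + 1) * 1\<^sup>2 * 1 * (l + 1 * r) powr (- \<alpha> - 2))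
         (\<lambda>r t. 0 * (l + 1 * r) powr (- \<alpha>) - \<alpha> * 0 * r * 1 * (l + 1 * r) powr (- \<alpha> - 1))"
        by (rule radial_weight_power) (use l0 \<alpha> in auto)
      have "(\<integral>x. (\<bar>q x t2\<bar> + 0 * q x t2) * ((1 * (l + 1 * (norm x)\<^sup>2) powr (- \<alpha>)) * cut R ((norm x)\<^sup>2)) \<partial>lborel)
        \<le> (\<integral>x. (\<bar>q x t1\<bar> + 0 * q x t1) * ((1 * (l + 1 * (norm x)\<^sup>2) powr (- \<alpha>)) * cut R ((norm x)\<^sup>2)) \<partial>lborel)
          + (24 + 6 * real DIM('a) + 24 * \<alpha>) * (C1 * tail_error TYPE('a) (1 + \<alpha>) m) * (t2 - t1)"
      proof (rule cutoff_inequality[OF u_sol B_sol t1(1) _ t2(2) w \<alpha> R])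
        fix x :: 'a and t assume t: "t \<in> {t1..t2}"
        define r where "r = (norm x)\<^sup>2"
        have r: "0 \<le> r" by (simp add: r_def)
        have "2 * (\<alpha> + 1) * (1 * r) - real DIM('a) * (l + 1 * r) = - r - real DIM('a) * l" by (simp add: \<alpha>_def field_simps)
        moreover have "- r - real DIM('a) * l \<le> 0" using r mult_nonneg_nonneg[of "real DIM('a)" l] n5 l0 by linarith
        ultimately have "2 * (\<alpha> + 1) * (1 * r) - real DIM('a) * (l + 1 * r) \<le> 0" by linarith
        then have "2 * \<alpha> * 1 * 1 * (l + 1 * r) powr (- \<alpha> - 2) * (2 * (\<alpha> + 1) * (1 * r) - real DIM('a) * (l + 1 * r)) \<le> 0"
          using \<alpha> by (intro mult_nonneg_nonpos) auto
        then have "4 * r * (\<alpha> * (\<alpha> + 1) * 1\<^sup>2 * 1 * (l + 1 * r) powr (- \<alpha> - 2)) + 2 * real DIM('a) * (- \<alpha> * 1 * 1 * (l + 1 * r) powr (- \<alpha> - 1)) \<le> 0"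
          using power_weight_laplacian[of l 1 r \<alpha> 1 "real DIM('a)"] r l0 by simp
        then show "(\<bar>g x t\<bar> + 0 * g x t) * (4 * (norm x)\<^sup>2 * (\<alpha> * (\<alpha> + 1) * 1\<^sup>2 * 1 * (l + 1 * (norm x)\<^sup>2) powr (- \<alpha> - 2))
           + 2 * real DIM('a) * (- \<alpha> * 1 * 1 * (l + 1 * (norm x)\<^sup>2) powr (- \<alpha> - 1)))
           + (\<bar>q x t\<bar> + 0 * q x t) * (0 * (l + 1 * (norm x)\<^sup>2) powr (- \<alpha>) - \<alpha> * 0 * (norm x)\<^sup>2 * 1 * (l + 1 * (norm x)\<^sup>2) powr (- \<alpha> - 1)) \<le> 0"
          unfolding r_def by (simp add: mult_nonneg_nonpos)
      next
        fix t assume t: "t \<in> {t1..t2}"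
        then have t': "0 < t" "t < T" "t \<le> t2" using t1 t2 by auto
        show "(\<integral>x. indicator (cball 0 R) x * ((\<bar>g x t\<bar> + 0 * g x t) * (1 * (l + 1 * (norm x)\<^sup>2) powr (- \<alpha>))) \<partial>lborel) / R\<^sup>2
          \<le> C1 * tail_error TYPE('a) (1 + \<alpha>) m"
          unfolding R_def
        proof (rule tail_error_bound)
          show "continuous_on UNIV (\<lambda>x. (\<bar>g x t\<bar> + 0 * g x t) * (1 * (l + 1 * (norm x)\<^sup>2) powr (- \<alpha>)))"
            using continuous_on_mult[OF continuous_on_rabs[OF cont_g[OF t'(1,2)]] cw] by simp
          fix x :: 'a
          define r where "r = (norm x)\<^sup>2"
          have r: "0 \<le> r" by (simp add: r_def)
          have AA: "sc (real DIM('a)) T t2 \<le> sc (real DIM('a)) T t" by (rule sc_antimono[OF dim3 t'(3) t2(2)])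
          have "min km (sc (real DIM('a)) T t2) * (1 + r) \<le> km + sc (real DIM('a)) T t * r"
          proof -
            have "min km (sc (real DIM('a)) T t2) * r \<le> sc (real DIM('a)) T t * r" using AA r by (intro mult_right_mono) auto
            moreover have "min km (sc (real DIM('a)) T t2) \<le> km" by (rule min.cobounded1)
            ultimately show ?thesis by (simp only: distrib_left mult_1_right add_mono)
          qed
          then have "(kM - km) / (km + sc (real DIM('a)) T t * r) \<le> (kM - km) / (min km (sc (real DIM('a)) T t2) * (1 + r))"
            using km At2 r by (intro divide_left_mono mult_pos_pos add_pos_nonneg mult_nonneg_nonneg) (use AA in auto)
          then have "\<bar>g x t\<bar> \<le> C1 / (1 + r)" using g_le[OF t'(1,2), of x] by (simp add: r_def C1_def)
          moreover have "(l + r) powr (- \<alpha>) \<le> (1 + r) powr (- \<alpha>)" using l r \<alpha> by (intro powr_mono2') auto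
          ultimately have "\<bar>g x t\<bar> * (l + r) powr (- \<alpha>) \<le> C1 / (1 + r) * (1 + r) powr (- \<alpha>)"
            using C1 r by (intro mult_mono) auto
          also have "\<dots> = C1 * (1 + r) powr (- (1 + \<alpha>))"
          proof -
            have "- (1 + \<alpha>) = - \<alpha> - 1" by simp
            then show ?thesis using powr_diff[of "1 + r" "- \<alpha>" 1] r by (simp only:) simp
          qed
          finally show "(\<bar>g x t\<bar> + 0 * g x t) * (1 * (l + 1 * (norm x)\<^sup>2) powr (- \<alpha>)) \<le> C1 * (1 + (norm x)\<^sup>2) powr (- (1 + \<alpha>))"
            by (simp add: r_def)
        qed
      qed (use t1 in auto)
      then have "(\<integral>x. \<bar>q x t2\<bar> * \<phi> x \<partial>lborel) \<le> (\<integral>x. \<bar>q x t1\<bar> * \<phi> x \<partial>lborel)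
          + E * (C1 * tail_error TYPE('a) (1 + \<alpha>) m) * (t2 - t1)"
        by (simp add: \<phi>_def E_def)
      also have "E * (C1 * tail_error TYPE('a) (1 + \<alpha>) m) * (t2 - t1) \<le> e m"
        unfolding e_def using t1 t2 by (intro mult_left_mono mult_nonneg_nonneg E C1 te) auto
      also have "(\<integral>x. \<bar>q x t1\<bar> * \<phi> x \<partial>lborel) \<le> h t1" using h(2) t1 t2 by simp
      finally show ?thesis by simp
    qed
    \<comment> \<open>The starting time \<open>t1\<close> tends to 0; the cutoff error
      \<open>e m\<close> does not depend on it.\<close>
    have "(\<integral>x. \<bar>q x t2\<bar> * \<phi> x \<partial>lborel) \<le> l powr (- \<alpha>) * (\<integral>x. \<bar>f x\<bar> \<partial>lebesgue) + e m"
    proof (rule tendsto_lowerbound)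
      show "((\<lambda>t. h t + e m) \<longlongrightarrow> l powr (- \<alpha>) * (\<integral>x. \<bar>f x\<bar> \<partial>lebesgue) + e m) (at_right 0)"
        by (intro tendsto_intros h)
      show "\<forall>\<^sub>F t in at_right 0. (\<integral>x. \<bar>q x t2\<bar> * \<phi> x \<partial>lborel) \<le> h t + e m"
        using eventually_at_right_less[of 0] eventually_at_right_real[OF t2(1)] by (auto elim!: eventually_mono intro: step)
    qed simp
    then show ?thesis by (simp add: \<phi>_def R_def mult.assoc)
  qed
  have cF: "continuous_on UNIV (\<lambda>x. \<bar>q x t2\<bar> * (l + (norm x)\<^sup>2) powr (- \<alpha>))"
    by (intro continuous_intros cw cont_u cont_B t2)
  show "integrable lborel (\<lambda>x. \<bar>q x t2\<bar> * (l + (norm x)\<^sup>2) powr (- \<alpha>))"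
    by (rule integral_le_of_cutoff(1)[OF cF _ main e]) simp
  show "(\<integral>x. \<bar>q x t2\<bar> * (l + (norm x)\<^sup>2) powr (- \<alpha>) \<partial>lborel) \<le> l powr (- \<alpha>) * (\<integral>x. \<bar>f x\<bar> \<partial>lebesgue)"
    by (rule integral_le_of_cutoff(2)[OF cF _ main e]) simp
qed

text \<open>On a fixed ball \<open>l^\<alpha> (l + |x|^2)^(-\<alpha>)\<close> tends to 1 as
  \<open>l\<close> grows, while the bound in the weighted estimate, multiplied by
  \<open>l^\<alpha>\<close>, is the norm of \<open>f\<close>. The cutoff is removed last.\<close>

lemma L1_contraction:
  assumes t: "0 < t" "t < T"
  shows "integrable lborel (\<lambda>x. \<bar>q x t\<bar>)" "(\<integral>x. \<bar>q x t\<bar> \<partial>lborel) \<le> (\<integral>x. \<bar>f x\<bar> \<partial>lebesgue)"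
proof -
  define \<alpha> where "\<alpha> = (real DIM('a) - 3) / 2"
  have \<alpha>: "0 \<le> \<alpha>" using n5 by (simp add: \<alpha>_def)
  define F where "F = (\<integral>x. \<bar>f x\<bar> \<partial>lebesgue)"
  have c: "continuous_on UNIV (\<lambda>x. \<bar>q x t\<bar>)" by (intro continuous_intros cont_u cont_B t)
  have le: "(\<integral>x. \<bar>q x t\<bar> * cut (real (Suc m)) ((norm x)\<^sup>2) \<partial>lborel) \<le> F + 0" for m
  proof -
    define R where "R = real (Suc m)"
    have R: "0 < R" by (simp add: R_def)
    define I where "I = (\<integral>x. \<bar>q x t\<bar> * cut R ((norm x)\<^sup>2) \<partial>lborel)"
    have R2: "R\<^sup>2 \<le> (norm x)\<^sup>2" if "R \<le> norm x" for x :: 'a using that R by (intro power_mono) auto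
    have i: "integrable lborel (\<lambda>x. \<bar>q x t\<bar> * cut R ((norm x)\<^sup>2))"
      by (rule integrable_compact_support[where R=R]) (use R2 cut_eq_0[OF R] in \<open>auto intro!: continuous_intros c cont_u cont_B t\<close>)
    have "I \<le> (1 + R\<^sup>2 * inverse (real (Suc j))) powr \<alpha> * F" for j
    proof -
      define l where "l = real (Suc j)"
      have l: "1 \<le> l" by (simp add: l_def)
      have "I \<le> (\<integral>x. (l + R\<^sup>2) powr \<alpha> * (\<bar>q x t\<bar> * (l + (norm x)\<^sup>2) powr (- \<alpha>)) \<partial>lborel)"
        unfolding I_def
      proof (intro integral_mono i integrable_mult_right)
        show "integrable lborel (\<lambda>x. \<bar>q x t\<bar> * (l + (norm x)\<^sup>2) powr (- \<alpha>))"
          unfolding \<alpha>_def by (rule L1_weighted_contraction[OF t l])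
        fix x :: 'a
        have "cut R ((norm x)\<^sup>2) \<le> (l + R\<^sup>2) powr \<alpha> * (l + (norm x)\<^sup>2) powr (- \<alpha>)"
        proof (cases "R \<le> norm x")
          case True
          then show ?thesis using cut_eq_0(1)[OF R R2] by simp
        next
          case False
          then have "(norm x)\<^sup>2 \<le> R\<^sup>2" by (intro power_mono) auto
          then have "(l + R\<^sup>2) powr (- \<alpha>) \<le> (l + (norm x)\<^sup>2) powr (- \<alpha>)" using \<alpha> l by (intro powr_mono2') (auto simp: add_pos_nonneg)
          then have "(l + R\<^sup>2) powr \<alpha> * (l + R\<^sup>2) powr (- \<alpha>) \<le> (l + R\<^sup>2) powr \<alpha> * (l + (norm x)\<^sup>2) powr (- \<alpha>)"
            by (intro mult_left_mono) auto
          moreover have "(l + R\<^sup>2) powr \<alpha> * (l + R\<^sup>2) powr (- \<alpha>) = 1" using add_pos_nonneg[of l "R\<^sup>2"] l by (simp flip: powr_add)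
          ultimately show ?thesis using cut_le(1)[OF R, of "(norm x)\<^sup>2"] by simp
        qed
        then have "\<bar>q x t\<bar> * cut R ((norm x)\<^sup>2) \<le> \<bar>q x t\<bar> * ((l + R\<^sup>2) powr \<alpha> * (l + (norm x)\<^sup>2) powr (- \<alpha>))"
          by (intro mult_left_mono) auto
        then show "\<bar>q x t\<bar> * cut R ((norm x)\<^sup>2) \<le> (l + R\<^sup>2) powr \<alpha> * (\<bar>q x t\<bar> * (l + (norm x)\<^sup>2) powr (- \<alpha>))"
          by (simp add: mult_ac)
      qed
      also have "\<dots> = (l + R\<^sup>2) powr \<alpha> * (\<integral>x. \<bar>q x t\<bar> * (l + (norm x)\<^sup>2) powr (- \<alpha>) \<partial>lborel)" by simp
      also have "\<dots> \<le> (l + R\<^sup>2) powr \<alpha> * (l powr (- \<alpha>) * F)"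
        using L1_weighted_contraction(2)[OF t l] unfolding F_def \<alpha>_def by (intro mult_left_mono) auto
      also have "\<dots> = (1 + R\<^sup>2 * inverse (real (Suc j))) powr \<alpha> * F"
      proof -
        have "1 + R\<^sup>2 * inverse (real (Suc j)) = (l + R\<^sup>2) / l" using l by (simp add: l_def field_simps)
        moreover have "((l + R\<^sup>2) / l) powr \<alpha> = (l + R\<^sup>2) powr \<alpha> * l powr (- \<alpha>)"
          by (subst powr_divide) (use l in \<open>auto simp: powr_minus divide_inverse\<close>)
        ultimately show ?thesis by simp
      qed
      finally show ?thesis .
    qed
    moreover have "(\<lambda>j. (1 + R\<^sup>2 * inverse (real (Suc j))) powr \<alpha> * F) \<longlonglongrightarrow> (1 + R\<^sup>2 * 0) powr \<alpha> * F"
      by (intro tendsto_intros LIMSEQ_inverse_real_of_nat) simp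
    ultimately have "I \<le> F" using LIMSEQ_le_const by fastforce
    then show ?thesis by (simp add: I_def R_def)
  qed
  show "integrable lborel (\<lambda>x. \<bar>q x t\<bar>)" by (rule integral_le_of_cutoff(1)[OF c _ le]) auto
  show "(\<integral>x. \<bar>q x t\<bar> \<partial>lborel) \<le> (\<integral>x. \<bar>f x\<bar> \<partial>lebesgue)"
    using integral_le_of_cutoff(2)[OF c _ le] by (simp add: F_def)
qed

end

section \<open>Exponential decay of a weighted norm\<close>

text \<open>A common upper bound for \<open>u\<close> and \<open>B\<close> bounds |g| from below by
  |q|, which converts the negative term with |g| in the decay estimate into one with |q|. The
  companion with a common lower bound goes the other way.\<close>

lemma abs_ln_diff_ge:
  fixes x y m :: real
  assumes "0 < x" "0 < y" "x \<le> m" "y \<le> m"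
  shows "\<bar>x - y\<bar> / m \<le> \<bar>ln x - ln y\<bar>"
proof -
  have *: "(b - a) / m \<le> ln b - ln a" if "0 < a" "a \<le> b" "b \<le> m" for a b :: real
  proof -
    have "ln a - ln b = ln (a / b)" using that by (simp add: ln_divide_pos)
    also have "\<dots> \<le> a / b - 1" using that by (intro ln_le_minus_one) auto
    finally have "(b - a) / b \<le> ln b - ln a" using that by (simp add: field_simps)
    moreover have "(b - a) / m \<le> (b - a) / b" using that by (intro divide_left_mono mult_pos_pos) auto
    ultimately show ?thesis by linarith
  qed
  show ?thesis using *[of x y] *[of y x] assms by (cases "x \<le> y") auto
qed

lemma abs_ln_diff_le:
  fixes x y m :: real
  assumes "0 < m" "m \<le> x" "m \<le> y"
  shows "\<bar>ln x - ln y\<bar> \<le> \<bar>x - y\<bar> / m"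
proof -
  have *: "ln b - ln a \<le> (b - a) / m" if "m \<le> a" "a \<le> b" for a b :: real
  proof -
    have "ln b - ln a = ln (b / a)" using that assms by (simp add: ln_divide_pos)
    also have "\<dots> \<le> b / a - 1" using that assms by (intro ln_le_minus_one) auto
    also have "\<dots> = (b - a) / a" using that assms by (simp add: field_simps)
    also have "\<dots> \<le> (b - a) / m" using that assms by (intro divide_left_mono mult_pos_pos) auto
    finally show ?thesis .
  qed
  show ?thesis using *[of x y] *[of y x] assms ln_mono[of x y] ln_mono[of y x] by (cases "x \<le> y") auto
qed

context pinched_solution
begin

lemma cont_weight:
  assumes "0 < k" "0 \<le> s"
  shows "continuous_on UNIV (\<lambda>x::'a. (k + s * (norm x)\<^sup>2) powr p)"
proof (intro continuous_intros)
  show "\<forall>x::'a\<in>UNIV. k + s * (norm x)\<^sup>2 \<noteq> 0"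
    using assms by (metis add_pos_nonneg less_irrefl mult_nonneg_nonneg zero_le_power2)
qed

lemma square_tail_tendsto: "(\<lambda>m. ((real (Suc m))\<^sup>2) powr (- (1/4))) \<longlonglongrightarrow> 0"
proof (rule tendsto_neg_powr)
  have "filterlim (\<lambda>m. real (Suc m)) at_top sequentially"
    using filterlim_real_sequentially filterlim_sequentially_Suc by blast
  then show "filterlim (\<lambda>m. (real (Suc m))\<^sup>2) at_top sequentially"
    by (intro filterlim_pow_at_top) auto
qed simp

text \<open>The exponent \<open>-1/4\<close> lies in \<open>(-(N-4)/2, 0)\<close>, the range of exponents for which the
  weighted norm decays exponentially in \<open>s = - ln (T - t)\<close>.\<close>
lemma weighted_decay:
  defines "c \<equiv> 1 / (8 * (real DIM('a) - 2))"
  obtains C where "0 \<le> C"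
    "\<And>t. T / 2 \<le> t \<Longrightarrow> t < T \<Longrightarrow> integrable lborel (\<lambda>x. \<bar>q x t\<bar> * (km + sc (real DIM('a)) T t * (norm x)\<^sup>2) powr (- (1/4)))"
    "\<And>t. T / 2 \<le> t \<Longrightarrow> t < T \<Longrightarrow>
       (\<integral>x. \<bar>q x t\<bar> * (km + sc (real DIM('a)) T t * (norm x)\<^sup>2) powr (- (1/4)) \<partial>lborel) \<le> C * (T - t) powr c"
proof -
  define n where "n = real DIM('a)"
  have n: "5 \<le> n" using n5 by (simp add: n_def)
  define F where "F = (\<integral>x. \<bar>f x\<bar> \<partial>lebesgue)"
  have F: "0 \<le> F" by (simp add: F_def)
  define e where "e = 2 / (n - 2)"
  define A where "A t = (T - t) powr e" for t
  have Asc: "sc (real DIM('a)) T t = A t" for t by (simp add: A_def sc_def e_def n_def)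
  \<comment> \<open>The decay rate is built into the weight: if the integral with this growing
    factor stays bounded, the integral without it decays like \<open>(T - t) powr c\<close>.\<close>
  define \<beta> where "\<beta> t = (T - t) powr (- c)" for t
  have c0: "0 < c" using n by (simp add: c_def n_def[symmetric])
  \<comment> \<open>The value of the bound at the starting time \<open>T / 2\<close>, where the
    power weight is at most \<open>km powr (- (1/4))\<close> and the unweighted norm at most
    \<open>F\<close>.\<close>
  define C where "C = \<beta> (T / 2) * km powr (- (1/4)) * F"
  have C: "0 \<le> C" by (simp add: C_def \<beta>_def F)
  have main: "integrable lborel (\<lambda>x. \<bar>q x t2\<bar> * (\<beta> t2 * (km + A t2 * (norm x)\<^sup>2) powr (- (1/4))))
     \<and> (\<integral>x. \<bar>q x t2\<bar> * (\<beta> t2 * (km + A t2 * (norm x)\<^sup>2) powr (- (1/4))) \<partial>lborel) \<le> C"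
    if t2: "T / 2 \<le> t2" "t2 < T" for t2
  proof -
    have Apos: "0 < A t" if "t < T" for t using that by (simp add: A_def)
    define A1 where "A1 = A (T / 2)"
    \<comment> \<open>The common lower bound with \<open>kM\<close> makes |g| times the weight at
      most \<open>K2 * D powr (3/4) * |q|\<close>, where \<open>D\<close> is the base of the power
      weight; the constants are taken at \<open>t2\<close>, the worst time of the window.\<close>
    define K2 where "K2 = \<beta> t2 * (kM / km) / (2 * (n - 2) * ((T - t2) * A t2))"
    have K2: "0 \<le> K2" using n t2 km Apos[OF t2(2)] by (simp add: K2_def \<beta>_def)
    define E where "E = 24 + 6 * n + 24 * (1/4::real)"
    have E: "0 \<le> E" using n by (simp add: E_def)
    \<comment> \<open>On the ball the base is at most \<open>(km + A1) * R^2\<close>, so the power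
      3/4 contributes \<open>R^(3/2)\<close>. Against \<open>R^-2\<close> this leaves
      \<open>R^(-1/2)\<close>, the power -1/4 of \<open>R^2\<close>; the remaining integral of |q|
      is bounded by the unweighted contraction.\<close>
    define er where "er m = K2 * (km + A1) powr (3/4) * F * ((real (Suc m))\<^sup>2) powr (- (1/4))" for m
    have A1: "0 < A1" using T by (simp add: A1_def Apos)
    have w: "radial_weight (1/4) {T/2..t2} (\<lambda>r t. \<beta> t * (km + A t * r) powr (- (1/4)))
       (\<lambda>r t. - (1/4) * A t * \<beta> t * (km + A t * r) powr (- (1/4) - 1))
       (\<lambda>r t. (1/4) * (1/4 + 1) * (A t)\<^sup>2 * \<beta> t * (km + A t * r) powr (- (1/4) - 2))
       (\<lambda>r t. c * (T - t) powr (- c - 1) * (km + A t * r) powr (- (1/4))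
          - (1/4) * (- e * (T - t) powr (e - 1)) * r * \<beta> t * (km + A t * r) powr (- (1/4) - 1))"
    proof (rule radial_weight_power)
      fix t assume "t \<in> {T/2..t2}"
      then have t: "0 < T - t" using t2 by simp
      show "0 < A t" "0 \<le> \<beta> t" using t by (auto simp: A_def \<beta>_def)
      have dT: "((\<lambda>t. T - t) has_real_derivative - 1) (at t within {T/2..t2})" by (auto intro!: derivative_eq_intros)
      have "((\<lambda>x. x powr s) has_real_derivative s * (T - t) powr (s - 1)) (at (T - t))" for s
        using has_real_derivative_powr[OF t] .
      from DERIV_chain2[OF this dT] have dp: "((\<lambda>t. (T - t) powr s) has_real_derivative - s * (T - t) powr (s - 1)) (at t within {T/2..t2})" for s
        by simp
      show "(A has_real_derivative - e * (T - t) powr (e - 1)) (at t within {T/2..t2})"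
        unfolding A_def[abs_def] by (rule dp)
      show "(\<beta> has_real_derivative c * (T - t) powr (- c - 1)) (at t within {T/2..t2})"
        unfolding \<beta>_def[abs_def] using dp[of "- c"] by simp
    next
      show "continuous_on {T/2..t2} (\<lambda>t. - e * (T - t) powr (e - 1))" "continuous_on {T/2..t2} (\<lambda>t. c * (T - t) powr (- c - 1))"
        using t2 by (auto intro!: continuous_intros)
    qed (use km in auto)
    have T2: "0 < T / 2" using T by simp
    have step: "(\<integral>x. \<bar>q x t2\<bar> * (\<beta> t2 * (km + A t2 * (norm x)\<^sup>2) powr (- (1/4))) * cut (real (Suc m)) ((norm x)\<^sup>2) \<partial>lborel) \<le> C + E * er m * (t2 - T / 2)" for m
    proof -
      define R where "R = real (Suc m)"
      have R: "0 < R" "1 \<le> R" by (auto simp: R_def)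
      have "(\<integral>x. (\<bar>q x t2\<bar> + 0 * q x t2) * ((\<beta> t2 * (km + A t2 * (norm x)\<^sup>2) powr (- (1/4))) * cut R ((norm x)\<^sup>2)) \<partial>lborel)
        \<le> (\<integral>x. (\<bar>q x (T/2)\<bar> + 0 * q x (T/2)) * ((\<beta> (T/2) * (km + A (T/2) * (norm x)\<^sup>2) powr (- (1/4))) * cut R ((norm x)\<^sup>2)) \<partial>lborel)
          + (24 + 6 * real DIM('a) + 24 * (1/4)) * er m * (t2 - T/2)"
      proof (rule cutoff_inequality[OF u_sol B_sol T2 t2 w _ R(1)])
        fix x :: 'a and t assume t: "t \<in> {T/2..t2}"
        then have t': "0 < t" "t < T" using t2 T by auto
        define \<tau> where "\<tau> = T - t"
        define r where "r = (norm x)\<^sup>2"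
        define a where "a = A t"
        define D where "D = km + a * r"
        define b where "b = \<beta> t"
        have \<tau>: "0 < \<tau>" using t' by (simp add: \<tau>_def)
        have r: "0 \<le> r" by (simp add: r_def)
        have a: "0 < a" using Apos t' by (simp add: a_def)
        have D: "0 < D" using km a r by (simp add: D_def add_pos_nonneg)
        have b: "0 < b" using \<tau> by (simp add: b_def \<beta>_def \<tau>_def)
        define S where "S = 2 * (1/4 + 1) * (a * r) - n * D"
        define P where "P = D powr (- (1/4) - 1)"
        have P: "0 < P" using D by (simp add: P_def)
        have ar: "0 \<le> a * r" using a r by simp
        have nD: "n * D = n * km + n * (a * r)" by (simp add: D_def distrib_left)
        have nar: "5 * (a * r) \<le> n * (a * r)" using n ar by (intro mult_right_mono) auto
        have nkm: "5 * km \<le> n * km" using n km by (intro mult_right_mono) auto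
        have S': "S = 5 / 2 * (a * r) - (n * km + n * (a * r))" unfolding S_def nD by simp
        have S: "S \<le> 0" unfolding S' using nar nkm ar km by linarith
        have Bkm: "barenblatt T km x t = 2 * (n - 2) * (\<tau> * a) / D"
          using barenblatt_sc[OF dim3 t'(2), of km x] by (simp add: Asc n_def \<tau>_def a_def D_def r_def)
        \<comment> \<open>The Laplacian of the weight is nonpositive, so a lower bound for |g| is
          required here; it comes from the common upper bound with \<open>km\<close>.\<close>
        have "\<bar>q x t\<bar> / barenblatt T km x t \<le> \<bar>g x t\<bar>"
          using bounds[OF t', of x] pos(1)[OF t', of x] pos(2)[OF t'(2), of x] by (intro abs_ln_diff_ge)
        then have G: "\<bar>q x t\<bar> * D / (2 * (n - 2) * (\<tau> * a)) \<le> \<bar>g x t\<bar>" by (simp add: Bkm)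
        have D1: "D powr (- (1/4) - 2) * D = P"
          using powr_add[of D "- (1/4) - 2" 1] D by (simp add: P_def)
        have D2: "D powr (- (1/4)) = P * D"
          using powr_add[of D "- (1/4) - 1" 1] D by (simp add: P_def)
        define LW where "LW = 2 * (1/4) * a * b * D powr (- (1/4) - 2) * S"
        have LW: "LW \<le> 0" unfolding LW_def using a b S by (intro mult_nonneg_nonpos) auto
        have "\<bar>g x t\<bar> * LW \<le> \<bar>q x t\<bar> * D / (2 * (n - 2) * (\<tau> * a)) * LW"
          by (rule mult_right_mono_neg[OF G LW])
        also have "\<dots> = \<bar>q x t\<bar> * b * P / (\<tau> * (n - 2)) * (S / 4)"
        proof -
          have "\<bar>q x t\<bar> * D / (2 * (n - 2) * (\<tau> * a)) * LW = \<bar>q x t\<bar> * b * (D powr (- (1/4) - 2) * D) / (\<tau> * (n - 2)) * (S / 4) * (a / a)"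
            unfolding LW_def using n by (simp add: divide_simps)
          then show ?thesis using a unfolding D1 by simp
        qed
        finally have 1: "\<bar>g x t\<bar> * LW \<le> \<bar>q x t\<bar> * b * P / (\<tau> * (n - 2)) * (S / 4)" .
        have b': "(T - t) powr (- c - 1) = b / \<tau>" using \<tau> by (simp add: b_def \<beta>_def \<tau>_def powr_diff)
        have a': "(T - t) powr (e - 1) = a / \<tau>" using \<tau> by (simp add: a_def A_def \<tau>_def powr_diff)
        have 2: "c * (T - t) powr (- c - 1) * D powr (- (1/4)) - (1/4) * (- e * (T - t) powr (e - 1)) * r * b * P
           = b * P / (\<tau> * (n - 2)) * (D / 8 + a * r / 2)"
        proof -
          have "c * (b / \<tau>) * (P * D) - (1/4) * (- e * (a / \<tau>)) * r * b * P = b * P / \<tau> * (c * D + e / 4 * (a * r))"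
            using \<tau> by (simp add: field_simps)
          also have "c * D + e / 4 * (a * r) = (D / 8 + a * r / 2) / (n - 2)"
            using n by (simp add: c_def e_def n_def[symmetric] divide_simps) (simp add: algebra_simps)
          finally show ?thesis unfolding a' b' D2 by simp
        qed
        \<comment> \<open>After collecting terms the coefficient of \<open>a * r\<close> is at most
          \<open>(5 - n) / 4\<close> and that of \<open>km\<close> at most
          \<open>(1 - 2 n) / 8\<close>. In dimension 5 the first one vanishes, so 1/8 in
          \<open>c\<close> is the largest factor this computation allows there.\<close>
        have "S / 4 + (D / 8 + a * r / 2) \<le> 0"
        proof -
          have *: "(5 / 2 * Y - (Z + X)) / 4 + ((K + Y) / 8 + Y / 2) \<le> 0"
            if "5 * Y \<le> X" "5 * K \<le> Z" "0 \<le> Y" "0 < K" for X Y Z K :: real using that by (simp add: field_simps)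
          show ?thesis unfolding S' D_def by (rule *[OF nar nkm ar km(1)])
        qed
        then have "\<bar>q x t\<bar> * b * P / (\<tau> * (n - 2)) * (S / 4 + (D / 8 + a * r / 2)) \<le> 0"
          using b P \<tau> n by (intro mult_nonneg_nonpos) auto
        then have "\<bar>g x t\<bar> * LW + \<bar>q x t\<bar> * (b * P / (\<tau> * (n - 2)) * (D / 8 + a * r / 2)) \<le> 0"
          using 1 by (simp add: distrib_left)
        moreover have "LW = 4 * r * (1/4 * (1/4 + 1) * a\<^sup>2 * b * D powr (- (1/4) - 2)) + 2 * n * (- (1/4) * a * b * D powr (- (1/4) - 1))"
          using power_weight_laplacian[of km a r "1/4" b n] D unfolding D_def LW_def S_def by simp
        ultimately have "\<bar>g x t\<bar> * (4 * r * (1/4 * (1/4 + 1) * a\<^sup>2 * b * D powr (- (1/4) - 2)) + 2 * n * (- (1/4) * a * b * D powr (- (1/4) - 1)))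
           + \<bar>q x t\<bar> * (c * (T - t) powr (- c - 1) * D powr (- (1/4)) - (1/4) * (- e * (T - t) powr (e - 1)) * r * b * P) \<le> 0"
          unfolding 2 by simp
        then show "(\<bar>g x t\<bar> + 0 * g x t) * (4 * (norm x)\<^sup>2 * (1/4 * (1/4 + 1) * (A t)\<^sup>2 * \<beta> t * (km + A t * (norm x)\<^sup>2) powr (- (1/4) - 2))
             + 2 * real DIM('a) * (- (1/4) * A t * \<beta> t * (km + A t * (norm x)\<^sup>2) powr (- (1/4) - 1)))
           + (\<bar>q x t\<bar> + 0 * q x t) * (c * (T - t) powr (- c - 1) * (km + A t * (norm x)\<^sup>2) powr (- (1/4))
             - (1/4) * (- e * (T - t) powr (e - 1)) * (norm x)\<^sup>2 * \<beta> t * (km + A t * (norm x)\<^sup>2) powr (- (1/4) - 1)) \<le> 0"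
          unfolding P_def D_def a_def b_def r_def n_def mult_zero_left add_0_right .
      next
        fix t assume t: "t \<in> {T/2..t2}"
        then have t': "0 < t" "t < T" "t \<le> t2" "T / 2 \<le> t" using t2 T by auto
        define a where "a = A t"
        have a: "0 < a" using Apos t' by (simp add: a_def)
        have aA: "A t2 \<le> a" "a \<le> A1"
          using sc_antimono[OF dim3 t'(3) t2(2)] sc_antimono[OF dim3 t'(4) t'(2)] by (auto simp: a_def A1_def Asc)
        have \<beta>\<beta>: "\<beta> t \<le> \<beta> t2" unfolding \<beta>_def using t' t2 c0 by (intro powr_mono2') auto
        have pt: "\<bar>g x t\<bar> * (\<beta> t * (km + a * (norm x)\<^sup>2) powr (- (1/4))) \<le> K2 * ((km + A1) * R\<^sup>2) powr (3/4) * \<bar>q x t\<bar>"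
          if x: "norm x \<le> R" for x
        proof -
          define r where "r = (norm x)\<^sup>2"
          have r: "0 \<le> r" "r \<le> R\<^sup>2" using x by (auto simp: r_def intro: power_mono)
          define D where "D = km + a * r"
          have D: "0 < D" using km a r by (simp add: D_def add_pos_nonneg)
          define M where "M = 2 * (n - 2) * ((T - t) * a)"
          define M2 where "M2 = 2 * (n - 2) * ((T - t2) * A t2)"
          have M2: "0 < M2" using n t2 Apos by (simp add: M2_def)
          have MM: "M2 \<le> M" unfolding M_def M2_def using n t' t2 aA Apos[OF t2(2)] by (intro mult_left_mono mult_mono) auto
          have BkM: "barenblatt T kM x t = M / (kM + a * r)"
            using barenblatt_sc[OF dim3 t'(2), of kM x] by (simp add: Asc M_def n_def a_def r_def)
          have "\<bar>g x t\<bar> \<le> \<bar>q x t\<bar> / barenblatt T kM x t"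
            using bounds[OF t'(1,2), of x] barenblatt_pos[OF dim3 km(3) t'(2)] by (intro abs_ln_diff_le) auto
          also have "\<dots> = \<bar>q x t\<bar> * ((kM + a * r) / M)" by (simp add: BkM)
          also have "\<dots> \<le> \<bar>q x t\<bar> * ((kM / km * D) / M2)"
          proof (intro mult_left_mono frac_le)
            have "km * (a * r) \<le> kM * (a * r)" using km a r by (intro mult_right_mono) auto
            then show "kM + a * r \<le> kM / km * D" using km(1) by (simp add: D_def field_simps)
          qed (use M2 MM D km in auto)
          finally have g: "\<bar>g x t\<bar> \<le> \<bar>q x t\<bar> * ((kM / km * D) / M2)" .
          have "\<bar>g x t\<bar> * (\<beta> t * D powr (- (1/4))) \<le> \<bar>q x t\<bar> * ((kM / km * D) / M2) * (\<beta> t2 * D powr (- (1/4)))"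
            using g \<beta>\<beta> D M2 km by (intro mult_mono) (auto simp: \<beta>_def)
          also have "\<dots> = K2 * (D * D powr (- (1/4))) * \<bar>q x t\<bar>" unfolding K2_def M2_def[symmetric] by (simp add: mult_ac)
          also have "D * D powr (- (1/4)) = D powr (3/4)" using powr_add[of D 1 "- (1/4)"] D by simp
          also have "K2 * D powr (3/4) * \<bar>q x t\<bar> \<le> K2 * ((km + A1) * R\<^sup>2) powr (3/4) * \<bar>q x t\<bar>"
          proof (intro mult_right_mono mult_left_mono powr_mono2 K2)
            have "a * r \<le> A1 * R\<^sup>2" using aA r a by (intro mult_mono) auto
            moreover have "km * 1 \<le> km * R\<^sup>2" using km R by (intro mult_left_mono one_le_power) auto
            ultimately show "D \<le> (km + A1) * R\<^sup>2" unfolding D_def by (simp only: distrib_right)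
          qed (use D in auto)
          finally show ?thesis by (simp add: D_def r_def)
        qed
        have cG: "continuous_on UNIV (\<lambda>x. (\<bar>g x t\<bar> + 0 * g x t) * (\<beta> t * (km + A t * (norm x)\<^sup>2) powr (- (1/4))))"
          using continuous_on_mult[OF continuous_on_rabs[OF cont_g[OF t'(1,2)]] continuous_on_mult[OF continuous_on_const[of _ "\<beta> t"] cont_weight[OF km(1) less_imp_le[OF a], of "- (1/4)"]]]
          by (simp add: a_def)
        have "(\<integral>x. indicator (cball 0 R) x * ((\<bar>g x t\<bar> + 0 * g x t) * (\<beta> t * (km + A t * (norm x)\<^sup>2) powr (- (1/4)))) \<partial>lborel)
          \<le> (\<integral>x. K2 * ((km + A1) * R\<^sup>2) powr (3/4) * \<bar>q x t\<bar> \<partial>lborel)"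
        proof (rule integral_mono)
          show "integrable lborel (\<lambda>x. indicator (cball 0 R) x * ((\<bar>g x t\<bar> + 0 * g x t) * (\<beta> t * (km + A t * (norm x)\<^sup>2) powr (- (1/4)))))"
            using borel_integrable_compact[OF compact_cball[of 0 R] continuous_on_subset[OF cG subset_UNIV]] by simp
          show "integrable lborel (\<lambda>x. K2 * ((km + A1) * R\<^sup>2) powr (3/4) * \<bar>q x t\<bar>)"
            by (intro integrable_mult_right L1_contraction t')
          show "indicator (cball 0 R) x * ((\<bar>g x t\<bar> + 0 * g x t) * (\<beta> t * (km + A t * (norm x)\<^sup>2) powr (- (1/4))))
             \<le> K2 * ((km + A1) * R\<^sup>2) powr (3/4) * \<bar>q x t\<bar>" for x :: 'a
            using pt[of x] K2 by (cases "norm x \<le> R") (auto simp: a_def)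
        qed
        also have "\<dots> = K2 * ((km + A1) * R\<^sup>2) powr (3/4) * (\<integral>x. \<bar>q x t\<bar> \<partial>lborel)" by simp
        also have "\<dots> \<le> K2 * ((km + A1) * R\<^sup>2) powr (3/4) * F"
          unfolding F_def using L1_contraction(2)[OF t'(1,2)] K2 by (intro mult_left_mono) auto
        finally have "(\<integral>x. indicator (cball 0 R) x * ((\<bar>g x t\<bar> + 0 * g x t) * (\<beta> t * (km + A t * (norm x)\<^sup>2) powr (- (1/4)))) \<partial>lborel) / R\<^sup>2
          \<le> K2 * ((km + A1) * R\<^sup>2) powr (3/4) * F / R\<^sup>2" by (rule divide_right_mono) simp
        also have "\<dots> = er m"
        proof -
          have "((km + A1) * R\<^sup>2) powr (3/4) = (km + A1) powr (3/4) * (R\<^sup>2) powr (3/4)"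
            by (rule powr_mult)
          moreover have "(R\<^sup>2) powr (3/4) / R\<^sup>2 = (R\<^sup>2) powr (- (1/4))"
            using powr_diff[of "R\<^sup>2" "3/4" 1] R by simp
          moreover have "K2 * (X * Y) * F / R\<^sup>2 = K2 * X * F * (Y / R\<^sup>2)" for X Y by simp
          ultimately show ?thesis unfolding er_def R_def[symmetric] by metis
        qed
        finally show "(\<integral>x. indicator (cball 0 R) x * ((\<bar>g x t\<bar> + 0 * g x t) * (\<beta> t * (km + A t * (norm x)\<^sup>2) powr (- (1/4)))) \<partial>lborel) / R\<^sup>2 \<le> er m" .
      qed auto
      moreover have "(\<integral>x. \<bar>q x (T/2)\<bar> * ((\<beta> (T/2) * (km + A (T/2) * (norm x)\<^sup>2) powr (- (1/4))) * cut R ((norm x)\<^sup>2)) \<partial>lborel) \<le> C"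
      proof -
        have tT: "0 < T / 2" "T / 2 < T" using T by auto
        have R2: "R\<^sup>2 \<le> (norm x)\<^sup>2" if "R \<le> norm x" for x :: 'a using that R by (intro power_mono) auto
        have a: "0 \<le> A (T/2)" by (simp add: A_def)
        have "(\<integral>x. \<bar>q x (T/2)\<bar> * ((\<beta> (T/2) * (km + A (T/2) * (norm x)\<^sup>2) powr (- (1/4))) * cut R ((norm x)\<^sup>2)) \<partial>lborel)
          \<le> (\<integral>x. \<beta> (T/2) * km powr (- (1/4)) * \<bar>q x (T/2)\<bar> \<partial>lborel)"
        proof (rule integral_mono)
          show "integrable lborel (\<lambda>x. \<beta> (T/2) * km powr (- (1/4)) * \<bar>q x (T/2)\<bar>)"
            by (intro integrable_mult_right L1_contraction tT)
          show "integrable lborel (\<lambda>x. \<bar>q x (T/2)\<bar> * ((\<beta> (T/2) * (km + A (T/2) * (norm x)\<^sup>2) powr (- (1/4))) * cut R ((norm x)\<^sup>2)))"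
          proof (rule integrable_compact_support[where R=R])
            show "continuous_on UNIV (\<lambda>x. \<bar>q x (T/2)\<bar> * ((\<beta> (T/2) * (km + A (T/2) * (norm x)\<^sup>2) powr (- (1/4))) * cut R ((norm x)\<^sup>2)))"
              by (intro continuous_on_mult continuous_on_const cont_weight km a cut_continuous continuous_on_rabs continuous_on_diff cont_u cont_B tT continuous_on_power continuous_on_norm continuous_on_id)
          qed (use cut_eq_0(1)[OF R(1) R2] in auto)
          fix x :: 'a
          have "(km + A (T/2) * (norm x)\<^sup>2) powr (- (1/4)) \<le> km powr (- (1/4))"
            using km a by (intro powr_mono2') auto
          then have "(\<beta> (T/2) * (km + A (T/2) * (norm x)\<^sup>2) powr (- (1/4))) * cut R ((norm x)\<^sup>2) \<le> (\<beta> (T/2) * km powr (- (1/4))) * 1"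
            using cut_le(1)[OF R(1)] cut_nonneg by (intro mult_mono mult_left_mono) (auto simp: \<beta>_def)
          then have "\<bar>q x (T/2)\<bar> * ((\<beta> (T/2) * (km + A (T/2) * (norm x)\<^sup>2) powr (- (1/4))) * cut R ((norm x)\<^sup>2)) \<le> \<bar>q x (T/2)\<bar> * ((\<beta> (T/2) * km powr (- (1/4))) * 1)"
            by (intro mult_left_mono) auto
          then show "\<bar>q x (T/2)\<bar> * ((\<beta> (T/2) * (km + A (T/2) * (norm x)\<^sup>2) powr (- (1/4))) * cut R ((norm x)\<^sup>2)) \<le> \<beta> (T/2) * km powr (- (1/4)) * \<bar>q x (T/2)\<bar>"
            by (simp add: mult_ac)
        qed
        also have "\<dots> = \<beta> (T/2) * km powr (- (1/4)) * (\<integral>x. \<bar>q x (T/2)\<bar> \<partial>lborel)" by simp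
        also have "\<dots> \<le> C" unfolding C_def F_def using L1_contraction(2)[OF tT] by (intro mult_left_mono) (auto simp: \<beta>_def)
        finally show ?thesis .
      qed
      ultimately show ?thesis by (simp add: R_def E_def n_def mult.assoc)
    qed
    have lim: "(\<lambda>m. E * er m * (t2 - T / 2)) \<longlonglongrightarrow> 0"
    proof -
      have "(\<lambda>m. E * (K2 * (km + A1) powr (3/4) * F * ((real (Suc m))\<^sup>2) powr (- (1/4))) * (t2 - T / 2))
         \<longlonglongrightarrow> E * (K2 * (km + A1) powr (3/4) * F * 0) * (t2 - T / 2)"
        by (intro tendsto_intros square_tail_tendsto)
      then show ?thesis by (simp add: er_def)
    qed
    have t0: "0 < t2" using t2 T by linarith
    have cF: "continuous_on UNIV (\<lambda>x. \<bar>q x t2\<bar> * (\<beta> t2 * (km + A t2 * (norm x)\<^sup>2) powr (- (1/4))))"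
      using Apos[OF t2(2)]
      by (intro continuous_on_mult continuous_on_const cont_weight km continuous_on_rabs continuous_on_diff cont_u cont_B t2 t0) auto
    have nn: "0 \<le> \<bar>q x t2\<bar> * (\<beta> t2 * (km + A t2 * (norm x)\<^sup>2) powr (- (1/4)))" for x by (simp add: \<beta>_def)
    show ?thesis using integral_le_of_cutoff[OF cF nn step lim] by blast
  qed
  show ?thesis
  proof (rule that[OF C])
    fix t assume t: "T / 2 \<le> t" "t < T"
    have \<beta>: "0 < \<beta> t" and \<beta>': "\<beta> t * (T - t) powr c = 1" using t by (auto simp: \<beta>_def simp flip: powr_add)
    have eq: "(\<lambda>x. \<bar>q x t\<bar> * (\<beta> t * (km + A t * (norm x)\<^sup>2) powr (- (1/4)))) = (\<lambda>x. \<beta> t * (\<bar>q x t\<bar> * (km + A t * (norm x)\<^sup>2) powr (- (1/4))))"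
      by (simp add: mult_ac)
    note m = main[OF t, unfolded eq]
    show "integrable lborel (\<lambda>x. \<bar>q x t\<bar> * (km + sc (real DIM('a)) T t * (norm x)\<^sup>2) powr (- (1/4)))"
      using m \<beta> by (simp add: Asc)
    have "\<beta> t * (\<integral>x. \<bar>q x t\<bar> * (km + A t * (norm x)\<^sup>2) powr (- (1/4)) \<partial>lborel) \<le> C" using m by simp
    then have "(T - t) powr c * (\<beta> t * I) \<le> (T - t) powr c * C"
      if "I = (\<integral>x. \<bar>q x t\<bar> * (km + A t * (norm x)\<^sup>2) powr (- (1/4)) \<partial>lborel)" for I
      unfolding that by (intro mult_left_mono) auto
    moreover have "(T - t) powr c * (\<beta> t * I) = I" for I
      using \<beta>' by (metis mult.assoc mult.commute mult_1)
    ultimately show "(\<integral>x. \<bar>q x t\<bar> * (km + sc (real DIM('a)) T t * (norm x)\<^sup>2) powr (- (1/4)) \<partial>lborel) \<le> C * (T - t) powr c"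
      by (simp add: Asc mult.commute)
  qed
qed

end

section \<open>Comparison with the time-scaled solution\<close>

text \<open>Continuity turns the vanishing of a weighted integral into a pointwise identity; this is
  the last step of the comparison argument.\<close>

lemma continuous_nonneg_integral_le_0:
  fixes F :: "'a::euclidean_space \<Rightarrow> real"
  assumes c: "continuous_on UNIV F" and pos: "\<And>x. 0 \<le> F x" and i: "integrable lborel F" and le: "(\<integral>x. F x \<partial>lborel) \<le> 0"
  shows "F x = 0"
proof -
  obtain a :: 'a where a: "cball 0 (norm x + 1) \<subseteq> box (- a) a"
    using bounded_subset_box_symmetric[OF bounded_cball] by blast
  have x: "x \<in> box (- a) a" using a by auto
  have "0 \<le> (\<integral>x. F x \<partial>lborel)" using pos by simp
  then have "(\<integral>x. F x \<partial>lborel) = 0" using le by linarith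
  then have "(F has_integral 0) UNIV" using has_integral_integral_lborel[OF i] by metis
  moreover have "F integrable_on cbox (- a) a" by (rule integrable_continuous[OF continuous_on_subset[OF c]]) auto
  ultimately have "integral (cbox (- a) a) F \<le> 0"
    using integral_subset_le[of "cbox (- a) a" UNIV F] pos \<open>(F has_integral 0) UNIV\<close>
    by (metis has_integral_integrable_integral subset_UNIV)
  moreover have "0 \<le> integral (cbox (- a) a) F" using pos by (intro Henstock_Kurzweil_Integration.integral_nonneg) (auto intro: \<open>F integrable_on cbox (- a) a\<close>)
  ultimately have "(F has_integral 0) (cbox (- a) a)"
    using \<open>F integrable_on cbox (- a) a\<close> by (simp add: has_integral_iff)
  then show ?thesis
    using has_integral_0_cbox_imp_0[OF continuous_on_subset[OF c subset_UNIV] pos, of "- a" a x] x box_subset_cbox by blast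
qed

context pinched_solution
begin

text \<open>At time 0 the two functions tend to \<open>u0 / c\<close> and \<open>u0\<close> in local
  L1, and \<open>u0 / c \<le> u0\<close> because \<open>u0 \<ge> 0\<close> and \<open>c > 1\<close>;
  the integrand is twice the positive part of the difference, so its integral is squeezed to 0. The
  factor 1 is the value of \<open>\<sigma>\<close> in the shared inequality.\<close>

lemma initial_bound_scaled:
  assumes \<phi>: "continuous_on UNIV \<phi>" "\<And>x. R \<le> norm x \<Longrightarrow> \<phi> x = 0" "\<And>x. 0 \<le> \<phi> x" "\<And>x. \<phi> x \<le> 1" and c: "1 < c"
  obtains h where "(h \<longlongrightarrow> 0) (at_right 0)"
    "\<And>t. 0 < t \<Longrightarrow> c * t < T \<Longrightarrow>
      (\<integral>x. (\<bar>u x (c * t) / c - u x t\<bar> + 1 * (u x (c * t) / c - u x t)) * \<phi> x \<partial>lborel) \<le> h t"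
proof -
  define K where "K = cball (0::'a) R"
  have K: "compact K" by (simp add: K_def)
  define U where "U t = (LINT x:K|lebesgue. \<bar>u x t - u0 x\<bar>)" for t
  define h where "h t = 2 / c * U (c * t) + 2 * U t" for t
  have U: "(U \<longlongrightarrow> 0) (at_right 0)"
    using sol K unfolding U_def log_diffusion_solution_def by blast
  have "filterlim (\<lambda>t. c * t) (at_right 0) (at_right (0::real))"
    by (rule filterlim_times_pos[of "\<lambda>t. t" 0]) (use c filterlim_ident in auto)
  from filterlim_compose[OF U this] have "((\<lambda>t. U (c * t)) \<longlongrightarrow> 0) (at_right 0)" .
  then have "(h \<longlongrightarrow> 2 / c * 0 + 2 * 0) (at_right 0)" unfolding h_def using U by (intro tendsto_intros)
  then have lim: "(h \<longlongrightarrow> 0) (at_right 0)" by simp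
  show ?thesis
  proof (rule that[OF lim])
    fix t assume t: "0 < t" "c * t < T"
    have "1 * t < c * t" by (rule mult_strict_right_mono[OF c t(1)])
    then have t': "t < T" "0 < c * t" using t by linarith+
    have i: "integrable lebesgue (\<lambda>x. indicator K x *\<^sub>R \<bar>u x s - u0 x\<bar>)" if s: "0 < s" "s < T" for s
    proof -
      have mu: "(\<lambda>x. indicator K x *\<^sub>R u x s) \<in> borel_measurable lborel"
        using borel_integrable_compact[OF K continuous_on_subset[OF cont_u[OF s] subset_UNIV]] by (rule borel_measurable_integrable)
      have "set_integrable lebesgue K (\<lambda>x. u x s)"
        unfolding set_integrable_def using borel_integrable_compact[OF K continuous_on_subset[OF cont_u[OF s] subset_UNIV]]
        unfolding integrable_completion[OF mu] .
      moreover have "set_integrable lebesgue K u0" using sol K by (simp add: log_diffusion_solution_def locally_integrable_def)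
      ultimately have "set_integrable lebesgue K (\<lambda>x. \<bar>u x s - u0 x\<bar>)"
        by (intro set_integrable_abs set_integral_diff)
      then show ?thesis by (simp add: set_integrable_def)
    qed
    define H where "H x = 2 / c * (indicator K x *\<^sub>R \<bar>u x (c * t) - u0 x\<bar>) + 2 * (indicator K x *\<^sub>R \<bar>u x t - u0 x\<bar>)" for x
    have "(\<integral>x. (\<bar>u x (c * t) / c - u x t\<bar> + 1 * (u x (c * t) / c - u x t)) * \<phi> x \<partial>lborel) \<le> (\<integral>x. H x \<partial>lebesgue)"
    proof (rule lborel_integral_le_lebesgue[where R=R])
      show "continuous_on UNIV (\<lambda>x. (\<bar>u x (c * t) / c - u x t\<bar> + 1 * (u x (c * t) / c - u x t)) * \<phi> x)"
        using c by (intro continuous_intros cont_u t t' \<phi>) auto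
      show "integrable lebesgue H" unfolding H_def using i[OF t'(2) t(2)] i[OF t(1) t'(1)]
        by (intro Bochner_Integration.integrable_add integrable_mult_right)
      have "AE x in lebesgue. 0 \<le> u0 x" using sol by (simp add: log_diffusion_solution_def)
      then show "AE x in lebesgue. (\<bar>u x (c * t) / c - u x t\<bar> + 1 * (u x (c * t) / c - u x t)) * \<phi> x \<le> H x"
      proof eventually_elim
        case (elim x)
        show ?case
        proof (cases "R \<le> norm x \<and> \<phi> x = 0")
          case True
          then show ?thesis using c by (simp add: H_def)
        next
          case False
          then have xK: "x \<in> K" using \<phi>(2)[of x] by (auto simp: K_def)
          have "u0 x / c \<le> u0 x" using elim c mult_right_mono[of 1 c "u0 x"] by (simp add: field_simps)
          moreover have "u x (c * t) / c - u0 x / c \<le> \<bar>u x (c * t) - u0 x\<bar> / c"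
            using c by (simp add: divide_right_mono flip: diff_divide_distrib)
          ultimately have "u x (c * t) / c - u x t \<le> \<bar>u x (c * t) - u0 x\<bar> / c + \<bar>u x t - u0 x\<bar>"
            by linarith
          then have "\<bar>u x (c * t) / c - u x t\<bar> + 1 * (u x (c * t) / c - u x t) \<le> 2 * (\<bar>u x (c * t) - u0 x\<bar> / c + \<bar>u x t - u0 x\<bar>)"
            using c by (auto simp: abs_if)
          then have "(\<bar>u x (c * t) / c - u x t\<bar> + 1 * (u x (c * t) / c - u x t)) * \<phi> x \<le> 2 * (\<bar>u x (c * t) - u0 x\<bar> / c + \<bar>u x t - u0 x\<bar>) * 1"
            using c \<phi>(3,4)[of x] by (intro mult_mono) auto
          also have "\<dots> = H x" using xK by (simp add: H_def)
          finally show ?thesis .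
        qed
      qed
    qed (simp add: \<phi>)
    also have "\<dots> = h t"
      unfolding H_def h_def U_def set_lebesgue_integral_def
      using i[OF t'(2) t(2)] i[OF t(1) t'(1)] by simp
    finally show "(\<integral>x. (\<bar>u x (c * t) / c - u x t\<bar> + 1 * (u x (c * t) / c - u x t)) * \<phi> x \<partial>lborel) \<le> h t" .
  qed
qed

text \<open>The scaling \<open>u(x, c t) / c\<close> preserves the equation and, for \<open>c > 1\<close>, decreases the initial
  value; the comparison principle gives the claim. It amounts to \<open>u\<^sub>t \<le> u / t\<close>.\<close>
lemma u_scaling_le:
  assumes c: "1 < c" and t2: "0 < t2" "c * t2 < T"
  shows "u x (c * t2) / c \<le> u x t2"
proof -
  define n where "n = real DIM('a)"
  have n: "5 \<le> n" using n5 by (simp add: n_def)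
  define v where "v x t = u x (c * t) / c" for x t
  define T' where "T' = T / c"
  have c0: "0 < c" using c by simp
  have ct: "t \<le> c * t" if "0 < t" for t using c that mult_right_mono[of 1 c t] by simp
  have T': "T' \<le> T" "t2 < T'" using c0 c T t2 by (auto simp: T'_def field_simps)
  have v_sol: "smooth_positive_solution T' v (\<lambda>x t. deriv (\<lambda>\<tau>. u x \<tau>) (c * t))"
    unfolding v_def T'_def by (rule smooth_positive_solution_scale[OF u_sol c0])
  have u_sol': "smooth_positive_solution T' u (\<lambda>x t. deriv (\<lambda>\<tau>. u x \<tau>) t)"
    by (rule smooth_positive_solution_restrict[OF u_sol T'(1)])
  obtain c1 C1 where c1: "0 < c1" and C1: "0 < C1"
    and lo: "\<And>x t. 0 \<le> t \<Longrightarrow> t \<le> c * t2 \<Longrightarrow> c1 / (1 + (norm x)\<^sup>2) \<le> barenblatt T kM (x::'a) t"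
    and up: "\<And>x t. 0 \<le> t \<Longrightarrow> t \<le> c * t2 \<Longrightarrow> barenblatt T km (x::'a) t \<le> C1 / (1 + (norm x)\<^sup>2)"
    using barenblatt_two_sided[OF dim3 km(1,3), of "c * t2" T] t2 c0 by (metis less_imp_le mult_pos_pos)
  \<comment> \<open>Dividing by \<open>c\<close> lowers the bound so that it also holds for the
    scaled solution \<open>v\<close>.\<close>
  define m where "m = c1 / c"
  have m: "0 < m" "m \<le> c1" using c1 c by (auto simp: m_def field_simps)
  have bu: "m / (1 + (norm x)\<^sup>2) \<le> u x t" "u x t \<le> C1 / (1 + (norm x)\<^sup>2)"
    "m / (1 + (norm x)\<^sup>2) \<le> v x t" "v x t \<le> C1 / (1 + (norm x)\<^sup>2)" if t: "0 < t" "t \<le> t2" for x t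
  proof -
    have s: "0 < t" "t < T" "t \<le> c * t2" "0 < c * t" "c * t < T" "c * t \<le> c * t2"
    proof -
      have "t \<le> c * t" "t2 \<le> c * t2" "c * t \<le> c * t2" "0 < c * t"
        using t ct[OF t(1)] ct[OF t2(1)] c0 by (auto intro: mult_left_mono)
      then show "0 < t" "t < T" "t \<le> c * t2" "0 < c * t" "c * t < T" "c * t \<le> c * t2" using t t2 by linarith+
    qed
    have "m / (1 + (norm x)\<^sup>2) \<le> c1 / (1 + (norm x)\<^sup>2)" using m by (intro divide_right_mono) auto
    then show "m / (1 + (norm x)\<^sup>2) \<le> u x t" using lo[of t x] bounds(1)[OF s(1,2), of x] s by linarith
    show "u x t \<le> C1 / (1 + (norm x)\<^sup>2)" using up[of t x] bounds(2)[OF s(1,2), of x] s by linarith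
    have "c1 / (1 + (norm x)\<^sup>2) \<le> u x (c * t)" using lo[of "c * t" x] bounds(1)[OF s(4,5), of x] s by linarith
    then have "c1 / (1 + (norm x)\<^sup>2) / c \<le> v x t" unfolding v_def using c0 by (intro divide_right_mono) auto
    then show "m / (1 + (norm x)\<^sup>2) \<le> v x t" by (simp add: m_def mult.commute)
    have "v x t \<le> u x (c * t)" unfolding v_def using c c0 pos(1)[OF s(4,5), of x] by (simp add: field_simps)
    also have "\<dots> \<le> C1 / (1 + (norm x)\<^sup>2)" using up[of "c * t" x] bounds(2)[OF s(4,5), of x] s by linarith
    finally show "v x t \<le> C1 / (1 + (norm x)\<^sup>2)" .
  qed
  define Lc where "Lc = ln (C1 / m)"
  \<comment> \<open>The lower bound \<open>m / (1 + |x|^2)\<close> gives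
    \<open>G \<le> Q (1 + |x|^2) / m\<close>, and the Laplacian of the weight is at most
    \<open>4 n (n + 1)\<close> times the weight divided by \<open>1 + |x|^2\<close>. The resulting
    growth rate \<open>M\<close> is absorbed by the factor \<open>exp (- M * t)\<close>.\<close>
  define M where "M = 4 * n * (n + 1) / m"
  have M: "0 \<le> M" using n m by (simp add: M_def)
  define \<beta> where "\<beta> t = exp (- M * t)" for t :: real
  define E where "E = 24 + 6 * n + 24 * n"
  have E: "0 \<le> E" using n by (simp add: E_def)
  define G where "G x t = \<bar>ln (v x t) - ln (u x t)\<bar> + 1 * (ln (v x t) - ln (u x t))" for x t
  define Q where "Q x t = \<bar>v x t - u x t\<bar> + 1 * (v x t - u x t)" for x t
  have Gn: "0 \<le> G x t" and Qn: "0 \<le> Q x t" for x t by (auto simp: G_def Q_def)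
  have GQ: "G x t \<le> Q x t * (1 + (norm x)\<^sup>2) / m" and G2: "G x t \<le> 2 * Lc" if t: "0 < t" "t \<le> t2" for x t
  proof -
    define r where "r = 1 + (norm x)\<^sup>2"
    have r: "0 < r" by (simp add: r_def add_pos_nonneg)
    note b = bu[OF t, of x, folded r_def]
    have mr: "0 < m / r" using m r by simp
    have "\<bar>ln (v x t) - ln (u x t)\<bar> \<le> \<bar>v x t - u x t\<bar> / (m / r)" by (rule abs_ln_diff_le[OF mr b(3,1)])
    then have *: "\<bar>ln (v x t) - ln (u x t)\<bar> \<le> \<bar>v x t - u x t\<bar> * r / m" by simp
    show "G x t \<le> Q x t * (1 + (norm x)\<^sup>2) / m"
    proof (cases "v x t \<le> u x t")
      case True
      then have "ln (v x t) \<le> ln (u x t)" using b mr by (intro ln_mono) auto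
      then have "G x t = 0" by (simp add: G_def)
      moreover have "0 \<le> Q x t * r / m" using Qn m r by simp
      ultimately show ?thesis by (simp add: r_def)
    next
      case False
      then have Q: "Q x t = 2 * \<bar>v x t - u x t\<bar>" by (simp add: Q_def)
      have "G x t \<le> 2 * \<bar>ln (v x t) - ln (u x t)\<bar>" by (simp add: G_def)
      also have "\<dots> \<le> 2 * (\<bar>v x t - u x t\<bar> * r / m)" using * by simp
      finally show ?thesis by (simp add: Q r_def)
    qed
    have l: "ln (m / r) \<le> ln (u x t)" "ln (u x t) \<le> ln (C1 / r)" "ln (m / r) \<le> ln (v x t)" "ln (v x t) \<le> ln (C1 / r)"
      using b mr by (auto intro!: ln_mono)
    have "ln (C1 / r) - ln (m / r) = Lc" using C1 m r by (simp add: Lc_def ln_divide_pos)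
    then have "\<bar>ln (v x t) - ln (u x t)\<bar> \<le> Lc" using l by linarith
    then show "G x t \<le> 2 * Lc" unfolding G_def mult_1_left by linarith
  qed
  have Lc: "0 \<le> Lc" using G2[OF t2(1) order.refl, of undefined] Gn[of undefined t2] by linarith
  have te: "0 \<le> tail_error TYPE('a) p j" for p j
    unfolding tail_error_def by (intro divide_nonneg_nonneg integral_nonneg) auto
  have cp: "continuous_on UNIV (\<lambda>x::'a. (1 + 1 * (norm x)\<^sup>2) powr p)" for p by (rule cont_weight) auto
  have cv: "continuous_on UNIV (\<lambda>x. v x t)" "continuous_on UNIV (\<lambda>x. u x t)" if t: "0 < t" "t \<le> t2" for t
  proof -
    have s: "t < T" "0 < c * t" "c * t < T"
    proof -
      have "t \<le> c * t" "t2 \<le> c * t2" "c * t \<le> c * t2" "0 < c * t"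
        using t ct[OF t(1)] ct[OF t2(1)] c0 by (auto intro: mult_left_mono)
      then show "t < T" "0 < c * t" "c * t < T" using t t2 by linarith+
    qed
    show "continuous_on UNIV (\<lambda>x. v x t)" "continuous_on UNIV (\<lambda>x. u x t)"
      unfolding v_def using c0 s t by (auto intro!: continuous_intros cont_u)
  qed
  \<comment> \<open>The exponent \<open>n\<close> is large enough for the cutoff error to vanish
    with a mere bound \<open>2 * Lc\<close> on \<open>G\<close>, without any decay in space.\<close>
  define e where "e j = E * (2 * Lc * tail_error TYPE('a) n j) * T" for j
  have e: "e \<longlonglongrightarrow> 0"
  proof -
    have "tail_error TYPE('a) n \<longlonglongrightarrow> 0" by (rule tail_error_tendsto) (simp add: n_def)
    then have "(\<lambda>j. E * (2 * Lc * tail_error TYPE('a) n j) * T) \<longlonglongrightarrow> E * (2 * Lc * 0) * T" by (intro tendsto_intros)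
    then show ?thesis by (simp add: e_def[abs_def])
  qed
  have main: "(\<integral>x. Q x t2 * (\<beta> t2 * (1 + 1 * (norm x)\<^sup>2) powr (- n)) * cut (real (Suc j)) ((norm x)\<^sup>2) \<partial>lborel) \<le> 0 + e j" for j
  proof -
    define R where "R = real (Suc j)"
    have R: "0 < R" by (simp add: R_def)
    have R2: "R\<^sup>2 \<le> (norm x)\<^sup>2" if "R \<le> norm x" for x :: 'a using that R by (intro power_mono) auto
    obtain h where h: "(h \<longlongrightarrow> 0) (at_right 0)"
      "\<And>t. 0 < t \<Longrightarrow> c * t < T \<Longrightarrow>
      (\<integral>x. (\<bar>u x (c * t) / c - u x t\<bar> + 1 * (u x (c * t) / c - u x t)) * cut R ((norm x)\<^sup>2) \<partial>lborel) \<le> h t"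
    proof (rule initial_bound_scaled[of "\<lambda>x. cut R ((norm x)\<^sup>2)" R c])
      show "continuous_on UNIV (\<lambda>x::'a. cut R ((norm x)\<^sup>2))" by (intro continuous_intros)
      show "cut R ((norm x)\<^sup>2) = 0" if "R \<le> norm x" for x :: 'a using cut_eq_0(1)[OF R R2[OF that]] .
      show "0 \<le> cut R ((norm x)\<^sup>2)" "cut R ((norm x)\<^sup>2) \<le> 1" for x :: 'a using cut_nonneg cut_le(1)[OF R] by auto
    qed (use c that in auto)
    have step: "(\<integral>x. Q x t2 * ((\<beta> t2 * (1 + 1 * (norm x)\<^sup>2) powr (- n)) * cut R ((norm x)\<^sup>2)) \<partial>lborel) \<le> h t1 + e j" if t1: "0 < t1" "t1 < t2" for t1
    proof -
      have w: "radial_weight n {t1..t2} (\<lambda>r t. \<beta> t * (1 + 1 * r) powr (- n))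
         (\<lambda>r t. - n * 1 * \<beta> t * (1 + 1 * r) powr (- n - 1))
         (\<lambda>r t. n * (n + 1) * 1\<^sup>2 * \<beta> t * (1 + 1 * r) powr (- n - 2))
         (\<lambda>r t. (- M * \<beta> t) * (1 + 1 * r) powr (- n) - n * 0 * r * \<beta> t * (1 + 1 * r) powr (- n - 1))"
      proof (rule radial_weight_power)
        show "(\<beta> has_real_derivative - M * \<beta> t) (at t within {t1..t2})" for t
          unfolding \<beta>_def[abs_def] by (auto intro!: derivative_eq_intros)
        show "continuous_on {t1..t2} (\<lambda>t. - M * \<beta> t)" unfolding \<beta>_def by (intro continuous_intros)
      qed (use n in \<open>auto simp: \<beta>_def\<close>)
      have "(\<integral>x. (\<bar>v x t2 - u x t2\<bar> + 1 * (v x t2 - u x t2)) * ((\<beta> t2 * (1 + 1 * (norm x)\<^sup>2) powr (- n)) * cut R ((norm x)\<^sup>2)) \<partial>lborel)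
        \<le> (\<integral>x. (\<bar>v x t1 - u x t1\<bar> + 1 * (v x t1 - u x t1)) * ((\<beta> t1 * (1 + 1 * (norm x)\<^sup>2) powr (- n)) * cut R ((norm x)\<^sup>2)) \<partial>lborel)
          + (24 + 6 * real DIM('a) + 24 * n) * (2 * Lc * tail_error TYPE('a) n j) * (t2 - t1)"
      proof (rule cutoff_inequality[OF v_sol u_sol' t1(1) _ T'(2) w _ R])
        fix x :: 'a and t assume "t \<in> {t1..t2}"
        then have t: "0 < t" "t \<le> t2" using t1 by auto
        define r where "r = (norm x)\<^sup>2"
        have r: "0 \<le> r" by (simp add: r_def)
        define D where "D = 1 + 1 * r"
        have D: "0 < D" using r by (simp add: D_def)
        define b where "b = \<beta> t"
        have b: "0 < b" by (simp add: b_def \<beta>_def)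
        define P where "P = D powr (- n - 2)"
        have P: "0 < P" using D by (simp add: P_def)
        have PD: "D powr (- n) = P * D * D"
          using powr_add[of D "- n - 2" 2] D by (simp add: P_def power2_eq_square mult.assoc)
        define LW where "LW = 2 * n * 1 * b * P * (2 * (n + 1) * (1 * r) - n * D)"
        have LWeq: "4 * r * (n * (n + 1) * 1\<^sup>2 * b * D powr (- n - 2)) + 2 * n * (- n * 1 * b * D powr (- n - 1)) = LW"
          using power_weight_laplacian[of 1 1 r n b n] D unfolding LW_def P_def D_def by simp
        have "2 * (n + 1) * (1 * r) - n * D \<le> 2 * (n + 1) * D"
        proof -
          have "2 * (n + 1) * (1 * r) \<le> 2 * (n + 1) * D" using n by (intro mult_left_mono) (auto simp: D_def)
          moreover have "0 \<le> n * D" using n D by simp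
          ultimately show ?thesis by linarith
        qed
        then have "LW \<le> 2 * n * 1 * b * P * (2 * (n + 1) * D)"
          unfolding LW_def using n b P by (intro mult_left_mono) auto
        then have "G x t * LW \<le> G x t * (2 * n * 1 * b * P * (2 * (n + 1) * D))"
          by (rule mult_left_mono) (rule Gn)
        also have "\<dots> \<le> (Q x t * D / m) * (2 * n * 1 * b * P * (2 * (n + 1) * D))"
          using GQ[OF t, of x] n b P D unfolding r_def[symmetric] D_def by (intro mult_right_mono) auto
        also have "\<dots> = Q x t * (M * b * (P * D * D))" by (simp add: M_def)
        finally have 1: "G x t * LW + Q x t * ((- M * b) * (P * D * D)) \<le> 0" by simp
        have "G x t * (4 * r * (n * (n + 1) * 1\<^sup>2 * b * D powr (- n - 2)) + 2 * n * (- n * 1 * b * D powr (- n - 1)))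
          + Q x t * ((- M * b) * D powr (- n) - n * 0 * r * b * D powr (- n - 1)) \<le> 0"
          unfolding LWeq PD using 1 by simp
        then show "(\<bar>ln (v x t) - ln (u x t)\<bar> + 1 * (ln (v x t) - ln (u x t)))
           * (4 * (norm x)\<^sup>2 * (n * (n + 1) * 1\<^sup>2 * \<beta> t * (1 + 1 * (norm x)\<^sup>2) powr (- n - 2)) + 2 * real DIM('a) * (- n * 1 * \<beta> t * (1 + 1 * (norm x)\<^sup>2) powr (- n - 1)))
           + (\<bar>v x t - u x t\<bar> + 1 * (v x t - u x t)) * ((- M * \<beta> t) * (1 + 1 * (norm x)\<^sup>2) powr (- n) - n * 0 * (norm x)\<^sup>2 * \<beta> t * (1 + 1 * (norm x)\<^sup>2) powr (- n - 1)) \<le> 0"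
          unfolding G_def Q_def D_def b_def r_def n_def[symmetric] .
      next
        fix t assume "t \<in> {t1..t2}"
        then have t: "0 < t" "t \<le> t2" using t1 by auto
        show "(\<integral>x. indicator (cball 0 R) x * ((\<bar>ln (v x t) - ln (u x t)\<bar> + 1 * (ln (v x t) - ln (u x t))) * (\<beta> t * (1 + 1 * (norm x)\<^sup>2) powr (- n))) \<partial>lborel) / R\<^sup>2
           \<le> 2 * Lc * tail_error TYPE('a) n j"
          unfolding R_def
        proof (rule tail_error_bound)
          have "\<forall>x\<in>UNIV. v x t \<noteq> 0" "\<forall>x\<in>UNIV. u x t \<noteq> 0"
          proof -
            have "0 < m / (1 + (norm x)\<^sup>2)" for x :: 'a using m by (intro divide_pos_pos) (auto simp: add_pos_nonneg)
            then have "0 < v x t" "0 < u x t" for x using bu(1,3)[OF t, of x] by (meson order_less_le_trans)+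
            then show "\<forall>x\<in>UNIV. v x t \<noteq> 0" "\<forall>x\<in>UNIV. u x t \<noteq> 0" by (metis less_irrefl)+
          qed
          then show "continuous_on UNIV (\<lambda>x. (\<bar>ln (v x t) - ln (u x t)\<bar> + 1 * (ln (v x t) - ln (u x t))) * (\<beta> t * (1 + 1 * (norm x)\<^sup>2) powr (- n)))"
            by (intro continuous_on_mult continuous_on_add continuous_on_rabs continuous_on_diff continuous_on_const continuous_on_ln cv t cp)
          fix x :: 'a
          have "\<beta> t \<le> 1" using M t by (simp add: \<beta>_def)
          then have "G x t * (\<beta> t * (1 + 1 * (norm x)\<^sup>2) powr (- n)) \<le> 2 * Lc * (1 * (1 + 1 * (norm x)\<^sup>2) powr (- n))"
            using G2[OF t, of x] Lc by (intro mult_mono mult_right_mono) (auto simp: \<beta>_def)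
          then show "(\<bar>ln (v x t) - ln (u x t)\<bar> + 1 * (ln (v x t) - ln (u x t))) * (\<beta> t * (1 + 1 * (norm x)\<^sup>2) powr (- n)) \<le> 2 * Lc * (1 + (norm x)\<^sup>2) powr (- n)"
            by (simp add: G_def)
        qed
      qed (use t1 n in auto)
      then have "(\<integral>x. Q x t2 * ((\<beta> t2 * (1 + 1 * (norm x)\<^sup>2) powr (- n)) * cut R ((norm x)\<^sup>2)) \<partial>lborel)
        \<le> (\<integral>x. Q x t1 * ((\<beta> t1 * (1 + 1 * (norm x)\<^sup>2) powr (- n)) * cut R ((norm x)\<^sup>2)) \<partial>lborel) + E * (2 * Lc * tail_error TYPE('a) n j) * (t2 - t1)"
        unfolding Q_def E_def n_def .
      moreover have "E * (2 * Lc * tail_error TYPE('a) n j) * (t2 - t1) \<le> e j"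
      proof -
        have "t2 - t1 \<le> T" using t1 t2 ct[OF t2(1)] by linarith
        then show ?thesis unfolding e_def by (intro mult_left_mono mult_nonneg_nonneg E Lc te) auto
      qed
      moreover have "(\<integral>x. Q x t1 * ((\<beta> t1 * (1 + 1 * (norm x)\<^sup>2) powr (- n)) * cut R ((norm x)\<^sup>2)) \<partial>lborel) \<le> (\<integral>x. Q x t1 * cut R ((norm x)\<^sup>2) \<partial>lborel)"
      proof (rule integral_mono)
        have cQ: "continuous_on UNIV (\<lambda>x. Q x t1)"
          unfolding Q_def using t1 by (intro continuous_intros cv) auto
        have cc: "continuous_on UNIV (\<lambda>x::'a. cut R ((norm x)\<^sup>2))" by (intro continuous_intros)
        show "integrable lborel (\<lambda>x. Q x t1 * ((\<beta> t1 * (1 + 1 * (norm x)\<^sup>2) powr (- n)) * cut R ((norm x)\<^sup>2)))"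
          by (rule integrable_compact_support[where R=R])
             (use cut_eq_0(1)[OF R R2] in \<open>auto intro!: continuous_on_mult continuous_on_const cQ cc cp[unfolded mult_1]\<close>)
        show "integrable lborel (\<lambda>x. Q x t1 * cut R ((norm x)\<^sup>2))"
          by (rule integrable_compact_support[where R=R])
             (use cut_eq_0(1)[OF R R2] in \<open>auto intro!: continuous_on_mult cQ cc\<close>)
        fix x :: 'a
        have b1: "\<beta> t1 \<le> 1" using M t1 by (simp add: \<beta>_def)
        have "(1 + 1 * (norm x)\<^sup>2) powr (- n) \<le> 1 powr (- n)" using n by (intro powr_mono2') auto
        then have "\<beta> t1 * (1 + 1 * (norm x)\<^sup>2) powr (- n) \<le> 1 * 1" using b1 by (intro mult_mono) (auto simp: \<beta>_def)
        then have "(\<beta> t1 * (1 + 1 * (norm x)\<^sup>2) powr (- n)) * cut R ((norm x)\<^sup>2) \<le> (1 * 1) * cut R ((norm x)\<^sup>2)"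
          by (rule mult_right_mono) (rule cut_nonneg)
        then have "Q x t1 * ((\<beta> t1 * (1 + 1 * (norm x)\<^sup>2) powr (- n)) * cut R ((norm x)\<^sup>2)) \<le> Q x t1 * ((1 * 1) * cut R ((norm x)\<^sup>2))"
          by (rule mult_left_mono) (rule Qn)
        then show "Q x t1 * ((\<beta> t1 * (1 + 1 * (norm x)\<^sup>2) powr (- n)) * cut R ((norm x)\<^sup>2)) \<le> Q x t1 * cut R ((norm x)\<^sup>2)" by simp
      qed
      moreover have "(\<integral>x. Q x t1 * cut R ((norm x)\<^sup>2) \<partial>lborel) \<le> h t1"
      proof -
        have "c * t1 < T" using t1 t2 c0 mult_strict_left_mono[of t1 t2 c] by linarith
        then show ?thesis using h(2)[of t1] t1 unfolding Q_def v_def by blast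
      qed
      ultimately show ?thesis by linarith
    qed
    have "(\<integral>x. Q x t2 * ((\<beta> t2 * (1 + 1 * (norm x)\<^sup>2) powr (- n)) * cut R ((norm x)\<^sup>2)) \<partial>lborel) \<le> 0 + e j"
    proof (rule tendsto_lowerbound)
      show "((\<lambda>t. h t + e j) \<longlongrightarrow> 0 + e j) (at_right 0)" by (intro tendsto_intros h)
      show "\<forall>\<^sub>F t in at_right 0. (\<integral>x. Q x t2 * ((\<beta> t2 * (1 + 1 * (norm x)\<^sup>2) powr (- n)) * cut R ((norm x)\<^sup>2)) \<partial>lborel) \<le> h t + e j"
        by (rule eventually_mono[OF eventually_at_right_real[OF t2(1)]], rule step) auto
    qed simp
    then show ?thesis by (simp add: R_def mult.assoc)
  qed
  have cF: "continuous_on UNIV (\<lambda>x. Q x t2 * (\<beta> t2 * (1 + 1 * (norm x)\<^sup>2) powr (- n)))"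
    unfolding Q_def using t2 by (intro continuous_on_mult continuous_on_add continuous_on_rabs continuous_on_diff continuous_on_const cv cp) auto
  have nn: "0 \<le> Q x t2 * (\<beta> t2 * (1 + 1 * (norm x)\<^sup>2) powr (- n))" for x using Qn by (simp add: \<beta>_def)
  note F = integral_le_of_cutoff[OF cF nn main e]
  have "Q x t2 * (\<beta> t2 * (1 + 1 * (norm x)\<^sup>2) powr (- n)) = 0"
    by (rule continuous_nonneg_integral_le_0[OF cF nn F])
  moreover have "1 + 1 * (norm x)\<^sup>2 \<noteq> 0" using zero_le_power2[of "norm x"] by linarith
  ultimately have "Q x t2 = 0" by (simp add: \<beta>_def)
  then show ?thesis by (simp add: Q_def v_def)
qed

end

section \<open>Mean value inequality\<close>

text \<open>\<open>kernel r\<close> and \<open>r\<^sup>-\<^sup>N cut r\<close> are chosen so that the \<open>r\<close>-derivative of the first is \<open>r\<close> times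
  the Laplacian of the second; this replaces the mean value formula over balls.\<close>
definition kernel :: "nat \<Rightarrow> real \<Rightarrow> real \<Rightarrow> real" where
  "kernel n r s = 6 * inverse (r ^ n) * (max 0 (1 - s / r\<^sup>2))\<^sup>2"

text \<open>By the radial formula this is the Laplacian, in dimension \<open>n\<close>, of
  \<open>cut r\<close> of the squared distance to a centre; \<open>s\<close> is that squared
  distance.\<close>

definition cutL :: "nat \<Rightarrow> real \<Rightarrow> real \<Rightarrow> real" where
  "cutL n r s = 4 * s * cut'' r s + 2 * real n * cut' r s"

text \<open>The factor 6 of the kernel matches the one in \<open>cut''\<close>, the power of
  \<open>r\<close> the term with \<open>cut'\<close>. As the Laplacian of a compactly supported
  function integrates to 0, the mass of the kernel is the same for all \<open>r\<close>.\<close>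

lemma kernel_derivative:
  assumes r: "0 < r"
  shows "((\<lambda>r. kernel n r s) has_real_derivative r * inverse (r ^ n) * cutL n r s) (at r)"
proof -
  define P where "P = max 0 (1 - s / r\<^sup>2)"
  have d1: "((\<lambda>r. inverse (r ^ n)) has_real_derivative - (real n * inverse (r ^ n) / r)) (at r)"
  proof -
    have "((\<lambda>r. inverse (r ^ n)) has_real_derivative - (inverse (r ^ n) * (real n * r ^ (n - Suc 0)) * inverse (r ^ n))) (at r)"
      using r by (intro DERIV_inverse' DERIV_pow) auto
    moreover have "real n * r ^ (n - Suc 0) * inverse (r ^ n) = real n / r"
      using r by (cases n) (auto simp: field_simps)
    then have "inverse (r ^ n) * (real n * r ^ (n - Suc 0)) * inverse (r ^ n) = real n * inverse (r ^ n) / r"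
      by (metis mult.assoc mult.commute times_divide_eq_left)
    ultimately show ?thesis by metis
  qed
  have "((\<lambda>r. s / r\<^sup>2) has_real_derivative - (2 * s / r ^ 3)) (at r)"
    using r by (auto intro!: derivative_eq_intros simp: power2_eq_square power3_eq_cube field_simps)
  from DERIV_diff[OF DERIV_const[of 1] this]
  have "((\<lambda>r. 1 - s / r\<^sup>2) has_real_derivative 2 * s / r ^ 3) (at r)" by simp
  from DERIV_chain2[OF pos_part_power_derivative[of 2] this]
  have d2: "((\<lambda>r. (max 0 (1 - s / r\<^sup>2))\<^sup>2) has_real_derivative 2 * P * (2 * s / r ^ 3)) (at r)"
    by (simp add: P_def)
  have "((\<lambda>r. kernel n r s) has_real_derivative 6 * (- (real n * inverse (r ^ n) / r) * P\<^sup>2 + 2 * P * (2 * s / r ^ 3) * inverse (r ^ n))) (at r)"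
    using DERIV_cmult[OF DERIV_mult[OF d1 d2], of 6] by (simp add: kernel_def P_def mult.assoc)
  moreover have "6 * (- (real n * i / r) * P\<^sup>2 + 2 * P * (2 * s / r ^ 3) * i) = r * i * cutL n r s" for i
  proof -
    have "r * (4 * s * (6 / r ^ 4 * P) + 2 * real n * (- (3 / r\<^sup>2) * P\<^sup>2)) = 24 * s * P / r ^ 3 - 6 * real n * P\<^sup>2 / r"
      using r by (simp add: field_simps power2_eq_square power3_eq_cube power4_eq_xxxx)
    then have "r * cutL n r s = 24 * s * P / r ^ 3 - 6 * real n * P\<^sup>2 / r"
      by (simp add: cutL_def cut'_def cut''_def P_def)
    then have "r * i * cutL n r s = i * (24 * s * P / r ^ 3 - 6 * real n * P\<^sup>2 / r)"
      by (metis mult.assoc mult.commute)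
    then show ?thesis by (simp add: algebra_simps)
  qed
  ultimately show ?thesis by metis
qed

lemma kernel_continuous [continuous_intros]:
  "continuous_on S f \<Longrightarrow> continuous_on S (\<lambda>x. kernel n r (f x))"
  "continuous_on S f \<Longrightarrow> continuous_on S (\<lambda>x. cutL n r (f x))"
  unfolding kernel_def cutL_def divide_inverse by (auto intro!: continuous_intros)

lemma kernel_nonneg: "0 < r \<Longrightarrow> 0 \<le> kernel n r s" by (simp add: kernel_def)

lemma kernel_eq_0: "0 < r \<Longrightarrow> r\<^sup>2 \<le> s \<Longrightarrow> kernel n r s = 0" "0 < r \<Longrightarrow> r\<^sup>2 \<le> s \<Longrightarrow> cutL n r s = 0"
  by (auto simp: kernel_def cutL_def cut_eq_0)

lemma kernel_le: "0 < r \<Longrightarrow> 0 \<le> s \<Longrightarrow> kernel n r s \<le> 6 * inverse (r ^ n)"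
proof -
  assume "0 < r" "0 \<le> s"
  then have "(max 0 (1 - s / r\<^sup>2))\<^sup>2 \<le> 1" by (intro power_le_one) auto
  then show ?thesis unfolding kernel_def using \<open>0 < r\<close> by (intro mult_left_le) auto
qed

lemma shifted_cut_test:
  fixes x0 :: "'a::euclidean_space"
  assumes r: "0 < r"
  obtains p pp where "c2_test (r + norm x0) (\<lambda>x. cut r ((norm (x - x0))\<^sup>2)) p pp"
    "\<And>x. (\<Sum>b\<in>Basis. pp b x) = cutL DIM('a) r ((norm (x - x0))\<^sup>2)"
proof -
  have c: "continuous_on {0..} (cut'' r)" by (intro continuous_intros)
  note rad = c2_along_basis_radial[OF cut_derivative(1)[OF r] cut_derivative(2)[OF r] c, where ?'a='a]
  define p where "p b x = 2 * ((x - x0) \<bullet> b) * cut' r ((norm (x - x0))\<^sup>2)" for b x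
  define pp where "pp b x = 2 * cut' r ((norm (x - x0))\<^sup>2) + 4 * ((x - x0) \<bullet> b)\<^sup>2 * cut'' r ((norm (x - x0))\<^sup>2)" for b x
  show ?thesis
  proof (rule that[of p pp])
    show "(\<Sum>b\<in>Basis. pp b x) = cutL DIM('a) r ((norm (x - x0))\<^sup>2)" for x
      unfolding pp_def cutL_def by (rule rad(2))
    have s: "r\<^sup>2 \<le> (norm (x - x0))\<^sup>2" if "r + norm x0 \<le> norm x" for x
      using that r norm_triangle_ineq2[of x x0] by (intro power_mono) auto
    have shift: "x + h *\<^sub>R b - x0 = (x - x0) + h *\<^sub>R b" for x b :: 'a and h by simp
    have "c2_along_basis (\<lambda>x. cut r ((norm (x - x0))\<^sup>2)) p pp"
      unfolding c2_along_basis_def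
    proof (intro conjI ballI allI)
      show "continuous_on UNIV (\<lambda>x. cut r ((norm (x - x0))\<^sup>2))" by (intro continuous_intros)
      fix b :: 'a assume b: "b \<in> Basis"
      show "continuous_on UNIV (p b)" "continuous_on UNIV (pp b)"
        unfolding p_def pp_def by (intro continuous_intros)+
      fix x
      show "((\<lambda>h. cut r ((norm (x + h *\<^sub>R b - x0))\<^sup>2)) has_real_derivative p b x) (at 0)"
        "((\<lambda>h. p b (x + h *\<^sub>R b)) has_real_derivative pp b x) (at 0)"
        unfolding p_def pp_def shift using c2_along_basisD(3,4)[OF rad(1) b, of "x - x0"] by auto
    qed
    then show "c2_test (r + norm x0) (\<lambda>x. cut r ((norm (x - x0))\<^sup>2)) p pp"
      unfolding c2_test_def supported_in_ball_def p_def pp_def using s cut_eq_0[OF r] by auto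
  qed
qed

text \<open>The derivative of the kernel average in \<open>r\<close> is \<open>r^(1-n)\<close> times
  the integral of \<open>L\<close> against the Laplacian of the cutoff, which \<open>weak\<close>
  turns into an integral of \<open>M\<close>. That integral is at most \<open>m\<close> times the
  volume of the ball, so the derivative is at most \<open>m V r\<close>. Only the weak relation
  enters; \<open>L\<close> is never differentiated.\<close>

lemma mean_value_estimate:
  fixes L M :: "'a::euclidean_space \<Rightarrow> real" and x0 :: 'a
  assumes L: "continuous_on UNIV L" and M: "continuous_on UNIV M" and m: "\<And>x. \<bar>M x\<bar> \<le> m"
    and weak: "\<And>r. 0 < r \<Longrightarrow> (\<integral>x. L x * cutL DIM('a) r ((norm (x - x0))\<^sup>2) \<partial>lborel) = (\<integral>x. M x * cut r ((norm (x - x0))\<^sup>2) \<partial>lborel)"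
    and r: "0 < r1" "r1 \<le> r2"
  shows "\<bar>(\<integral>x. L x * kernel DIM('a) r2 ((norm (x - x0))\<^sup>2) \<partial>lborel) - (\<integral>x. L x * kernel DIM('a) r1 ((norm (x - x0))\<^sup>2) \<partial>lborel)\<bar>
    \<le> m * unit_ball_vol DIM('a) * r2\<^sup>2"
proof -
  let ?n = "DIM('a)"
  define V where "V = unit_ball_vol (real ?n)"
  have V: "0 \<le> V" by (simp add: V_def)
  have m0: "0 \<le> m" using m[of 0] abs_ge_zero by linarith
  have far: "s\<^sup>2 \<le> (norm (x - x0))\<^sup>2" if "s + norm x0 \<le> norm x" "0 < s" for x s
    using that norm_triangle_ineq2[of x x0] by (intro power_mono) auto
  obtain a :: 'a where a: "cball 0 (r2 + norm x0) \<subseteq> cbox (- a) a"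
    using bounded_subset_cbox_symmetric[OF bounded_cball] by blast
  define \<Phi> where "\<Phi> r = (\<integral>x. L x * kernel ?n r ((norm (x - x0))\<^sup>2) \<partial>lborel)" for r
  have sub: "cball 0 (s + norm x0) \<subseteq> cbox (- a) a" if "s \<le> r2" for s
    using a that by (meson add_le_cancel_right subset_cball subset_trans)
  have \<Phi>: "\<Phi> s = integral (cbox (- a) a) (\<lambda>x. L x * kernel ?n s ((norm (x - x0))\<^sup>2))" if "s \<in> {r1..r2}" for s
    unfolding \<Phi>_def
    by (rule lborel_integral_eq_cbox[OF _ _ sub[of s]]) (use that r far kernel_eq_0 in \<open>auto intro!: continuous_intros L\<close>)
  have d\<Phi>: "(\<Phi> has_real_derivative s * inverse (s ^ ?n) * (\<integral>x. M x * cut s ((norm (x - x0))\<^sup>2) \<partial>lborel)) (at s within {r1..r2})"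
    if s: "s \<in> {r1..r2}" for s
  proof -
    have s0: "0 < s" using s r by auto
    have "((\<lambda>s. integral (cbox (- a) a) (\<lambda>x. L x * kernel ?n s ((norm (x - x0))\<^sup>2))) has_real_derivative
       integral (cbox (- a) a) (\<lambda>x. L x * (s * inverse (s ^ ?n) * cutL ?n s ((norm (x - x0))\<^sup>2)))) (at s within {r1..r2})"
    proof (rule leibniz_rule_field_derivative[where fx="\<lambda>s x. L x * (s * inverse (s ^ ?n) * cutL ?n s ((norm (x - x0))\<^sup>2))"])
      fix t x assume "t \<in> {r1..r2}"
      then have "0 < t" using r by auto
      from DERIV_cmult[OF kernel_derivative[OF this, of ?n "(norm (x - x0))\<^sup>2"], of "L x"]
      show "((\<lambda>s. L x * kernel ?n s ((norm (x - x0))\<^sup>2)) has_real_derivative L x * (t * inverse (t ^ ?n) * cutL ?n t ((norm (x - x0))\<^sup>2))) (at t within {r1..r2})"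
        by (rule DERIV_subset) simp
    next
      fix t
      have "continuous_on UNIV (\<lambda>x. L x * kernel ?n t ((norm (x - x0))\<^sup>2))" by (intro continuous_intros L)
      then show "(\<lambda>x. L x * kernel ?n t ((norm (x - x0))\<^sup>2)) integrable_on cbox (- a) a"
        by (intro integrable_continuous) (auto intro: continuous_on_subset)
    next
      have "continuous_on ({r1..r2} \<times> cbox (- a) a) (\<lambda>z. L (snd z) * (fst z * inverse (fst z ^ ?n) * (4 * (norm (snd z - x0))\<^sup>2 * (6 / fst z ^ 4 * max 0 (1 - (norm (snd z - x0))\<^sup>2 / (fst z)\<^sup>2)) + 2 * real ?n * (- (3 / (fst z)\<^sup>2) * (max 0 (1 - (norm (snd z - x0))\<^sup>2 / (fst z)\<^sup>2))\<^sup>2))))"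
        by (intro continuous_intros continuous_on_compose2[OF L]) (use r in auto)
      then show "continuous_on ({r1..r2} \<times> cbox (- a) a) (\<lambda>(s, x). L x * (s * inverse (s ^ ?n) * cutL ?n s ((norm (x - x0))\<^sup>2)))"
        unfolding cutL_def cut'_def cut''_def split_beta .
    qed (use s in auto)
    moreover have "integral (cbox (- a) a) (\<lambda>x. L x * (s * inverse (s ^ ?n) * cutL ?n s ((norm (x - x0))\<^sup>2)))
       = s * inverse (s ^ ?n) * (\<integral>x. M x * cut s ((norm (x - x0))\<^sup>2) \<partial>lborel)"
    proof -
      have "integral (cbox (- a) a) (\<lambda>x. L x * (s * inverse (s ^ ?n) * cutL ?n s ((norm (x - x0))\<^sup>2)))
        = (\<integral>x. L x * (s * inverse (s ^ ?n) * cutL ?n s ((norm (x - x0))\<^sup>2)) \<partial>lborel)"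
        by (rule lborel_integral_eq_cbox[OF _ _ sub[of s], symmetric]) (use s s0 far kernel_eq_0 in \<open>auto intro!: continuous_intros L\<close>)
      also have "\<dots> = (\<integral>x. s * inverse (s ^ ?n) * (L x * cutL ?n s ((norm (x - x0))\<^sup>2)) \<partial>lborel)"
        by (simp only: mult.left_commute)
      also have "\<dots> = s * inverse (s ^ ?n) * (\<integral>x. L x * cutL ?n s ((norm (x - x0))\<^sup>2) \<partial>lborel)"
        by (rule integral_mult_right_zero)
      finally show ?thesis unfolding weak[OF s0] .
    qed
    ultimately have "((\<lambda>s. integral (cbox (- a) a) (\<lambda>x. L x * kernel ?n s ((norm (x - x0))\<^sup>2))) has_real_derivative
       s * inverse (s ^ ?n) * (\<integral>x. M x * cut s ((norm (x - x0))\<^sup>2) \<partial>lborel)) (at s within {r1..r2})" by simp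
    then show ?thesis
      by (rule has_field_derivative_transform_within[where d=1]) (use \<Phi> s in auto)
  qed
  have bound: "\<bar>s * inverse (s ^ ?n) * (\<integral>x. M x * cut s ((norm (x - x0))\<^sup>2) \<partial>lborel)\<bar> \<le> m * V * r2" if s: "s \<in> {r1..r2}" for s
  proof -
    have s0: "0 < s" using s r by auto
    have i: "integrable lborel (\<lambda>x. M x * cut s ((norm (x - x0))\<^sup>2))"
      by (rule integrable_compact_support[where R="s + norm x0"]) (use s0 far cut_eq_0 in \<open>auto intro!: continuous_intros M\<close>)
    have fin: "emeasure lborel (cball x0 s) < \<infinity>" by (rule emeasure_bounded_finite[OF bounded_cball])
    have "\<bar>\<integral>x. M x * cut s ((norm (x - x0))\<^sup>2) \<partial>lborel\<bar> \<le> (\<integral>x. \<bar>M x * cut s ((norm (x - x0))\<^sup>2)\<bar> \<partial>lborel)"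
      using integral_norm_bound[of lborel "\<lambda>x. M x * cut s ((norm (x - x0))\<^sup>2)"] by simp
    also have "\<dots> \<le> (\<integral>x. m * indicator (cball x0 s) x \<partial>lborel)"
    proof (rule integral_mono)
      show "integrable lborel (\<lambda>x. \<bar>M x * cut s ((norm (x - x0))\<^sup>2)\<bar>)" using i by simp
      show "integrable lborel (\<lambda>x. m * indicator (cball x0 s) x :: real)"
        by (intro integrable_mult_right integrable_real_indicator fin) auto
      fix x
      show "\<bar>M x * cut s ((norm (x - x0))\<^sup>2)\<bar> \<le> m * indicator (cball x0 s) x"
      proof (cases "norm (x - x0) \<le> s")
        case True
        have "\<bar>M x\<bar> * cut s ((norm (x - x0))\<^sup>2) \<le> m * 1"
          using m[of x] cut_nonneg cut_le(1)[OF s0] m0 by (intro mult_mono) auto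
        then show ?thesis using True cut_nonneg[of s "(norm (x - x0))\<^sup>2"] by (simp add: abs_mult dist_norm norm_minus_commute)
      next
        case False
        then have "s\<^sup>2 \<le> (norm (x - x0))\<^sup>2" using s0 by (intro power_mono) auto
        then show ?thesis using m0 by (simp add: cut_eq_0[OF s0])
      qed
    qed
    also have "\<dots> = m * (V * s ^ ?n)"
      using fin s0 by (simp add: content_cball V_def)
    finally have le: "\<bar>\<integral>x. M x * cut s ((norm (x - x0))\<^sup>2) \<partial>lborel\<bar> \<le> m * (V * s ^ ?n)" .
    have "\<bar>s * inverse (s ^ ?n) * (\<integral>x. M x * cut s ((norm (x - x0))\<^sup>2) \<partial>lborel)\<bar> = s * inverse (s ^ ?n) * \<bar>\<integral>x. M x * cut s ((norm (x - x0))\<^sup>2) \<partial>lborel\<bar>"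
      using s0 by (simp add: abs_mult)
    also have "\<dots> \<le> s * inverse (s ^ ?n) * (m * (V * s ^ ?n))" using s0 by (intro mult_left_mono le) auto
    also have "\<dots> = m * V * s" using s0 by simp
    also have "\<dots> \<le> m * V * r2" using s m0 V by (intro mult_left_mono) auto
    finally show ?thesis .
  qed
  have "norm (\<Phi> r2 - \<Phi> r1) \<le> m * V * r2 * norm (r2 - r1)"
  proof (rule field_differentiable_bound[where S="{r1..r2}"])
    show "norm (s * inverse (s ^ ?n) * (\<integral>x. M x * cut s ((norm (x - x0))\<^sup>2) \<partial>lborel)) \<le> m * V * r2" if "s \<in> {r1..r2}" for s
      using bound[OF that] by simp
  qed (use d\<Phi> r in auto)
  also have "\<dots> \<le> m * V * r2 * r2" using m0 V r by (intro mult_left_mono) auto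
  finally show ?thesis by (simp add: \<Phi>_def V_def power2_eq_square mult.assoc)
qed

text \<open>A lower bound for the mass of the kernel: at radius 1 it is at least
  \<open>6 (3/4)^2 \<ge> 3\<close> on the ball of radius 1/2.\<close>

definition kernel_mass_bound :: "nat \<Rightarrow> real" where
  "kernel_mass_bound n = 3 * unit_ball_vol (real n) * (1 / 2) ^ n"

lemma kernel_mass_bound_pos: "0 < kernel_mass_bound n" by (simp add: kernel_mass_bound_def)

text \<open>As the radius shrinks, the kernel averages approach \<open>L x0\<close> times the mass
  of the kernel, which is constant in the radius; \<open>mean_value_estimate\<close> compares them
  with the average at radius \<open>r\<close>.\<close>

lemma pointwise_bound_of_weak_laplacian:
  fixes L M :: "'a::euclidean_space \<Rightarrow> real" and x0 :: 'a
  assumes L: "continuous_on UNIV L" and M: "continuous_on UNIV M" and m: "\<And>x. \<bar>M x\<bar> \<le> m"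
    and weak: "\<And>r. 0 < r \<Longrightarrow> (\<integral>x. L x * cutL DIM('a) r ((norm (x - x0))\<^sup>2) \<partial>lborel) = (\<integral>x. M x * cut r ((norm (x - x0))\<^sup>2) \<partial>lborel)"
    and r: "0 < r" and H: "\<bar>\<integral>x. L x * kernel DIM('a) r ((norm (x - x0))\<^sup>2) \<partial>lborel\<bar> \<le> H"
  shows "kernel_mass_bound DIM('a) * \<bar>L x0\<bar> \<le> H + m * unit_ball_vol DIM('a) * r\<^sup>2"
proof -
  let ?n = "DIM('a)"
  define \<Psi> where "\<Psi> s = (\<integral>x. kernel ?n s ((norm (x - x0))\<^sup>2) \<partial>lborel)" for s
  have far: "s\<^sup>2 \<le> (norm (x - x0))\<^sup>2" if "s + norm x0 \<le> norm x" "0 < s" for x s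
    using that norm_triangle_ineq2[of x x0] by (intro power_mono) auto
  have ik: "integrable lborel (\<lambda>x. F x * kernel ?n s ((norm (x - x0))\<^sup>2))" if "continuous_on UNIV F" "0 < s" for F s
    by (rule integrable_compact_support[where R="s + norm x0"]) (use that far kernel_eq_0 in \<open>auto intro!: continuous_intros\<close>)
  have weak1: "(\<integral>x. 1 * cutL ?n s ((norm (x - x0))\<^sup>2) \<partial>lborel) = (\<integral>x. 0 * cut s ((norm (x - x0))\<^sup>2) \<partial>lborel)" if s: "0 < s" for s
  proof -
    obtain p pp where p: "c2_test (s + norm x0) (\<lambda>x. cut s ((norm (x - x0))\<^sup>2)) p pp"
      "\<And>x. (\<Sum>b\<in>Basis. pp b x) = cutL ?n s ((norm (x - x0))\<^sup>2)"
      using shifted_cut_test[OF s, of x0] by blast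
    have one: "c2_along_basis (\<lambda>x::'a. 1::real) (\<lambda>b x. 0) (\<lambda>b x. 0)" by (simp add: c2_along_basis_def)
    have ii: "integrable lborel (\<lambda>x. 1 * pp b x)" if "b \<in> Basis" for b
      by (rule integrable_compact_support[where R="s + norm x0"])
         (use p(1) that in \<open>auto simp: c2_test_def c2_along_basis_def supported_in_ball_def\<close>)
    have "(\<integral>x. 1 * cutL ?n s ((norm (x - x0))\<^sup>2) \<partial>lborel) = (\<Sum>b\<in>Basis. \<integral>x. 1 * pp b x \<partial>lborel)"
      unfolding p(2)[symmetric] sum_distrib_left by (rule Bochner_Integration.integral_sum[OF ii])
    also have "\<dots> = (\<Sum>b\<in>(Basis::'a set). 0)"
    proof (intro sum.cong refl)
      show "(\<integral>x. 1 * pp b x \<partial>lborel) = 0" if "b \<in> Basis" for b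
        using green_identity[OF one p(1) that] by simp
    qed
    finally show ?thesis by simp
  qed
  \<comment> \<open>The mean value estimate applied to the constant 1, whose Laplacian is 0, shows
    that the mass does not depend on the radius; its exact value is never computed.\<close>
  have mass: "\<Psi> s2 = \<Psi> s1" if "0 < s1" "s1 \<le> s2" for s1 s2
    using mean_value_estimate[where L="\<lambda>_::'a. 1" and M="\<lambda>_. 0" and m=0, OF _ _ _ weak1 that] by (simp add: \<Psi>_def)
  have mass_all: "\<Psi> s = \<Psi> 1" if "0 < s" for s
  proof (cases "s \<le> 1")
    case True
    show ?thesis by (rule mass[symmetric, OF that True])
  next
    case False
    then show ?thesis by (intro mass) auto
  qed
  have mass_lower: "kernel_mass_bound ?n \<le> \<Psi> 1"
  proof -
    have fin: "emeasure lborel (cball x0 (1/2)) < \<infinity>" by (rule emeasure_bounded_finite[OF bounded_cball])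
    have "kernel_mass_bound ?n = (\<integral>x. 3 * indicator (cball x0 (1/2)) x \<partial>lborel)"
      using fin by (simp add: kernel_mass_bound_def content_cball)
    also have "\<dots> \<le> \<Psi> 1" unfolding \<Psi>_def
    proof (rule integral_mono)
      show "integrable lborel (\<lambda>x. 3 * indicator (cball x0 (1/2)) x :: real)"
        by (intro integrable_mult_right integrable_real_indicator fin) auto
      show "integrable lborel (\<lambda>x. kernel ?n 1 ((norm (x - x0))\<^sup>2))" using ik[of "\<lambda>_. 1" 1] by simp
      fix x
      show "3 * indicator (cball x0 (1/2)) x \<le> kernel ?n 1 ((norm (x - x0))\<^sup>2)"
      proof (cases "norm (x - x0) \<le> 1/2")
        case True
        have "(norm (x - x0))\<^sup>2 \<le> (1/2)\<^sup>2" using True by (intro power_mono) auto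
        then have "3 / 4 \<le> max 0 (1 - (norm (x - x0))\<^sup>2 / 1\<^sup>2)" by (simp add: power2_eq_square)
        then have "(3 / 4)\<^sup>2 \<le> (max 0 (1 - (norm (x - x0))\<^sup>2 / 1\<^sup>2))\<^sup>2" by (rule power_mono) simp
        moreover have "3 \<le> 6 * z" if "(3 / 4)\<^sup>2 \<le> z" for z :: real using that by (simp add: power2_eq_square)
        ultimately have "3 \<le> 6 * (max 0 (1 - (norm (x - x0))\<^sup>2 / 1\<^sup>2))\<^sup>2" by blast
        moreover have "kernel ?n 1 s = 6 * (max 0 (1 - s / 1\<^sup>2))\<^sup>2" for s by (simp add: kernel_def)
        ultimately have "3 \<le> kernel ?n 1 ((norm (x - x0))\<^sup>2)" by (simp only:)
        then show ?thesis using True by (simp add: dist_norm norm_minus_commute)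
      next
        case False
        then show ?thesis using kernel_nonneg[of 1 ?n] by (simp add: dist_norm norm_minus_commute)
      qed
    qed
    finally show ?thesis .
  qed
  have \<Psi>1: "0 < \<Psi> 1" using mass_lower kernel_mass_bound_pos by (rule order_less_le_trans[rotated])
  have "\<Psi> 1 * \<bar>L x0\<bar> \<le> H + m * unit_ball_vol ?n * r\<^sup>2 + \<Psi> 1 * e" if e: "0 < e" for e
  proof -
    obtain d where d: "0 < d" "\<And>x. dist x x0 < d \<Longrightarrow> dist (L x) (L x0) < e"
      using L e unfolding continuous_on_iff by (metis UNIV_I)
    define s where "s = min (d / 2) r"
    have s: "0 < s" "s \<le> r" "s < d" using d r by (auto simp: s_def)
    have "\<bar>(\<integral>x. L x * kernel ?n s ((norm (x - x0))\<^sup>2) \<partial>lborel) - L x0 * \<Psi> s\<bar> = \<bar>\<integral>x. (L x - L x0) * kernel ?n s ((norm (x - x0))\<^sup>2) \<partial>lborel\<bar>"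
      using ik[OF L s(1)] ik[of "\<lambda>_. L x0" s] s(1) by (simp add: \<Psi>_def left_diff_distrib)
    also have "\<dots> \<le> (\<integral>x. \<bar>(L x - L x0) * kernel ?n s ((norm (x - x0))\<^sup>2)\<bar> \<partial>lborel)"
      using integral_norm_bound[of lborel "\<lambda>x. (L x - L x0) * kernel ?n s ((norm (x - x0))\<^sup>2)"] by simp
    also have "\<dots> \<le> (\<integral>x. e * kernel ?n s ((norm (x - x0))\<^sup>2) \<partial>lborel)"
    proof (rule integral_mono)
      show "integrable lborel (\<lambda>x. \<bar>(L x - L x0) * kernel ?n s ((norm (x - x0))\<^sup>2)\<bar>)"
        using ik[OF continuous_on_diff[OF L continuous_on_const[of _ "L x0"]] s(1)] by (rule integrable_abs)
      show "integrable lborel (\<lambda>x. e * kernel ?n s ((norm (x - x0))\<^sup>2))" using ik[of "\<lambda>_. e" s] s(1) by simp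
      fix x
      show "\<bar>(L x - L x0) * kernel ?n s ((norm (x - x0))\<^sup>2)\<bar> \<le> e * kernel ?n s ((norm (x - x0))\<^sup>2)"
      proof (cases "norm (x - x0) < d")
        case True
        then have "\<bar>L x - L x0\<bar> \<le> e" using d(2)[of x] by (simp add: dist_norm)
        then show ?thesis using kernel_nonneg[OF s(1)] by (simp add: abs_mult mult_right_mono)
      next
        case False
        then have "s\<^sup>2 \<le> (norm (x - x0))\<^sup>2" using s by (intro power_mono) auto
        then show ?thesis by (simp add: kernel_eq_0 s)
      qed
    qed
    also have "\<dots> = e * \<Psi> s" by (simp add: \<Psi>_def)
    finally have 1: "\<bar>(\<integral>x. L x * kernel ?n s ((norm (x - x0))\<^sup>2) \<partial>lborel) - L x0 * \<Psi> 1\<bar> \<le> e * \<Psi> 1"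
      by (simp add: mass_all[OF s(1)])
    have 2: "\<bar>(\<integral>x. L x * kernel ?n r ((norm (x - x0))\<^sup>2) \<partial>lborel) - (\<integral>x. L x * kernel ?n s ((norm (x - x0))\<^sup>2) \<partial>lborel)\<bar> \<le> m * unit_ball_vol ?n * r\<^sup>2"
      by (rule mean_value_estimate[OF L M m weak s(1,2)])
    have "\<Psi> 1 * \<bar>L x0\<bar> = \<bar>L x0 * \<Psi> 1\<bar>" using \<Psi>1 by (simp add: abs_mult)
    also have "\<dots> \<le> H + m * unit_ball_vol ?n * r\<^sup>2 + e * \<Psi> 1" using 1 2 H by linarith
    finally show ?thesis by (simp add: mult.commute)
  qed
  then have "\<Psi> 1 * \<bar>L x0\<bar> \<le> H + m * unit_ball_vol ?n * r\<^sup>2 + e" if "0 < e" for e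
    using that \<Psi>1 by (metis divide_pos_pos nonzero_mult_div_cancel_left less_irrefl times_divide_eq_right)
  then have "\<Psi> 1 * \<bar>L x0\<bar> \<le> H + m * unit_ball_vol ?n * r\<^sup>2" by (rule field_le_epsilon)
  then show ?thesis using mult_right_mono[OF mass_lower abs_ge_zero[of "L x0"]] by linarith
qed

section \<open>Pointwise smallness of the logarithmic ratio\<close>

lemma integral_swap_compact_support:
  fixes F :: "'a::euclidean_space \<Rightarrow> real \<Rightarrow> real"
  assumes F: "continuous_on ({ta..tb} \<times> UNIV) (\<lambda>z. F (snd z) (fst z))" and t: "ta \<le> tb"
    and \<psi>: "continuous_on UNIV \<psi>" "\<And>x. R \<le> norm x \<Longrightarrow> \<psi> x = 0"
  shows "continuous_on UNIV (\<lambda>x. integral {ta..tb} (F x))"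
    and "(\<integral>x. integral {ta..tb} (F x) * \<psi> x \<partial>lborel) = integral {ta..tb} (\<lambda>t. \<integral>x. F x t * \<psi> x \<partial>lborel)"
proof -
  obtain a :: 'a where a: "cball 0 R \<subseteq> cbox (- a) a"
    using bounded_subset_cbox_symmetric[OF bounded_cball] by blast
  have sw: "continuous_on (S \<times> {ta..tb}) (\<lambda>(x, t). F x t)" for S
  proof -
    have "continuous_on (S \<times> {ta..tb}) (\<lambda>w. (\<lambda>z. F (snd z) (fst z)) (snd w, fst w))"
      by (rule continuous_on_compose2[OF F]) (auto intro!: continuous_intros)
    then show ?thesis by (simp add: split_beta)
  qed
  show cL: "continuous_on UNIV (\<lambda>x. integral {ta..tb} (F x))"
    using integral_continuous_on_param[of UNIV ta tb F] sw by simp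
  have sl: "continuous_on UNIV (\<lambda>x. F x t)" if "t \<in> {ta..tb}" for t
  proof -
    have "continuous_on UNIV (\<lambda>x. (\<lambda>z. F (snd z) (fst z)) (t, x))"
      by (rule continuous_on_compose2[OF F]) (use that in \<open>auto intro!: continuous_intros\<close>)
    then show ?thesis by simp
  qed
  have "(\<integral>x. integral {ta..tb} (F x) * \<psi> x \<partial>lborel) = integral (cbox (- a) a) (\<lambda>x. integral {ta..tb} (F x) * \<psi> x)"
    by (rule lborel_integral_eq_cbox[OF _ _ a]) (use \<psi> in \<open>auto intro!: continuous_on_mult cL\<close>)
  also have "\<dots> = integral (cbox (- a) a) (\<lambda>x. integral (cbox ta tb) (\<lambda>t. F x t * \<psi> x))" by simp
  also have "\<dots> = integral (cbox ta tb) (\<lambda>t. integral (cbox (- a) a) (\<lambda>x. F x t * \<psi> x))"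
  proof (rule integral_swap_continuous)
    have "continuous_on (cbox (- a) a \<times> {ta..tb}) (\<lambda>z. (\<lambda>(x, t). F x t) z * \<psi> (fst z))"
      by (intro continuous_on_mult sw continuous_on_compose2[OF \<psi>(1)] continuous_intros) auto
    then show "continuous_on (cbox (- a, ta) (a, tb)) (\<lambda>(x, t). F x t * \<psi> x)"
      by (simp add: split_beta cbox_Pair_eq)
  qed
  also have "\<dots> = integral {ta..tb} (\<lambda>t. \<integral>x. F x t * \<psi> x \<partial>lborel)"
  proof -
    have "integral (cbox (- a) a) (\<lambda>x. F x t * \<psi> x) = (\<integral>x. F x t * \<psi> x \<partial>lborel)" if "t \<in> {ta..tb}" for t
      by (rule lborel_integral_eq_cbox[OF _ _ a, symmetric]) (use \<psi> sl[OF that] in \<open>auto intro!: continuous_on_mult\<close>)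
    then show ?thesis by (auto intro: integral_cong)
  qed
  finally show "(\<integral>x. integral {ta..tb} (F x) * \<psi> x \<partial>lborel) = integral {ta..tb} (\<lambda>t. \<integral>x. F x t * \<psi> x \<partial>lborel)" .
qed

context pinched_solution
begin

text \<open>Green's identity puts all spatial derivatives on the cutoff. The time integration that
  follows depends on this, since second partials of \<open>ln u\<close> are only available time by
  time, while \<open>g\<close> and the time derivatives are jointly continuous.\<close>

lemma log_ratio_weak_equation:
  assumes t: "0 < t" "t < T" and r: "0 < r"
  shows "(\<integral>x. g x t * cutL DIM('a) r ((norm (x - x0))\<^sup>2) \<partial>lborel)
    = (\<integral>x. (deriv (\<lambda>\<tau>. u x \<tau>) t - barenblatt_dt T k0 x t) * cut r ((norm (x - x0))\<^sup>2) \<partial>lborel)"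
proof -
  obtain p1 pp1 where p1: "c2_along_basis (\<lambda>x. ln (u x t)) p1 pp1" "\<And>x. deriv (\<lambda>\<tau>. u x \<tau>) t = (\<Sum>b\<in>Basis. pp1 b x)"
    using u_sol t unfolding smooth_positive_solution_def by force
  obtain p2 pp2 where p2: "c2_along_basis (\<lambda>x. ln (B x t)) p2 pp2" "\<And>x. barenblatt_dt T k0 x t = (\<Sum>b\<in>Basis. pp2 b x)"
    using B_sol t unfolding smooth_positive_solution_def by force
  have g: "c2_along_basis (\<lambda>x. g x t) (\<lambda>b x. p1 b x - p2 b x) (\<lambda>b x. pp1 b x - pp2 b x)"
    by (rule c2_along_basis_diff[OF p1(1) p2(1)])
  obtain p pp where p: "c2_test (r + norm x0) (\<lambda>x. cut r ((norm (x - x0))\<^sup>2)) p pp"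
    "\<And>x. (\<Sum>b\<in>Basis. pp b x) = cutL DIM('a) r ((norm (x - x0))\<^sup>2)"
    using shifted_cut_test[OF r, of x0] by blast
  have supp: "\<And>x. r + norm x0 \<le> norm x \<Longrightarrow> cut r ((norm (x - x0))\<^sup>2) = 0"
    "\<And>b x. b \<in> Basis \<Longrightarrow> r + norm x0 \<le> norm x \<Longrightarrow> pp b x = 0"
    and cont: "continuous_on UNIV (\<lambda>x. cut r ((norm (x - x0))\<^sup>2))" "\<And>b. b \<in> Basis \<Longrightarrow> continuous_on UNIV (pp b)"
    using p(1) by (auto simp: c2_test_def c2_along_basis_def supported_in_ball_def)
  have i: "integrable lborel (\<lambda>x. g x t * pp b x)"
    "integrable lborel (\<lambda>x. (pp1 b x - pp2 b x) * cut r ((norm (x - x0))\<^sup>2))" if b: "b \<in> Basis" for b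
    by (rule integrable_compact_support[where R="r + norm x0"];
        use supp b in \<open>auto intro!: continuous_on_mult cont cont_g[OF t] c2_along_basisD(2)[OF g b]\<close>)+
  have "(\<integral>x. g x t * cutL DIM('a) r ((norm (x - x0))\<^sup>2) \<partial>lborel) = (\<Sum>b\<in>Basis. \<integral>x. g x t * pp b x \<partial>lborel)"
    unfolding p(2)[symmetric] sum_distrib_left by (rule Bochner_Integration.integral_sum[OF i(1)])
  also have "\<dots> = (\<Sum>b\<in>Basis. \<integral>x. (pp1 b x - pp2 b x) * cut r ((norm (x - x0))\<^sup>2) \<partial>lborel)"
    by (intro sum.cong refl green_identity[OF g p(1), symmetric])
  also have "\<dots> = (\<integral>x. (\<Sum>b\<in>Basis. (pp1 b x - pp2 b x) * cut r ((norm (x - x0))\<^sup>2)) \<partial>lborel)"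
    by (rule Bochner_Integration.integral_sum[OF i(2), symmetric])
  also have "\<dots> = (\<integral>x. (deriv (\<lambda>\<tau>. u x \<tau>) t - barenblatt_dt T k0 x t) * cut r ((norm (x - x0))\<^sup>2) \<partial>lborel)"
    by (simp add: p1(2) p2(2) sum_subtractf flip: sum_distrib_right)
  finally show ?thesis .
qed

text \<open>At a fixed time the Laplacian of \<open>g\<close> is the time derivative of
  \<open>q\<close>, for which there is no bound; integrated over a window it becomes a difference of
  values of \<open>q\<close>, which the pinching bounds.\<close>

lemma time_integrated_log_ratio_bound:
  assumes t: "0 < ta" "ta \<le> tb" "tb < T" and r: "0 < r"
    and m: "\<And>x. \<bar>q x tb - q x ta\<bar> \<le> m"
    and H: "\<And>t. t \<in> {ta..tb} \<Longrightarrow> \<bar>\<integral>x. g x t * kernel DIM('a) r ((norm (x - x0))\<^sup>2) \<partial>lborel\<bar> \<le> H"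
  shows "kernel_mass_bound DIM('a) * \<bar>integral {ta..tb} (g x0)\<bar> \<le> H * (tb - ta) + m * unit_ball_vol DIM('a) * r\<^sup>2"
proof -
  have sub: "{ta..tb} \<subseteq> {0<..<T}" using t by auto
  have cu: "continuous_on ({ta..tb} \<times> UNIV) (\<lambda>z. u (snd z) (fst z))"
    "continuous_on ({ta..tb} \<times> UNIV) (\<lambda>z. B (snd z) (fst z))"
    "continuous_on ({ta..tb} \<times> UNIV) (\<lambda>z. deriv (\<lambda>\<tau>. u (snd z) \<tau>) (fst z))"
    "continuous_on ({ta..tb} \<times> UNIV) (\<lambda>z. barenblatt_dt T k0 (snd z :: 'a) (fst z))"
  proof -
    have c: "continuous_on (UNIV \<times> {0<..<T}) (\<lambda>(x, t). u x t)" "continuous_on (UNIV \<times> {0<..<T}) (\<lambda>(x, t). B x t)"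
      "continuous_on (UNIV \<times> {0<..<T}) (\<lambda>(x, t). deriv (\<lambda>\<tau>. u x \<tau>) t)" "continuous_on (UNIV \<times> {0<..<T}) (\<lambda>(x::'a, t). barenblatt_dt T k0 x t)"
      using u_sol B_sol unfolding smooth_positive_solution_def by blast+
    show "continuous_on ({ta..tb} \<times> UNIV) (\<lambda>z. u (snd z) (fst z))" by (rule continuous_on_swapped[OF c(1) sub subset_UNIV])
    show "continuous_on ({ta..tb} \<times> UNIV) (\<lambda>z. B (snd z) (fst z))" by (rule continuous_on_swapped[OF c(2) sub subset_UNIV])
    show "continuous_on ({ta..tb} \<times> UNIV) (\<lambda>z. deriv (\<lambda>\<tau>. u (snd z) \<tau>) (fst z))" by (rule continuous_on_swapped[OF c(3) sub subset_UNIV])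
    show "continuous_on ({ta..tb} \<times> UNIV) (\<lambda>z. barenblatt_dt T k0 (snd z :: 'a) (fst z))" by (rule continuous_on_swapped[OF c(4) sub subset_UNIV])
  qed
  have cg: "continuous_on ({ta..tb} \<times> UNIV) (\<lambda>z. g (snd z) (fst z))"
  proof (intro continuous_intros cu)
    show "\<forall>z\<in>{ta..tb} \<times> UNIV. u (snd z) (fst z) \<noteq> 0" "\<forall>z\<in>{ta..tb} \<times> UNIV. B (snd z) (fst z) \<noteq> 0"
    proof -
      have "0 < u (snd z) (fst z) \<and> 0 < B (snd z) (fst z)" if "z \<in> {ta..tb} \<times> UNIV" for z
        using pos(1)[of "fst z" "snd z"] pos(2)[of "fst z" "snd z"] that t by (auto simp: mem_Times_iff)
      then show "\<forall>z\<in>{ta..tb} \<times> UNIV. u (snd z) (fst z) \<noteq> 0" "\<forall>z\<in>{ta..tb} \<times> UNIV. B (snd z) (fst z) \<noteq> 0"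
        by (metis less_irrefl)+
    qed
  qed
  have cqt: "continuous_on ({ta..tb} \<times> UNIV) (\<lambda>z. deriv (\<lambda>\<tau>. u (snd z) \<tau>) (fst z) - barenblatt_dt T k0 (snd z :: 'a) (fst z))"
    by (intro continuous_on_diff cu)
  have far: "s\<^sup>2 \<le> (norm (x - x0))\<^sup>2" if "s + norm x0 \<le> norm x" "0 < s" for x s
    using that norm_triangle_ineq2[of x x0] by (intro power_mono) auto
  have ftc: "integral {ta..tb} (\<lambda>t. deriv (\<lambda>\<tau>. u x \<tau>) t - barenblatt_dt T k0 x t) = q x tb - q x ta" for x
  proof (rule integral_unique, rule fundamental_theorem_of_calculus[OF t(2)])
    fix s assume s: "s \<in> {ta..tb}"
    have "(u x has_real_derivative deriv (\<lambda>\<tau>. u x \<tau>) s) (at s)" "(B x has_real_derivative barenblatt_dt T k0 x s) (at s)"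
      using u_sol B_sol s t by (auto simp: smooth_positive_solution_def)
    from DERIV_diff[OF this]
    show "((\<lambda>s. q x s) has_vector_derivative deriv (\<lambda>\<tau>. u x \<tau>) s - barenblatt_dt T k0 x s) (at s within {ta..tb})"
      unfolding has_real_derivative_iff_has_vector_derivative[symmetric] by (rule DERIV_subset) simp
  qed
  have cLk: "continuous_on UNIV (\<lambda>x::'a. kernel DIM('a) s ((norm (x - x0))\<^sup>2))" "continuous_on UNIV (\<lambda>x::'a. cutL DIM('a) s ((norm (x - x0))\<^sup>2))"
    "continuous_on UNIV (\<lambda>x::'a. cut s ((norm (x - x0))\<^sup>2))" for s
    by (intro continuous_intros)+
  have weak: "(\<integral>x. integral {ta..tb} (g x) * cutL DIM('a) s ((norm (x - x0))\<^sup>2) \<partial>lborel) = (\<integral>x. (q x tb - q x ta) * cut s ((norm (x - x0))\<^sup>2) \<partial>lborel)"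
    if s: "0 < s" for s
  proof -
    have "(\<integral>x. integral {ta..tb} (g x) * cutL DIM('a) s ((norm (x - x0))\<^sup>2) \<partial>lborel)
      = integral {ta..tb} (\<lambda>t. \<integral>x. g x t * cutL DIM('a) s ((norm (x - x0))\<^sup>2) \<partial>lborel)"
      by (rule integral_swap_compact_support(2)[OF cg t(2) cLk(2), of "s + norm x0"]) (use far s kernel_eq_0 in auto)
    also have "\<dots> = integral {ta..tb} (\<lambda>t. \<integral>x. (deriv (\<lambda>\<tau>. u x \<tau>) t - barenblatt_dt T k0 x t) * cut s ((norm (x - x0))\<^sup>2) \<partial>lborel)"
      by (rule integral_cong) (use log_ratio_weak_equation[OF _ _ s] t in auto)
    also have "\<dots> = (\<integral>x. integral {ta..tb} (\<lambda>t. deriv (\<lambda>\<tau>. u x \<tau>) t - barenblatt_dt T k0 x t) * cut s ((norm (x - x0))\<^sup>2) \<partial>lborel)"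
      by (rule integral_swap_compact_support(2)[OF cqt t(2) cLk(3), of "s + norm x0", symmetric]) (use far s cut_eq_0 in auto)
    finally show ?thesis unfolding ftc .
  qed
  have cM: "continuous_on UNIV (\<lambda>x. q x tb - q x ta)"
    using t by (intro continuous_on_diff cont_u cont_B) auto
  have Hk: "\<bar>\<integral>x. integral {ta..tb} (g x) * kernel DIM('a) r ((norm (x - x0))\<^sup>2) \<partial>lborel\<bar> \<le> H * (tb - ta)"
  proof -
    have "(\<integral>x. integral {ta..tb} (g x) * kernel DIM('a) r ((norm (x - x0))\<^sup>2) \<partial>lborel)
      = integral {ta..tb} (\<lambda>t. \<integral>x. g x t * kernel DIM('a) r ((norm (x - x0))\<^sup>2) \<partial>lborel)"
      by (rule integral_swap_compact_support(2)[OF cg t(2) cLk(1), of "r + norm x0"]) (use far r kernel_eq_0 in auto)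
    \<comment> \<open>A non-integrable function has gauge integral 0, so the bound is trivial in
      that case and the two cases can be treated separately.\<close>
    moreover have "norm (integral (cbox ta tb) (\<lambda>t. \<integral>x. g x t * kernel DIM('a) r ((norm (x - x0))\<^sup>2) \<partial>lborel)) \<le> H * measure lborel (cbox ta tb)"
      if "(\<lambda>t. \<integral>x. g x t * kernel DIM('a) r ((norm (x - x0))\<^sup>2) \<partial>lborel) integrable_on cbox ta tb"
    proof (rule has_integral_bound[OF _ integrable_integral[OF that]])
      show "0 \<le> H" using H[of ta] t by (meson abs_ge_zero atLeastAtMost_iff order.refl order_trans)
    qed (use H in auto)
    moreover have "0 \<le> H * (tb - ta)" using H[of ta] t by (intro mult_nonneg_nonneg) (auto intro: order_trans[OF abs_ge_zero])
    ultimately show ?thesis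
      using t by (cases "(\<lambda>t. \<integral>x. g x t * kernel DIM('a) r ((norm (x - x0))\<^sup>2) \<partial>lborel) integrable_on cbox ta tb")
        (auto simp: not_integrable_integral)
  qed
  \<comment> \<open>The zero function serves as the compactly supported factor when only continuity
    of the time integral is extracted from the exchange lemma.\<close>
  show ?thesis
    by (rule pointwise_bound_of_weak_laplacian[OF integral_swap_compact_support(1)[OF cg t(2) continuous_on_const[of _ 0]] cM m weak r Hk]) auto
qed

section \<open>Almost monotonicity in time on short windows\<close>

lemma sc_le:
  assumes "0 \<le> \<delta>" "s \<le> t" "t < T" "T - s \<le> (1 + \<delta>) * (T - t)"
  shows "sc (real DIM('a)) T s \<le> (1 + \<delta>) * sc (real DIM('a)) T t"
proof -
  define e where "e = 2 / (real DIM('a) - 2)"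
  have e: "0 \<le> e" "e \<le> 1" using n5 by (auto simp: e_def)
  have "sc (real DIM('a)) T s \<le> ((1 + \<delta>) * (T - t)) powr e"
    unfolding sc_def e_def[symmetric] using assms e by (intro powr_mono2) auto
  also have "\<dots> = (1 + \<delta>) powr e * sc (real DIM('a)) T t" by (simp add: powr_mult sc_def e_def)
  also have "\<dots> \<le> (1 + \<delta>) powr 1 * sc (real DIM('a)) T t"
    using assms e by (intro mult_right_mono powr_mono) (auto simp: sc_def)
  finally show ?thesis using assms by simp
qed

text \<open>In the second bound one factor \<open>1 + \<delta>\<close> comes from
  \<open>T - s\<close>, the other from \<open>sc\<close>, whose exponent \<open>2 / (N - 2)\<close>
  is at most 1.\<close>

lemma barenblatt_time_monotone:
  assumes "0 < k" "0 \<le> \<delta>" "s \<le> t" "t < T" "T - s \<le> (1 + \<delta>) * (T - t)"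
  shows "barenblatt T k (x::'a) t \<le> barenblatt T k x s" "barenblatt T k x s \<le> (1 + \<delta>)\<^sup>2 * barenblatt T k x t"
proof -
  define n where "n = real DIM('a) - 2"
  have n: "3 \<le> n" using n5 by (simp add: n_def)
  define At where "At = sc (real DIM('a)) T t"
  define As where "As = sc (real DIM('a)) T s"
  have A: "0 < At" "At \<le> As" "0 < As"
    using sc_pos[OF dim3, of t T] sc_antimono[OF dim3, of s t T] sc_pos[OF dim3, of s T] assms by (auto simp: At_def As_def)
  have As: "As \<le> (1 + \<delta>) * At"
    unfolding As_def At_def by (rule sc_le[OF assms(2-5)])
  define r where "r = (norm x)\<^sup>2"
  have r: "0 \<le> r" by (simp add: r_def)
  have Bt: "barenblatt T k x t = 2 * n * ((T - t) * At) / (k + At * r)" and Bs: "barenblatt T k x s = 2 * n * ((T - s) * As) / (k + As * r)"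
    using barenblatt_sc[OF dim3, of t T k x] barenblatt_sc[OF dim3, of s T k x] assms by (auto simp: n_def At_def As_def r_def)
  have D: "0 < k + At * r" "0 < k + As * r" using assms A r by (auto intro!: add_pos_nonneg)
  have a: "At / (k + At * r) \<le> As / (k + As * r)" 
  proof -
    have "At * (k + As * r) \<le> As * (k + At * r)" using A assms mult_right_mono[of At As k] by (simp add: algebra_simps)
    then show ?thesis using D by (simp add: divide_simps mult.commute)
  qed
  have p: "0 \<le> At / (k + At * r)" using A D by simp
  have "2 * n * (T - t) * (At / (k + At * r)) \<le> 2 * n * (T - s) * (As / (k + As * r))"
    using a p assms n by (intro mult_mono) auto
  then show "barenblatt T k x t \<le> barenblatt T k x s" by (simp add: Bt Bs mult.assoc)
  have "As / (k + As * r) \<le> (1 + \<delta>) * At / (k + At * r)"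
    using A D As r assms by (intro frac_le add_left_mono mult_right_mono) auto
  then have "2 * n * (T - s) * (As / (k + As * r)) \<le> 2 * n * ((1 + \<delta>) * (T - t)) * ((1 + \<delta>) * At / (k + At * r))"
    using assms n A D by (intro mult_mono mult_left_mono) auto
  moreover have "2 * n * ((T - s) * As) / X = 2 * n * (T - s) * (As / X)"
    "(1 + \<delta>)\<^sup>2 * (2 * n * ((T - t) * At) / Y) = 2 * n * ((1 + \<delta>) * (T - t)) * ((1 + \<delta>) * At / Y)" for X Y
    by (simp_all add: power2_eq_square)
  ultimately show "barenblatt T k x s \<le> (1 + \<delta>)\<^sup>2 * barenblatt T k x t" unfolding Bt Bs by metis
qed

text \<open>The scaling inequality lets \<open>ln u\<close> rise by at most
  \<open>ln (t / s)\<close>, which is at most \<open>\<delta>\<close> because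
  \<open>t - s \<le> \<delta> (T - t)\<close> and \<open>T - t \<le> T / 2 \<le> s\<close>;
  \<open>ln B\<close> falls by at most \<open>2 \<delta>\<close>. The estimate is one-sided: it does
  not limit how fast \<open>g\<close> may decrease.\<close>

lemma log_ratio_almost_monotone:
  assumes t: "T / 2 \<le> s" "s \<le> t" "t < T" and \<delta>: "0 \<le> \<delta>" "\<delta> \<le> 1" "T - s \<le> (1 + \<delta>) * (T - t)"
  shows "g x t \<le> g x s + 3 * \<delta>"
proof -
  have s: "0 < s" "s < T" "0 < t" using t T by auto
  have "ln (u x t) \<le> ln (u x s) + \<delta>"
  proof (cases "s = t")
    case False
    then have c: "1 < t / s" using t s by simp
    have "u x (t / s * s) / (t / s) \<le> u x s" by (rule u_scaling_le[OF c s(1)]) (use s t in simp)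
    then have "u x t \<le> t / s * u x s" using s c by (simp add: field_simps)
    then have "ln (u x t) \<le> ln (t / s * u x s)" using pos(1)[OF s(3) t(3), of x] by (intro ln_mono) auto
    also have "\<dots> = ln (t / s) + ln (u x s)" using c s pos(1)[OF s(1,2), of x] by (intro ln_mult_pos) auto
    also have "ln (t / s) \<le> t / s - 1" using c by (intro ln_le_minus_one) auto
    also have "t / s - 1 = (t - s) / s" using s by (simp add: field_simps)
    also have "\<dots> \<le> \<delta>"
    proof -
      have "T - s \<le> (T - t) + \<delta> * (T - t)" using \<delta>(3) by (simp add: algebra_simps)
      then have "t - s \<le> \<delta> * (T - t)" by simp
      also have "\<dots> \<le> \<delta> * s" using \<delta> t by (intro mult_left_mono) auto
      finally show ?thesis using s by (simp add: divide_le_eq)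
    qed
    finally show ?thesis by simp
  qed (use \<delta> in simp)
  moreover have "ln (B x s) \<le> ln (B x t) + 2 * \<delta>"
  proof -
    have "ln (B x s) \<le> ln ((1 + \<delta>)\<^sup>2 * B x t)"
      using barenblatt_time_monotone(2)[OF k(3) \<delta>(1) t(2,3) \<delta>(3), of x] pos(2)[OF s(2), of x] by (intro ln_mono) auto
    also have "\<dots> = 2 * ln (1 + \<delta>) + ln (B x t)"
      using \<delta> pos(2)[OF t(3), of x] by (subst ln_mult_pos) (auto simp: ln_realpow)
    also have "ln (1 + \<delta>) \<le> \<delta>" using \<delta> by (intro ln_add_one_self_le_self) auto
    finally show ?thesis by simp
  qed
  moreover have "ln (B x t) \<le> ln (B x s)"
    using barenblatt_time_monotone(1)[OF k(3) \<delta>(1) t(2,3) \<delta>(3), of x] pos(2)[OF t(3), of x] by (intro ln_mono) auto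
  ultimately show ?thesis by linarith
qed

end

context pinched_solution
begin

section \<open>From weighted decay to pointwise smallness\<close>

lemma barenblatt_le_max:
  assumes "0 < k" "t < T"
  shows "barenblatt T k (x::'a) t \<le> 2 * (real DIM('a) - 2) * ((T - t) * sc (real DIM('a)) T t) / k"
proof -
  have "k \<le> k + sc (real DIM('a)) T t * (norm x)\<^sup>2" using sc_pos[OF dim3 assms(2)] by simp
  then show ?thesis unfolding barenblatt_sc[OF dim3 assms(2)]
    using assms sc_pos[OF dim3 assms(2)] n5 barenblatt_denominator_pos[OF dim3 assms, of x]
    by (intro divide_left_mono mult_nonneg_nonneg mult_pos_pos) auto
qed

text \<open>The kernel is at most \<open>6 r^-N\<close> and lives where the base \<open>D\<close> of
  the weight is at most \<open>Y\<close>. There |g| is at most a multiple of \<open>|q| D\<close>,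
  and writing \<open>D\<close> as \<open>D powr (- (1/4)) * D powr (5/4)\<close> brings in the
  weight of the decay estimate.\<close>

lemma kernel_average_bound:
  fixes x0 :: 'a
  assumes t: "0 < t" "t < T" and r: "0 < r"
    and Y: "km + sc (real DIM('a)) T t * (norm x0 + r)\<^sup>2 \<le> Y"
    and int: "integrable lborel (\<lambda>x. \<bar>q x t\<bar> * (km + sc (real DIM('a)) T t * (norm x)\<^sup>2) powr (- (1/4)))"
  shows "\<bar>\<integral>x. g x t * kernel DIM('a) r ((norm (x - x0))\<^sup>2) \<partial>lborel\<bar>
    \<le> 6 * inverse (r ^ DIM('a)) * (kM / km * Y powr (5/4) / (2 * (real DIM('a) - 2) * ((T - t) * sc (real DIM('a)) T t)))
      * (\<integral>x. \<bar>q x t\<bar> * (km + sc (real DIM('a)) T t * (norm x)\<^sup>2) powr (- (1/4)) \<partial>lborel)"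
proof -
  define a where "a = sc (real DIM('a)) T t"
  have a: "0 < a" unfolding a_def by (rule sc_pos[OF dim3 t(2)])
  define M where "M = 2 * (real DIM('a) - 2) * ((T - t) * a)"
  have M: "0 < M" using n5 t a by (simp add: M_def)
  define Z where "Z = 6 * inverse (r ^ DIM('a)) * (kM / km * Y powr (5/4) / M)"
  have Z: "0 \<le> Z" using r km M by (simp add: Z_def)
  have pt: "\<bar>g x t * kernel DIM('a) r ((norm (x - x0))\<^sup>2)\<bar> \<le> Z * (\<bar>q x t\<bar> * (km + a * (norm x)\<^sup>2) powr (- (1/4)))" for x
  proof (cases "norm (x - x0) \<le> r")
    case True
    define D where "D = km + a * (norm x)\<^sup>2"
    have D: "0 < D" using km a by (simp add: D_def add_pos_nonneg)
    have "norm x \<le> norm x0 + r" using True norm_triangle_ineq2[of x x0] by linarith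
    then have "(norm x)\<^sup>2 \<le> (norm x0 + r)\<^sup>2" by (intro power_mono) auto
    then have "a * (norm x)\<^sup>2 \<le> a * (norm x0 + r)\<^sup>2" using a by (intro mult_left_mono) auto
    then have DY: "D \<le> Y" using Y by (simp add: D_def a_def)
    have BkM: "barenblatt T kM x t = M / (kM + a * (norm x)\<^sup>2)"
      using barenblatt_sc[OF dim3 t(2), of kM x] by (simp add: M_def a_def)
    have "\<bar>g x t\<bar> \<le> \<bar>q x t\<bar> / barenblatt T kM x t"
      using bounds[OF t, of x] barenblatt_pos[OF dim3 km(3) t(2)] by (intro abs_ln_diff_le) auto
    also have "\<dots> = \<bar>q x t\<bar> * ((kM + a * (norm x)\<^sup>2) / M)" by (simp add: BkM)
    also have "\<dots> \<le> \<bar>q x t\<bar> * ((kM / km * D) / M)"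
    proof (intro mult_left_mono divide_right_mono)
      have "km * (a * (norm x)\<^sup>2) \<le> kM * (a * (norm x)\<^sup>2)" using km a by (intro mult_right_mono) auto
      then show "kM + a * (norm x)\<^sup>2 \<le> kM / km * D" using km(1) by (simp add: D_def field_simps)
    qed (use M in auto)
    also have "\<dots> = \<bar>q x t\<bar> * D powr (- (1/4)) * (kM / km * D powr (5/4) / M)"
    proof -
      have "D = D powr (- (1/4)) * D powr (5/4)" using D by (simp flip: powr_add)
      then have "kM / km * D / M = D powr (- (1/4)) * (kM / km * D powr (5/4) / M)"
        by (metis mult.assoc mult.commute times_divide_eq_right)
      then show ?thesis by (simp only: mult.assoc)
    qed
    also have "\<dots> \<le> \<bar>q x t\<bar> * D powr (- (1/4)) * (kM / km * Y powr (5/4) / M)"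
      using D DY km M by (intro mult_left_mono divide_right_mono powr_mono2) auto
    finally have g: "\<bar>g x t\<bar> \<le> \<bar>q x t\<bar> * D powr (- (1/4)) * (kM / km * Y powr (5/4) / M)" .
    have "\<bar>g x t * kernel DIM('a) r ((norm (x - x0))\<^sup>2)\<bar> = \<bar>g x t\<bar> * kernel DIM('a) r ((norm (x - x0))\<^sup>2)"
      using kernel_nonneg[OF r] by (simp add: abs_mult)
    also have "\<dots> \<le> (\<bar>q x t\<bar> * D powr (- (1/4)) * (kM / km * Y powr (5/4) / M)) * (6 * inverse (r ^ DIM('a)))"
      by (intro mult_mono g kernel_le kernel_nonneg r) (use km M in auto)
    finally show ?thesis by (simp add: Z_def D_def mult_ac)
  next
    case False
    then have "r\<^sup>2 \<le> (norm (x - x0))\<^sup>2" using r by (intro power_mono) auto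
    then show ?thesis using Z by (simp add: kernel_eq_0[OF r])
  qed
  have far: "r\<^sup>2 \<le> (norm (x - x0))\<^sup>2" if "r + norm x0 \<le> norm x" for x
    using that r norm_triangle_ineq2[of x x0] by (intro power_mono) auto
  have i: "integrable lborel (\<lambda>x. g x t * kernel DIM('a) r ((norm (x - x0))\<^sup>2))"
  proof (rule integrable_compact_support[where R="r + norm x0"])
    have "continuous_on UNIV (\<lambda>x::'a. kernel DIM('a) r ((norm (x - x0))\<^sup>2))" by (intro continuous_intros)
    then show "continuous_on UNIV (\<lambda>x. g x t * kernel DIM('a) r ((norm (x - x0))\<^sup>2))"
      by (rule continuous_on_mult[OF cont_g[OF t]])
  qed (use far kernel_eq_0[OF r] in auto)
  have "\<bar>\<integral>x. g x t * kernel DIM('a) r ((norm (x - x0))\<^sup>2) \<partial>lborel\<bar> \<le> (\<integral>x. \<bar>g x t * kernel DIM('a) r ((norm (x - x0))\<^sup>2)\<bar> \<partial>lborel)"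
    using integral_norm_bound[of lborel "\<lambda>x. g x t * kernel DIM('a) r ((norm (x - x0))\<^sup>2)"] by simp
  also have "\<dots> \<le> (\<integral>x. Z * (\<bar>q x t\<bar> * (km + a * (norm x)\<^sup>2) powr (- (1/4))) \<partial>lborel)"
    by (intro integral_mono pt integrable_abs i integrable_mult_right) (use int in \<open>simp add: a_def\<close>)
  also have "\<dots> = Z * (\<integral>x. \<bar>q x t\<bar> * (km + a * (norm x)\<^sup>2) powr (- (1/4)) \<partial>lborel)" by (rule integral_mult_right_zero)
  finally show ?thesis by (simp only: Z_def M_def a_def)
qed

text \<open>With \<open>A = (T - t)\<^sup>2\<^sup>/\<^sup>(\<^sup>N\<^sup>-\<^sup>2\<^sup>)\<close> the radius \<open>r = \<epsilon> A\<^sup>-\<^sup>1\<^sup>/\<^sup>2\<close> is \<open>\<epsilon>\<close> in the rescaled variable.\<close>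
lemma time_average_bound:
  fixes R \<epsilon> \<delta> :: real
  assumes \<epsilon>: "0 < \<epsilon>" "\<epsilon> \<le> 1" and \<delta>: "0 < \<delta>" "\<delta> \<le> 1" and R: "0 < R"
  defines "c \<equiv> 1 / (8 * (real DIM('a) - 2))"
    and "K1 \<equiv> 16 * (real DIM('a) - 2) * unit_ball_vol DIM('a) / (km * kernel_mass_bound DIM('a))"
  obtains C where "0 \<le> C"
    "\<And>ta tb x. T / 2 \<le> ta \<Longrightarrow> tb < T \<Longrightarrow> T - ta = (1 + \<delta>) * (T - tb) \<Longrightarrow> sc (real DIM('a)) T tb * (norm x)\<^sup>2 \<le> R\<^sup>2 \<Longrightarrow>
       \<bar>integral {ta..tb} (g x)\<bar> \<le> (C * (T - tb) powr c + K1 * \<epsilon>\<^sup>2 / \<delta>) * (tb - ta)"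
proof -
  define n where "n = real DIM('a)"
  have n: "5 \<le> n" using n5 by (simp add: n_def)
  obtain C0 where C0: "0 \<le> C0"
    and iJ: "\<And>t. T / 2 \<le> t \<Longrightarrow> t < T \<Longrightarrow> integrable lborel (\<lambda>x. \<bar>q x t\<bar> * (km + sc (real DIM('a)) T t * (norm x)\<^sup>2) powr (- (1/4)))"
    and J: "\<And>t. T / 2 \<le> t \<Longrightarrow> t < T \<Longrightarrow>
       (\<integral>x. \<bar>q x t\<bar> * (km + sc (real DIM('a)) T t * (norm x)\<^sup>2) powr (- (1/4)) \<partial>lborel) \<le> C0 * (T - t) powr c"
    unfolding c_def using weighted_decay by blast
  have c: "0 < c" using n by (simp add: c_def n_def[symmetric])
  define m0 where "m0 = kernel_mass_bound DIM('a)"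
  have m0: "0 < m0" unfolding m0_def by (rule kernel_mass_bound_pos)
  define V where "V = unit_ball_vol n"
  \<comment> \<open>The factor 2 covers the variation of \<open>sc\<close> over the window, the
    summand 1 the radius \<open>\<epsilon> \<le> 1\<close> in the rescaled variable.\<close>
  define Y where "Y = km + 2 * (R + 1)\<^sup>2"
  define P where "P = 6 * inverse (\<epsilon> ^ DIM('a)) * (kM / km * Y powr (5/4) / (2 * (n - 2)))"
  have P: "0 \<le> P" using \<epsilon> km n by (simp add: P_def)
  define C where "C = P * (C0 * 2 powr c) / m0"
  have C: "0 \<le> C" using P C0 m0 by (simp add: C_def)
  show ?thesis
  proof (rule that[OF C])
    fix ta tb and x :: 'a
    assume ta: "T / 2 \<le> ta" and tb: "tb < T" and tab: "T - ta = (1 + \<delta>) * (T - tb)"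
      and x: "sc (real DIM('a)) T tb * (norm x)\<^sup>2 \<le> R\<^sup>2"
    define \<tau> where "\<tau> = T - tb"
    have \<tau>: "0 < \<tau>" using tb by (simp add: \<tau>_def)
    have diff: "tb - ta = \<delta> * \<tau>" using tab by (simp add: \<tau>_def algebra_simps)
    have le: "ta \<le> tb" using diff \<delta> \<tau> mult_nonneg_nonneg[of \<delta> \<tau>] by linarith
    have ta0: "0 < ta" using ta T by linarith
    define sA where "sA = \<tau> powr (1 / (n - 2))"
    define A where "A = sc (real DIM('a)) T tb"
    have sA: "0 < sA" using \<tau> by (simp add: sA_def)
    have A2: "sA\<^sup>2 = A"
      using \<tau> by (simp add: sA_def A_def sc_def n_def \<tau>_def powr_power)
    have A: "0 < A" using sA A2 by (metis zero_less_power)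
    \<comment> \<open>The \<open>N\<close>-th power of the rescaling factor \<open>sA\<close> is the
      amplitude factor \<open>\<tau> * A\<close> of the Barenblatt solutions. This makes
      \<open>r^-N\<close> cancel the denominator in \<open>kernel_average_bound\<close>, so that the
      constant \<open>C\<close> does not depend on the window.\<close>
    have AN: "sA ^ DIM('a) = \<tau> * A"
    proof -
      have "sA ^ DIM('a) = \<tau> powr (n / (n - 2))" using \<tau> by (simp add: sA_def powr_power n_def)
      also have "n / (n - 2) = 1 + 2 / (n - 2)" using n by (simp add: field_simps)
      also have "\<tau> powr (1 + 2 / (n - 2)) = \<tau> * A" using \<tau> by (simp add: powr_add A_def sc_def n_def \<tau>_def)
      finally show ?thesis .
    qed
    define r where "r = \<epsilon> / sA"
    have r: "0 < r" using \<epsilon> sA by (simp add: r_def)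
    have Ar: "A * r\<^sup>2 = \<epsilon>\<^sup>2" using sA by (simp add: r_def power_divide flip: A2)
    have rN: "inverse (r ^ DIM('a)) = inverse (\<epsilon> ^ DIM('a)) * (\<tau> * A)"
      unfolding r_def power_divide AN by (simp add: divide_inverse)
    have win: "A \<le> sc (real DIM('a)) T t" "sc (real DIM('a)) T t \<le> 2 * A" "\<tau> \<le> T - t" "T - t \<le> 2 * \<tau>" "T / 2 \<le> t" "0 < t" "t < T"
      if t: "t \<in> {ta..tb}" for t
    proof -
      show "A \<le> sc (real DIM('a)) T t" unfolding A_def using t tb by (intro sc_antimono[OF dim3]) auto
      have "T - t \<le> (1 + \<delta>) * \<tau>" using t tab by (simp add: \<tau>_def)
      also have "\<dots> \<le> (1 + 1) * \<tau>" using \<delta> \<tau> by (intro mult_right_mono) auto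
      finally have *: "T - t \<le> (1 + 1) * \<tau>" .
      then show "T - t \<le> 2 * \<tau>" by simp
      show "sc (real DIM('a)) T t \<le> 2 * A"
        using sc_le[of 1 t tb] t tb * by (simp add: A_def \<tau>_def)
      show "\<tau> \<le> T - t" "T / 2 \<le> t" "0 < t" "t < T" using t tb ta ta0 by (auto simp: \<tau>_def)
    qed
    define H where "H = P * (C0 * 2 powr c) * \<tau> powr c"
    have H: "\<bar>\<integral>y. g y t * kernel DIM('a) r ((norm (y - x))\<^sup>2) \<partial>lborel\<bar> \<le> H" if t: "t \<in> {ta..tb}" for t
    proof -
      note w = win[OF t]
      have "sA * norm x \<le> R"
      proof (rule power2_le_imp_le)
        show "(sA * norm x)\<^sup>2 \<le> R\<^sup>2" using x by (simp add: power_mult_distrib A2 A_def)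
      qed (use R in simp)
      then have "sA * (norm x + r) \<le> R + 1" using sA \<epsilon> by (simp add: r_def distrib_left)
      then have "(sA * (norm x + r))\<^sup>2 \<le> (R + 1)\<^sup>2" using sA r by (intro power_mono) auto
      then have "A * (norm x + r)\<^sup>2 \<le> (R + 1)\<^sup>2" by (simp add: power_mult_distrib A2)
      moreover have "sc (real DIM('a)) T t * (norm x + r)\<^sup>2 \<le> 2 * A * (norm x + r)\<^sup>2"
        using w by (intro mult_right_mono) auto
      ultimately have Yb: "km + sc (real DIM('a)) T t * (norm x + r)\<^sup>2 \<le> Y" unfolding Y_def by linarith
      define J' where "J' = (\<integral>x. \<bar>q x t\<bar> * (km + sc (real DIM('a)) T t * (norm x)\<^sup>2) powr (- (1/4)) \<partial>lborel)"
      have J0: "0 \<le> J'" unfolding J'_def by (rule Bochner_Integration.integral_nonneg) simp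
      have "\<bar>\<integral>y. g y t * kernel DIM('a) r ((norm (y - x))\<^sup>2) \<partial>lborel\<bar>
        \<le> 6 * inverse (r ^ DIM('a)) * (kM / km * Y powr (5/4) / (2 * (n - 2) * ((T - t) * sc (real DIM('a)) T t))) * J'"
        unfolding J'_def n_def by (rule kernel_average_bound[OF w(6,7) r Yb iJ[OF w(5,7)]])
      also have "\<dots> \<le> 6 * inverse (r ^ DIM('a)) * (kM / km * Y powr (5/4) / (2 * (n - 2) * (\<tau> * A))) * J'"
      proof -
        have "2 * (n - 2) * (\<tau> * A) \<le> 2 * (n - 2) * ((T - t) * sc (real DIM('a)) T t)"
          using w \<tau> A n by (intro mult_left_mono mult_mono) auto
        moreover have "0 < 2 * (n - 2) * (\<tau> * A)" using \<tau> A n by (intro mult_pos_pos) auto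
        moreover have "0 \<le> kM / km * Y powr (5/4)" using km by (intro mult_nonneg_nonneg divide_nonneg_nonneg) auto
        ultimately have "kM / km * Y powr (5/4) / (2 * (n - 2) * ((T - t) * sc (real DIM('a)) T t)) \<le> kM / km * Y powr (5/4) / (2 * (n - 2) * (\<tau> * A))"
          by (intro frac_le) auto
        then show ?thesis using r J0 by (intro mult_right_mono mult_left_mono) auto
      qed
      also have "\<dots> = P * J'"
      proof -
        have "inverse (\<epsilon> ^ DIM('a)) * (\<tau> * A) * (Z / (2 * (n - 2) * (\<tau> * A))) = inverse (\<epsilon> ^ DIM('a)) * (Z / (2 * (n - 2)))" for Z
          using \<tau> A by simp
        then show ?thesis unfolding rN P_def by (metis mult.assoc)
      qed
      also have "\<dots> \<le> P * (C0 * (2 * \<tau>) powr c)"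
      proof (intro mult_left_mono P)
        have "J' \<le> C0 * (T - t) powr c" unfolding J'_def by (rule J[OF w(5,7)])
        also have "\<dots> \<le> C0 * (2 * \<tau>) powr c" using C0 w c by (intro mult_left_mono powr_mono2) auto
        finally show "J' \<le> C0 * (2 * \<tau>) powr c" .
      qed
      also have "\<dots> = H" by (simp add: H_def powr_mult)
      finally show ?thesis .
    qed
    \<comment> \<open>Over the window \<open>T - t\<close> and \<open>sc\<close> at most double, so
      |q| is at most \<open>2 * 2 * 2 (n - 2) \<tau> A / km\<close> at each end; the two ends
      together give 16.\<close>
    define m where "m = 16 * (n - 2) * (\<tau> * A) / km"
    have m: "\<bar>q y tb - q y ta\<bar> \<le> m" for y
    proof -
      have *: "\<bar>q y t\<bar> \<le> 8 * (n - 2) * (\<tau> * A) / km" if t: "t \<in> {ta..tb}" for t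
      proof -
        note w = win[OF t]
        have "\<bar>q y t\<bar> \<le> barenblatt T km y t"
          using bounds[OF w(6,7), of y] pos(1)[OF w(6,7), of y] pos(2)[OF w(7), of y] by linarith
        also have "\<dots> \<le> 2 * (n - 2) * ((T - t) * sc (real DIM('a)) T t) / km"
          using barenblatt_le_max[OF km(1) w(7)] by (simp add: n_def)
        also have "\<dots> \<le> 2 * (n - 2) * ((2 * \<tau>) * (2 * A)) / km"
          using w n km \<tau> A by (intro divide_right_mono mult_left_mono mult_mono) auto
        also have "2 * (n - 2) * ((2 * \<tau>) * (2 * A)) = 8 * (n - 2) * (\<tau> * A)" by simp
        finally show ?thesis .
      qed
      have "\<bar>q y tb\<bar> \<le> m / 2" "\<bar>q y ta\<bar> \<le> m / 2" 
      proof -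
        have half: "16 * w * z / K / 2 = 8 * w * z / K" for w z K :: real by simp
        show "\<bar>q y tb\<bar> \<le> m / 2" "\<bar>q y ta\<bar> \<le> m / 2" unfolding m_def half using *[of tb] *[of ta] le by simp_all
      qed
      then show ?thesis by linarith
    qed
    have "m0 * \<bar>integral {ta..tb} (g x)\<bar> \<le> H * (tb - ta) + m * V * r\<^sup>2"
      using time_integrated_log_ratio_bound[OF ta0 le tb r m H] by (simp add: m0_def V_def n_def)
    \<comment> \<open>\<open>m * r^2\<close> is of order \<open>\<epsilon>^2 * \<tau>\<close> while
      the window has length \<open>\<delta> * \<tau>\<close>; this is the origin of the quotient of
      \<open>\<epsilon>^2\<close> by \<open>\<delta>\<close>.\<close>
    also have "m * V * r\<^sup>2 = m0 * (K1 * \<epsilon>\<^sup>2 / \<delta>) * (tb - ta)"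
    proof -
      have "m * V * r\<^sup>2 = 16 * (n - 2) * \<tau> * V * (A * r\<^sup>2) / km" by (simp add: m_def)
      also have "\<dots> = m0 * (16 * (n - 2) * V / (km * m0) * \<epsilon>\<^sup>2 / \<delta>) * (\<delta> * \<tau>)"
      proof -
        have "16 * w * \<tau> * V * E / K = m0 * (16 * w * V / (K * m0) * E / \<delta>) * (\<delta> * \<tau>)" if "0 < K" for w E K
          using that m0 \<delta>(1) by (simp add: field_simps)
        then show ?thesis unfolding Ar using km(1) by blast
      qed
      finally show ?thesis by (simp add: K1_def diff n_def V_def m0_def)
    qed
    also have "H * (tb - ta) = m0 * (C * \<tau> powr c) * (tb - ta)" using m0 by (simp add: H_def C_def)
    finally have "m0 * \<bar>integral {ta..tb} (g x)\<bar> \<le> m0 * ((C * \<tau> powr c + K1 * \<epsilon>\<^sup>2 / \<delta>) * (tb - ta))"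
      by (simp add: algebra_simps)
    then show "\<bar>integral {ta..tb} (g x)\<bar> \<le> (C * (T - tb) powr c + K1 * \<epsilon>\<^sup>2 / \<delta>) * (tb - ta)"
      using m0 by (simp add: \<tau>_def)
  qed
qed

text \<open>Three shares of \<open>\<eta> / 3\<close>, chosen in this order: \<open>\<delta>\<close>
  for the loss in almost monotonicity, then \<open>\<epsilon>\<close> for
  \<open>K1 * \<epsilon>^2 / \<delta>\<close>, and last the time for the decaying term, whose
  constant depends on \<open>\<epsilon>\<close>. The bound \<open>T / 4\<close> keeps the windows
  inside the second half of the time interval.\<close>

lemma log_ratio_small:
  assumes \<eta>: "0 < \<eta>" and R: "0 < R"
  obtains \<tau>0 where "0 < \<tau>0" "\<tau>0 \<le> T / 4"
    "\<And>t x. T - \<tau>0 \<le> t \<Longrightarrow> t < T \<Longrightarrow> sc (real DIM('a)) T t * (norm x)\<^sup>2 \<le> R\<^sup>2 \<Longrightarrow> \<bar>g x t\<bar> \<le> \<eta>"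
proof -
  define c where "c = 1 / (8 * (real DIM('a) - 2))"
  define K1 where "K1 = 16 * (real DIM('a) - 2) * unit_ball_vol DIM('a) / (km * kernel_mass_bound DIM('a))"
  have c: "0 < c" using n5 by (simp add: c_def)
  have K1: "0 < K1" unfolding K1_def using n5 km kernel_mass_bound_pos[of "DIM('a)"] by (intro divide_pos_pos mult_pos_pos) auto
  define \<delta> where "\<delta> = min 1 (\<eta> / 9)"
  have \<delta>: "0 < \<delta>" "\<delta> \<le> 1" "3 * \<delta> \<le> \<eta> / 3" using \<eta> by (auto simp: \<delta>_def)
  define \<epsilon> where "\<epsilon> = min 1 (\<eta> * \<delta> / (3 * K1))"
  have \<epsilon>: "0 < \<epsilon>" "\<epsilon> \<le> 1" "\<epsilon> \<le> \<eta> * \<delta> / (3 * K1)" using \<eta> \<delta> K1 by (auto simp: \<epsilon>_def)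
  have "\<epsilon>\<^sup>2 \<le> \<eta> * \<delta> / (3 * K1)"
  proof -
    have "\<epsilon>\<^sup>2 \<le> 1 * \<epsilon>" unfolding power2_eq_square using \<epsilon> by (intro mult_right_mono) auto
    then show ?thesis using \<epsilon>(3) by simp
  qed
  then have K: "K1 * \<epsilon>\<^sup>2 / \<delta> \<le> \<eta> / 3" using K1 \<delta> by (simp add: field_simps)
  obtain C where C: "0 \<le> C"
    "\<And>ta tb x. T / 2 \<le> ta \<Longrightarrow> tb < T \<Longrightarrow> T - ta = (1 + \<delta>) * (T - tb) \<Longrightarrow> sc (real DIM('a)) T tb * (norm x)\<^sup>2 \<le> R\<^sup>2 \<Longrightarrow>
       \<bar>integral {ta..tb} (g x)\<bar> \<le> (C * (T - tb) powr c + K1 * \<epsilon>\<^sup>2 / \<delta>) * (tb - ta)"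
    using time_average_bound[OF \<epsilon>(1,2) \<delta>(1,2) R] unfolding c_def K1_def by blast
  define \<tau>1 where "\<tau>1 = (\<eta> / (3 * (C + 1))) powr (1 / c)"
  have \<tau>1: "0 < \<tau>1" using \<eta> C by (simp add: \<tau>1_def)
  have small: "C * \<tau> powr c \<le> \<eta> / 3" if "0 < \<tau>" "\<tau> \<le> \<tau>1" for \<tau>
  proof -
    have "\<tau> powr c \<le> \<tau>1 powr c" using that c by (intro powr_mono2) auto
    also have "\<dots> = \<eta> / (3 * (C + 1))" using \<eta> C c by (simp add: \<tau>1_def powr_powr)
    finally have "C * \<tau> powr c \<le> C * (\<eta> / (3 * (C + 1)))" using C by (intro mult_left_mono) auto
    also have "\<dots> \<le> (C + 1) * (\<eta> / (3 * (C + 1)))" using C \<eta> by (intro mult_right_mono) auto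
    also have "\<dots> = \<eta> / 3"
    proof -
      have "C + 1 \<noteq> 0" using C(1) by linarith
      then show ?thesis by (simp add: divide_simps)
    qed
    finally show ?thesis .
  qed
  define \<tau>0 where "\<tau>0 = min \<tau>1 (T / 4)"
  \<comment> \<open>As \<open>g\<close> almost decreases, its average over a window bounds it from
    above at the right end and from below at the left end; hence two different windows for the two
    signs.\<close>
  have window: "g x tb \<le> \<eta>" "- \<eta> \<le> g x ta"
    if ta: "T / 2 \<le> ta" and tb: "tb < T" "T - tb \<le> \<tau>1" and eq: "T - ta = (1 + \<delta>) * (T - tb)" and x: "sc (real DIM('a)) T tb * (norm x)\<^sup>2 \<le> R\<^sup>2" for ta tb x
  proof -
    have d: "tb - ta = \<delta> * (T - tb)" using eq by (simp add: algebra_simps)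
    then have lt: "ta < tb" using \<delta> tb by (metis diff_gt_0_iff_gt mult_pos_pos)
    have tt: "0 < T - tb" using tb by simp
    have cg: "continuous_on {ta..tb} (g x)"
    proof -
      have "isCont (\<lambda>t. g x t) s" if "s \<in> {ta..tb}" for s
      proof -
        have s: "0 < s" "s < T" using that ta tb T by auto
        have "(u x has_real_derivative deriv (\<lambda>\<tau>. u x \<tau>) s) (at s)" "(B x has_real_derivative barenblatt_dt T k0 x s) (at s)"
          using u_sol B_sol s by (auto simp: smooth_positive_solution_def)
        then have "isCont (u x) s" "isCont (B x) s" by (auto intro: DERIV_isCont)
        then show ?thesis using pos(1)[OF s, of x] pos(2)[OF s(2), of x] by (intro isCont_diff isCont_ln'[unfolded o_def] continuous_intros) auto
      qed
      then show ?thesis by (intro continuous_at_imp_continuous_on) auto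
    qed
    have i: "g x integrable_on {ta..tb}" by (rule integrable_continuous_real[OF cg])
    have up: "\<bar>integral {ta..tb} (g x)\<bar> \<le> (2 * \<eta> / 3) * (tb - ta)"
    proof -
      have "\<bar>integral {ta..tb} (g x)\<bar> \<le> (C * (T - tb) powr c + K1 * \<epsilon>\<^sup>2 / \<delta>) * (tb - ta)"
        by (rule C(2)[OF ta tb(1) eq x])
      also have "\<dots> \<le> (2 * \<eta> / 3) * (tb - ta)"
        using small[OF tt tb(2)] K lt by (intro mult_right_mono) auto
      finally show ?thesis .
    qed
    have m: "g x tb \<le> g x t + 3 * \<delta>" "g x t \<le> g x ta + 3 * \<delta>" if t: "t \<in> {ta..tb}" for t
    proof -
      have "T - t \<le> (1 + \<delta>) * (T - tb)" using eq t by auto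
      then show "g x tb \<le> g x t + 3 * \<delta>" using t ta tb \<delta> by (intro log_ratio_almost_monotone) auto
      have "T - tb \<le> T - t" using t by simp
      then have "(1 + \<delta>) * (T - tb) \<le> (1 + \<delta>) * (T - t)" using \<delta> by (intro mult_left_mono) auto
      then show "g x t \<le> g x ta + 3 * \<delta>" using t ta tb \<delta> eq by (intro log_ratio_almost_monotone) auto
    qed
    have pos_d: "0 < tb - ta" using lt by simp
    have "(g x tb - 3 * \<delta>) * (tb - ta) = integral {ta..tb} (\<lambda>t. g x tb - 3 * \<delta>)" using lt by simp
    also have "\<dots> \<le> integral {ta..tb} (g x)" by (intro integral_le i) (use m(1) in force)+
    also have "\<dots> \<le> (2 * \<eta> / 3) * (tb - ta)" using up by linarith
    finally have "g x tb - 3 * \<delta> \<le> 2 * \<eta> / 3" using pos_d by (rule mult_right_le_imp_le)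
    then show "g x tb \<le> \<eta>" using \<delta>(3) by linarith
    have "(- (2 * \<eta> / 3)) * (tb - ta) \<le> integral {ta..tb} (g x)" using up by linarith
    also have "\<dots> \<le> integral {ta..tb} (\<lambda>t. g x ta + 3 * \<delta>)" by (intro integral_le i) (use m(2) in force)+
    also have "\<dots> = (g x ta + 3 * \<delta>) * (tb - ta)" using lt by simp
    finally have "- (2 * \<eta> / 3) \<le> g x ta + 3 * \<delta>" using pos_d by (rule mult_right_le_imp_le)
    then show "- \<eta> \<le> g x ta" using \<delta>(3) by linarith
  qed
  show ?thesis
  proof (rule that[of \<tau>0])
    show "0 < \<tau>0" "\<tau>0 \<le> T / 4" using \<tau>1 T by (auto simp: \<tau>0_def)
    fix t and x :: 'a assume t: "T - \<tau>0 \<le> t" "t < T" and x: "sc (real DIM('a)) T t * (norm x)\<^sup>2 \<le> R\<^sup>2"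
    have t': "T - t \<le> \<tau>1" "T - t \<le> T / 4" using t by (auto simp: \<tau>0_def)
    have "g x t \<le> \<eta>"
    proof (rule window(1)[where ta="T - (1 + \<delta>) * (T - t)"])
      have "(1 + \<delta>) * (T - t) \<le> 2 * (T / 4)" using \<delta> t t' by (intro mult_mono) auto
      then show "T / 2 \<le> T - (1 + \<delta>) * (T - t)" by simp
    qed (use t t' x in auto)
    moreover have "- \<eta> \<le> g x t"
    proof -
      \<comment> \<open>For the lower bound \<open>t\<close> becomes the left end of its window; the
        right end is even closer to \<open>T\<close>, so the smallness conditions persist.\<close>
      define tb where "tb = T - (T - t) / (1 + \<delta>)"
      have tb: "(1 + \<delta>) * (T - tb) = T - t" using \<delta> by (simp add: tb_def)
      have "0 < (T - t) / (1 + \<delta>)" using t \<delta> by simp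
      then have tb1: "tb < T" by (simp add: tb_def)
      have "(T - t) / (1 + \<delta>) \<le> (T - t) / 1" using t \<delta> by (intro divide_left_mono) auto
      then have tb2: "t \<le> tb" "T - tb \<le> \<tau>1" using t' by (auto simp: tb_def)
      have "sc (real DIM('a)) T tb * (norm x)\<^sup>2 \<le> sc (real DIM('a)) T t * (norm x)\<^sup>2"
        by (intro mult_right_mono sc_antimono[OF dim3 tb2(1) tb1]) auto
      then show ?thesis using window(2)[OF _ tb1 tb2(2) tb[symmetric], of x] x t' T by linarith
    qed
    ultimately show "\<bar>g x t\<bar> \<le> \<eta>" by linarith
  qed
qed

end

section \<open>Convergence in rescaled variables\<close>

lemma lborel_integral_dilate:
  fixes F :: "'a::euclidean_space \<Rightarrow> real"
  assumes c: "0 < c" and F: "F \<in> borel_measurable borel" and i: "integrable lborel (\<lambda>x. F (c *\<^sub>R x))"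
  shows "integrable lborel F" "(\<integral>x. F x \<partial>lborel) = c ^ DIM('a) * (\<integral>x. F (c *\<^sub>R x) \<partial>lborel)"
proof -
  have eq: "lborel = density (distr lborel borel (\<lambda>x::'a. 0 + c *\<^sub>R x)) (\<lambda>_. ennreal (c ^ DIM('a)))"
    using lborel_affine[of c 0] c by simp
  have m: "(\<lambda>x::'a. 0 + c *\<^sub>R x) \<in> lborel \<rightarrow>\<^sub>M borel" by measurable
  have "integrable (distr lborel borel (\<lambda>x::'a. 0 + c *\<^sub>R x)) (\<lambda>x. c ^ DIM('a) *\<^sub>R F x)"
    using i F c by (subst integrable_distr_eq[OF m]) auto
  then show "integrable lborel F"
    by (subst eq, subst integrable_density) (use F c in auto)
  have "(\<integral>x. F x \<partial>lborel) = (\<integral>x. c ^ DIM('a) *\<^sub>R F x \<partial>distr lborel borel (\<lambda>x::'a. 0 + c *\<^sub>R x))"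
    by (subst eq, subst integral_density) (use F c in auto)
  also have "\<dots> = (\<integral>x. c ^ DIM('a) *\<^sub>R F (0 + c *\<^sub>R x) \<partial>lborel)"
    by (rule integral_distr[OF m]) (use F in auto)
  finally show "(\<integral>x. F x \<partial>lborel) = c ^ DIM('a) * (\<integral>x. F (c *\<^sub>R x) \<partial>lborel)" by simp
qed

context pinched_solution
begin

text \<open>\<open>\<sigma>\<close> is the factor in \<open>y = \<sigma> x\<close>. The identity for
  \<open>\<sigma> ^ DIM('a)\<close> says that the Jacobian equals the amplitude factor, so
  unweighted L1 norms of differences are invariant under rescaling.\<close>

lemma rescaled_diff:
  assumes s: "exp (- s) < T"
  obtains \<sigma> where "0 < \<sigma>" "\<sigma>\<^sup>2 = sc (real DIM('a)) T (T - exp (- s))" "\<sigma> ^ DIM('a) = exp (- s) * \<sigma>\<^sup>2"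
    "\<And>y. rescaled T u y s - rescaled_barenblatt k0 y = q (y /\<^sub>R \<sigma>) (T - exp (- s)) / (exp (- s) * \<sigma>\<^sup>2)"
    "\<And>k y. 0 < k \<Longrightarrow> barenblatt T k ((y::'a) /\<^sub>R \<sigma>) (T - exp (- s)) / (exp (- s) * \<sigma>\<^sup>2) = rescaled_barenblatt k y"
proof -
  define n where "n = real DIM('a)"
  have n: "5 \<le> n" using n5 by (simp add: n_def)
  define \<tau> where "\<tau> = exp (- s)"
  define t where "t = T - \<tau>"
  have \<tau>: "0 < \<tau>" "T - t = \<tau>" "t < T" by (auto simp: \<tau>_def t_def)
  define \<sigma> where "\<sigma> = \<tau> powr (1 / (n - 2))"
  have \<sigma>: "0 < \<sigma>" using \<tau> by (simp add: \<sigma>_def)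
  have s2: "\<sigma>\<^sup>2 = sc (real DIM('a)) T t" using \<tau> by (simp add: \<sigma>_def sc_def n_def powr_power)
  have "n / (n - 2) = 1 + 2 / (n - 2)" using n by (simp add: field_simps)
  then have pn: "\<tau> powr (n / (n - 2)) = \<tau> * \<sigma>\<^sup>2" using \<tau> by (simp add: powr_add s2 sc_def n_def)
  moreover have "\<sigma> ^ DIM('a) = \<tau> powr (n / (n - 2))" using \<tau> by (simp add: \<sigma>_def powr_power n_def)
  ultimately have sN: "\<sigma> ^ DIM('a) = \<tau> * \<sigma>\<^sup>2" by simp
  have b: "barenblatt T k (y /\<^sub>R \<sigma>) t / (\<tau> * \<sigma>\<^sup>2) = rescaled_barenblatt k y" for k and y :: 'a
  proof -
    have "\<sigma>\<^sup>2 * (norm (y /\<^sub>R \<sigma>))\<^sup>2 = (norm y)\<^sup>2" using \<sigma> by (simp add: power_mult_distrib power_inverse)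
    then show ?thesis
      using barenblatt_sc[OF dim3 \<tau>(3), of k "y /\<^sub>R \<sigma>"] \<tau> \<sigma> by (simp add: s2[symmetric] rescaled_barenblatt_def)
  qed
  have "rescaled T u y s = u (y /\<^sub>R \<sigma>) t / (\<tau> * \<sigma>\<^sup>2)" for y
    unfolding rescaled_def Let_def \<tau>_def[symmetric] t_def[symmetric] \<tau>(2) pn[unfolded n_def] \<sigma>_def[symmetric, unfolded n_def]
    by simp
  then have "rescaled T u y s - rescaled_barenblatt k0 y = q (y /\<^sub>R \<sigma>) t / (\<tau> * \<sigma>\<^sup>2)" for y
    by (simp add: b[of k0 y, symmetric] diff_divide_distrib)
  then show ?thesis using that[of \<sigma>] \<sigma> s2 sN b unfolding \<tau>_def t_def by blast
qed

lemma eventually_exp_neg_less: "0 < \<tau> \<Longrightarrow> \<forall>\<^sub>F s in at_top. exp (- s) < (\<tau>::real)"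
proof -
  assume \<tau>: "0 < \<tau>"
  have "\<forall>\<^sub>F s in at_top. - ln \<tau> < s" by (rule eventually_gt_at_top)
  then show ?thesis
  proof eventually_elim
    case (elim s)
    then have "exp (- s) < exp (ln \<tau>)" by (subst exp_less_cancel_iff) linarith
    then show ?case using \<tau> by simp
  qed
qed

text \<open>For \<open>|y| > R\<close> the common bound by the rescaled profile with
  \<open>km\<close> is already at most \<open>e / 2\<close>; for \<open>|y| \<le> R\<close> one has
  \<open>|q| \<le> |g|\<close> times the upper Barenblatt solution and
  \<open>log_ratio_small\<close> applies. \<open>R\<close> and \<open>\<eta>\<close> are chosen to
  give \<open>e / 2\<close> in either region.\<close>

lemma uniform_convergence: "uniform_limit UNIV (\<lambda>s x. rescaled T u x s) (rescaled_barenblatt k0) at_top"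
  unfolding uniform_limit_iff
proof (intro allI impI)
  fix e :: real assume e: "0 < e"
  define N where "N = 2 * (real DIM('a) - 2)"
  have N: "0 < N" using n5 by (simp add: N_def)
  define R where "R = sqrt (2 * N / e)"
  have R: "0 < R" "R\<^sup>2 = 2 * N / e" using e N by (auto simp: R_def)
  define \<eta> where "\<eta> = e * km / (2 * N)"
  have \<eta>: "0 < \<eta>" using e km N by (simp add: \<eta>_def)
  obtain \<tau>0 where \<tau>0: "0 < \<tau>0" "\<tau>0 \<le> T / 4"
    "\<And>t x. T - \<tau>0 \<le> t \<Longrightarrow> t < T \<Longrightarrow> sc (real DIM('a)) T t * (norm x)\<^sup>2 \<le> R\<^sup>2 \<Longrightarrow> \<bar>g x t\<bar> \<le> \<eta>"
    using log_ratio_small[OF \<eta> R(1)] by blast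
  show "\<forall>\<^sub>F s in at_top. \<forall>x\<in>UNIV. dist (rescaled T u x s) (rescaled_barenblatt k0 x) < e"
    using eventually_exp_neg_less[OF \<tau>0(1)]
  proof eventually_elim
    case (elim s)
    define t where "t = T - exp (- s)"
    have t: "0 < t" "t < T" "T - \<tau>0 \<le> t" "exp (- s) < T" using elim \<tau>0 T by (auto simp: t_def)
    obtain \<sigma> where \<sigma>: "0 < \<sigma>" "\<sigma>\<^sup>2 = sc (real DIM('a)) T t"
      "\<And>y. rescaled T u y s - rescaled_barenblatt k0 y = q (y /\<^sub>R \<sigma>) t / (exp (- s) * \<sigma>\<^sup>2)"
      "\<And>k y. 0 < k \<Longrightarrow> barenblatt T k ((y::'a) /\<^sub>R \<sigma>) t / (exp (- s) * \<sigma>\<^sup>2) = rescaled_barenblatt k y"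
      using rescaled_diff[OF t(4)] unfolding t_def by metis
    show ?case
    proof
      fix y :: 'a
      define x where "x = y /\<^sub>R \<sigma>"
      have x2: "sc (real DIM('a)) T t * (norm x)\<^sup>2 = (norm y)\<^sup>2"
        using \<sigma>(1) unfolding \<sigma>(2)[symmetric] x_def by (simp add: power_mult_distrib power_inverse)
      have M: "0 < exp (- s) * \<sigma>\<^sup>2" using \<sigma>(1) by simp
      note b = bounds[OF t(1,2), of x] pos(1)[OF t(1,2), of x] pos(2)[OF t(2), of x]
      have Bk: "0 < barenblatt T km x t" by (rule barenblatt_pos[OF dim3 km(1) t(2)])
      have rb: "barenblatt T km x t / (exp (- s) * \<sigma>\<^sup>2) = N / (km + (norm y)\<^sup>2)"
        using \<sigma>(4)[OF km(1), of y] by (simp add: x_def rescaled_barenblatt_def N_def)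
      have dd: "dist (rescaled T u y s) (rescaled_barenblatt k0 y) = \<bar>q x t\<bar> / (exp (- s) * \<sigma>\<^sup>2)"
        using \<sigma>(3)[of y] M by (simp add: dist_real_def x_def)
      show "dist (rescaled T u y s) (rescaled_barenblatt k0 y) < e"
      proof (cases "(norm y)\<^sup>2 \<le> R\<^sup>2")
        case True
        have "\<bar>q x t\<bar> / barenblatt T km x t \<le> \<bar>g x t\<bar>" using b by (intro abs_ln_diff_ge) auto
        also have "\<dots> \<le> \<eta>" by (rule \<tau>0(3)[OF t(3,2)]) (use True x2 in simp)
        finally have "\<bar>q x t\<bar> \<le> \<eta> * barenblatt T km x t" using Bk by (simp add: divide_le_eq)
        then have "\<bar>q x t\<bar> / (exp (- s) * \<sigma>\<^sup>2) \<le> \<eta> * barenblatt T km x t / (exp (- s) * \<sigma>\<^sup>2)"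
          using M by (intro divide_right_mono) auto
        also have "\<dots> = \<eta> * (N / (km + (norm y)\<^sup>2))" using rb by (metis times_divide_eq_right)
        also have "\<dots> \<le> \<eta> * (N / km)"
          using \<eta> N km(1) by (intro mult_left_mono divide_left_mono mult_pos_pos add_pos_nonneg) auto
        also have "\<dots> = e / 2"
        proof -
          have "e * K / (2 * N) * (N / K) = e / 2" if "0 < K" for K using that N by (simp add: divide_simps)
          then show ?thesis unfolding \<eta>_def using km(1) by blast
        qed
        also have "\<dots> < e" using e by simp
        finally show ?thesis unfolding dd .
      next
        case False
        have "\<bar>q x t\<bar> \<le> barenblatt T km x t" using b by linarith
        then have "\<bar>q x t\<bar> / (exp (- s) * \<sigma>\<^sup>2) \<le> N / (km + (norm y)\<^sup>2)"
          unfolding rb[symmetric] using M by (intro divide_right_mono) auto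
        also have "\<dots> \<le> N / R\<^sup>2"
        proof (intro divide_left_mono mult_pos_pos)
          show "R\<^sup>2 \<le> km + (norm y)\<^sup>2" using False km(1) by linarith
          show "0 < km + (norm y)\<^sup>2" using km(1) zero_le_power2[of "norm y"] by linarith
        qed (use N R(1) in auto)
        also have "\<dots> = e / 2" using N e by (simp add: R(2))
        also have "\<dots> < e" using e by simp
        finally show ?thesis unfolding dd .
      qed
    qed
  qed
qed

text \<open>For \<open>N \<ge> 5\<close> the exponent \<open>(N - 4) / 2\<close> is at least 1/2, so
  the weight is dominated by the one of exponent 1/4, whose norm of the difference decays like a
  power of \<open>exp (- s)\<close>.\<close>

lemma weighted_L1_convergence:
  "tendsto_weighted_L1 (\<lambda>x::'a. rescaled_barenblatt k2 x powr ((real DIM('a) - 4) / 2))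
     (\<lambda>s x. rescaled T u x s) (rescaled_barenblatt k0) at_top"
proof -
  define \<beta> where "\<beta> = (real DIM('a) - 4) / 2"
  have \<beta>: "1 / 2 \<le> \<beta>" using n5 by (simp add: \<beta>_def)
  define N where "N = 2 * (real DIM('a) - 2)"
  have N: "0 < N" using n5 by (simp add: N_def)
  define w where "w x = rescaled_barenblatt k2 x powr \<beta>" for x :: 'a
  \<comment> \<open>Replacing \<open>k2\<close> by \<open>km\<close> only increases the weight; the
    excess power \<open>1/4 - \<beta>\<close> is negative, hence largest at the origin, where its
    base is \<open>km\<close>.\<close>
  define K where "K = N powr \<beta> * km powr (1/4 - \<beta>)"
  have K: "0 \<le> K" by (simp add: K_def)
  have w0: "0 \<le> w x" for x by (simp add: w_def)
  have w: "w x \<le> K * (km + (norm x)\<^sup>2) powr (- (1/4))" for x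
  proof -
    have d: "0 < km + (norm x)\<^sup>2" "km + (norm x)\<^sup>2 \<le> k2 + (norm x)\<^sup>2" "km \<le> km + (norm x)\<^sup>2"
      using km(1) zero_le_power2[of "norm x"] by (auto intro: add_pos_nonneg)
    have "w x \<le> (N / (km + (norm x)\<^sup>2)) powr \<beta>"
      unfolding w_def rescaled_barenblatt_def N_def[symmetric]
      using d N \<beta> by (intro powr_mono2 divide_left_mono mult_pos_pos) auto
    also have "\<dots> = N powr \<beta> * ((km + (norm x)\<^sup>2) powr (1/4 - \<beta>) * (km + (norm x)\<^sup>2) powr (- (1/4)))"
    proof -
      have "(km + (norm x)\<^sup>2) powr (- \<beta>) = (km + (norm x)\<^sup>2) powr ((1/4 - \<beta>) + (- (1/4)))" by simp
      also have "\<dots> = (km + (norm x)\<^sup>2) powr (1/4 - \<beta>) * (km + (norm x)\<^sup>2) powr (- (1/4))" by (rule powr_add)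
      finally have "(km + (norm x)\<^sup>2) powr (1/4 - \<beta>) * (km + (norm x)\<^sup>2) powr (- (1/4)) = inverse ((km + (norm x)\<^sup>2) powr \<beta>)"
        by (simp only: powr_minus)
      moreover have "(N / (km + (norm x)\<^sup>2)) powr \<beta> = N powr \<beta> / (km + (norm x)\<^sup>2) powr \<beta>"
        by (rule powr_divide)
      ultimately show ?thesis by (simp only: divide_inverse)
    qed
    also have "\<dots> \<le> N powr \<beta> * (km powr (1/4 - \<beta>) * (km + (norm x)\<^sup>2) powr (- (1/4)))"
      using d km(1) \<beta> by (intro mult_left_mono mult_right_mono powr_mono2') auto
    finally show ?thesis by (simp add: K_def)
  qed
  have cw: "continuous_on UNIV w"
  proof -
    have nz: "k2 + (norm x)\<^sup>2 \<noteq> 0" for x :: 'a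
      using k(1) zero_le_power2[of "norm x"] by linarith
    then have "rescaled_barenblatt k2 x \<noteq> 0" for x :: 'a using n5 by (simp add: rescaled_barenblatt_def)
    with nz show ?thesis unfolding w_def rescaled_barenblatt_def by (intro continuous_intros) auto
  qed
  obtain C where C: "0 \<le> C"
    "\<And>t. T / 2 \<le> t \<Longrightarrow> t < T \<Longrightarrow> integrable lborel (\<lambda>x. \<bar>q x t\<bar> * (km + sc (real DIM('a)) T t * (norm x)\<^sup>2) powr (- (1/4)))"
    "\<And>t. T / 2 \<le> t \<Longrightarrow> t < T \<Longrightarrow>
       (\<integral>x. \<bar>q x t\<bar> * (km + sc (real DIM('a)) T t * (norm x)\<^sup>2) powr (- (1/4)) \<partial>lborel) \<le> C * (T - t) powr (1 / (8 * (real DIM('a) - 2)))"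
    using weighted_decay by blast
  define D where "D s x = rescaled T u x s - rescaled_barenblatt k0 x" for s and x :: 'a
  have main: "D s \<in> weighted_L1 w \<and> 0 \<le> weighted_L1_norm w (D s) \<and> weighted_L1_norm w (D s) \<le> K * (C * exp (- s) powr (1 / (8 * (real DIM('a) - 2))))"
    if s: "exp (- s) < T / 2" for s
  proof -
    define t where "t = T - exp (- s)"
    have t: "0 < t" "t < T" "T / 2 \<le> t" "exp (- s) < T" "T - t = exp (- s)" using s T by (auto simp: t_def)
    obtain \<sigma> where \<sigma>: "0 < \<sigma>" "\<sigma>\<^sup>2 = sc (real DIM('a)) T t" "\<sigma> ^ DIM('a) = exp (- s) * \<sigma>\<^sup>2"
      "\<And>y. D s y = q (y /\<^sub>R \<sigma>) t / (exp (- s) * \<sigma>\<^sup>2)"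
      using rescaled_diff[OF t(4)] unfolding t_def D_def by metis
    have M: "0 < exp (- s) * \<sigma>\<^sup>2" using \<sigma>(1) by simp
    have cq: "continuous_on UNIV (\<lambda>x. q x t)" by (intro continuous_on_diff cont_u cont_B t)
    have "continuous_on UNIV (\<lambda>y. q (y /\<^sub>R \<sigma>) t / (exp (- s) * \<sigma>\<^sup>2))"
      using M by (intro continuous_on_divide continuous_on_const continuous_on_compose2[OF cq] continuous_intros) auto
    then have cD: "continuous_on UNIV (D s)" by (simp add: \<sigma>(4)[abs_def] fun_eq_iff[of "D s", THEN iffD2, OF allI[OF \<sigma>(4)]])
    define F where "F y = \<bar>D s y\<bar> * (km + (norm y)\<^sup>2) powr (- (1/4))" for y
    have cF: "continuous_on UNIV F"
      unfolding F_def using continuous_on_mult[OF continuous_on_rabs[OF cD] cont_weight[OF km(1), of 1 "- (1/4)"]] by simp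
    have F_scale: "F (\<sigma> *\<^sub>R x) = \<bar>q x t\<bar> * (km + sc (real DIM('a)) T t * (norm x)\<^sup>2) powr (- (1/4)) / (exp (- s) * \<sigma>\<^sup>2)" for x
      using \<sigma>(1) M by (simp add: F_def \<sigma>(4) abs_mult power_mult_distrib flip: \<sigma>(2))
    have iF: "integrable lborel F" and F_eq: "(\<integral>y. F y \<partial>lborel) = \<sigma> ^ DIM('a) * (\<integral>x. F (\<sigma> *\<^sub>R x) \<partial>lborel)"
      by (rule lborel_integral_dilate[OF \<sigma>(1) borel_measurable_continuous_onI[OF cF]];
          use C(2)[OF t(3,2)] in \<open>simp add: F_scale\<close>)+
    \<comment> \<open>The Jacobian cancels the amplitude factor, and the weight in \<open>y\<close>
      becomes the time-dependent weight of \<open>weighted_decay\<close> in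
      \<open>x\<close>.\<close>
    have "(\<integral>y. F y \<partial>lborel) = (\<integral>x. \<bar>q x t\<bar> * (km + sc (real DIM('a)) T t * (norm x)\<^sup>2) powr (- (1/4)) \<partial>lborel)"
      unfolding F_eq F_scale \<sigma>(3) using \<sigma>(1) by simp
    also have "\<dots> \<le> C * exp (- s) powr (1 / (8 * (real DIM('a) - 2)))" using C(3)[OF t(3,2)] by (simp add: t(5))
    finally have F_le: "(\<integral>y. F y \<partial>lborel) \<le> C * exp (- s) powr (1 / (8 * (real DIM('a) - 2)))" .
    have cDw: "continuous_on UNIV (\<lambda>x. \<bar>D s x\<bar> * w x)" by (intro continuous_on_mult continuous_on_rabs cD cw)
    then have m: "(\<lambda>x. \<bar>D s x\<bar> * w x) \<in> borel_measurable lborel" by (simp add: borel_measurable_continuous_onI)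
    have le: "\<bar>D s x\<bar> * w x \<le> K * F x" for x
      using mult_left_mono[OF w[of x], of "\<bar>D s x\<bar>"] by (simp add: F_def mult_ac)
    have i: "integrable lborel (\<lambda>x. \<bar>D s x\<bar> * w x)"
    proof (rule Bochner_Integration.integrable_bound[OF integrable_mult_right[OF iF, of K] m])
      show "AE x in lborel. norm (\<bar>D s x\<bar> * w x) \<le> norm (K * F x)"
      proof (intro AE_I2)
        fix x
        have "norm (\<bar>D s x\<bar> * w x) = \<bar>D s x\<bar> * w x" using w0[of x] by simp
        also have "\<dots> \<le> norm (K * F x)" using le[of x] by simp
        finally show "norm (\<bar>D s x\<bar> * w x) \<le> norm (K * F x)" .
      qed
    qed
    have "D s \<in> borel_measurable lebesgue"
      using borel_measurable_continuous_onI[OF cD] by (simp add: measurable_completion)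
    then have 1: "D s \<in> weighted_L1 w" using i by (simp add: weighted_L1_def integrable_completion[OF m])
    have n: "weighted_L1_norm w (D s) = (\<integral>x. \<bar>D s x\<bar> * w x \<partial>lborel)"
      unfolding weighted_L1_norm_def by (rule integral_completion[OF m])
    have "(\<integral>x. \<bar>D s x\<bar> * w x \<partial>lborel) \<le> (\<integral>x. K * F x \<partial>lborel)" by (intro integral_mono i integrable_mult_right iF le)
    also have "\<dots> = K * (\<integral>x. F x \<partial>lborel)" by simp
    also have "\<dots> \<le> K * (C * exp (- s) powr (1 / (8 * (real DIM('a) - 2))))" by (rule mult_left_mono[OF F_le K])
    finally have 2: "weighted_L1_norm w (D s) \<le> K * (C * exp (- s) powr (1 / (8 * (real DIM('a) - 2))))" unfolding n .
    have "0 \<le> weighted_L1_norm w (D s)" unfolding n by (rule Bochner_Integration.integral_nonneg) (use w0 in simp)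
    then show ?thesis using 1 2 by simp
  qed
  have ev: "\<forall>\<^sub>F s in at_top. exp (- s) < T / 2" by (rule eventually_exp_neg_less) (use T in simp)
  have "((\<lambda>s. weighted_L1_norm w (D s)) \<longlongrightarrow> 0) at_top"
  proof (rule real_tendsto_sandwich)
    show "\<forall>\<^sub>F s in at_top. 0 \<le> weighted_L1_norm w (D s)" "\<forall>\<^sub>F s in at_top. weighted_L1_norm w (D s) \<le> K * (C * exp (- s) powr (1 / (8 * (real DIM('a) - 2))))"
      using ev main by (auto elim!: eventually_mono)
    have "((\<lambda>s::real. exp (- s)) \<longlongrightarrow> 0) at_top"
      using filterlim_compose[OF exp_at_bot filterlim_uminus_at_bot_at_top] .
    then have "((\<lambda>s::real. exp (- s) powr (1 / (8 * (real DIM('a) - 2)))) \<longlongrightarrow> 0 powr (1 / (8 * (real DIM('a) - 2)))) at_top"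
      using n5 by (intro tendsto_powr') auto
    then have "((\<lambda>s::real. K * (C * exp (- s) powr (1 / (8 * (real DIM('a) - 2))))) \<longlongrightarrow> K * (C * 0)) at_top"
      by (intro tendsto_mult tendsto_const) simp
    then show "((\<lambda>s::real. K * (C * exp (- s) powr (1 / (8 * (real DIM('a) - 2))))) \<longlongrightarrow> 0) at_top" by simp
  qed simp
  moreover have "\<forall>\<^sub>F s in at_top. D s \<in> weighted_L1 w" using ev main by (auto elim!: eventually_mono)
  ultimately show ?thesis unfolding tendsto_weighted_L1_def D_def w_def \<beta>_def by simp
qed

end

theorem theorem1p2:
  fixes u :: "real ^ 'n \<Rightarrow> real \<Rightarrow> real" and u0 f :: "real ^ 'n \<Rightarrow> real"
    and T k0 k1 k2 :: real
  assumes "5 \<le> CARD('n)" and "0 < T"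
    and "log_diffusion_solution T u0 u"
    and "0 < k2" and "k2 < k1" and "0 < k0"
    and "AE x in lebesgue. barenblatt T k1 x 0 \<le> u0 x \<and> u0 x \<le> barenblatt T k2 x 0"
    and "integrable lebesgue f"
    and "AE x in lebesgue. u0 x = barenblatt T k0 x 0 + f x"
    and "\<And>x t. 0 < t \<Longrightarrow> t < T \<Longrightarrow> barenblatt T k1 x t \<le> u x t \<and> u x t \<le> barenblatt T k2 x t"
  shows "uniform_limit UNIV (\<lambda>s x. rescaled T u x s) (rescaled_barenblatt k0) at_top \<and>
    tendsto_weighted_L1 (\<lambda>x. rescaled_barenblatt k2 x powr ((real CARD('n) - 4) / 2))
      (\<lambda>s x. rescaled T u x s) (rescaled_barenblatt k0) at_top"
proof -
  interpret pinched_solution T k0 k1 k2 u u0 f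
    by unfold_locales (use assms in auto)
  show ?thesis
    using uniform_convergence weighted_L1_convergence by simp
qed

end
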